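(* The high-SNR asymptotic capacities of the EC-OIC and of the BC-OIC satisfy $$\lim_{\sigma\downarrow0^+}\left[\mathsf{C}_{\mathrm E}(\mathbf{h},\boldsymbol{\alpha},\sigma)-\log\frac1\sigma\right]=-\frac12\log2\pi e+\gamma_{\mathrm E},\qquad \lim_{\sigma\downarrow0^+}\left[\mathsf{C}_{\mathrm B}(\mathbf{h},\boldsymbol{\alpha},\sigma)-\log\frac1\sigma\right]=-\frac12\log2\pi e+\gamma_{\mathrm B},$$ where, writing $$G(\nu_0,\lambda_0,\dots,\lambda_{n-1})=\sum_{i=0}^{n-1}\lambda_i(1-\mathsf{H}_{[i]})\bar\alpha_i-1-\nu_0+e^{\nu_0}\left\{\sum_{k=1}^n h_k\exp\left[-\lambda_0\mathsf{H}_{[k-1]}+\sum_{i=1}^{k-2}\lambda_i\big(\mathsf{H}_{[i]}-\mathsf{H}_{[k-1]}\big)\right]\zeta\left[\left(-\sum_{i=0}^{k-1}\lambda_i\right)h_k\right]\right\}$$ with $\zeta(x)=\frac{e^x-1}{x}$ (and $\zeta(0)=1$), $$\gamma_{\mathrm E}=\min_{\nu_0,\lambda_0\in\mathbb{R},\ \lambda_1,\dots,\lambda_{n-1}\ge0}G,\qquad \gamma_{\mathrm B}=\min_{\nu_0\in\mathbb{R},\ \lambda_0,\dots,\lambda_{n-1}\ge0}G.$$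
   Context: Let $n\ge 2$ be an integer, $\mathbf{h}=(h_1,\dots,h_n)^{\mathsf T}$ with $h_k>0$ and $\sum_{k=1}^n h_k=1$, and $\boldsymbol{\alpha}=(\alpha_1,\dots,\alpha_n)^{\mathsf T}$ with $1\ge\alpha_1>\alpha_2>\cdots>\alpha_n>0$ and $\alpha_n\le \tfrac12$. Put $\mathsf{H}_{[0]}=0$, $\mathsf{H}_{[k]}=\sum_{i=1}^k h_i$ and $\bar\alpha_k=\frac{\sum_{i=k+1}^n h_i\alpha_i}{1-\mathsf{H}_{[k]}}$ for $0\le k\le n-1$. Empty sums are $0$. Channel: $Y=\mathbf{h}^{\mathsf T}\mathbf{X}+Z$ with $Z\sim\mathcal{N}(0,\sigma^2)$, $\sigma>0$, independent of $\mathbf{X}=(X_1,\dots,X_n)^{\mathsf T}$. Capacities: $\mathsf{C}_{\mathrm E}(\mathbf{h},\boldsymbol{\alpha},\sigma)$ (EC-OIC), respectively $\mathsf{C}_{\mathrm B}(\mathbf{h},\boldsymbol{\alpha},\sigma)$ (BC-OIC), is $\sup I(\mathbf{X};Y)$ over all laws of $\mathbf{X}$ with $0\le X_k\le1$ (almost surely) and $\mathbb{E}[X_k]=\alpha_k$, respectively $\mathbb{E}[X_k]\le\alpha_k$, for all $k\in\{1,\dots,n\}$. $I$ is mutual information in nats; $\log$ is the natural logarithm.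
   Formalization: The minima defining γ_E and γ_B are read as infima, since for α₁ = 1 the minimum defining γ_E is not attained; attainment is also proved for γ_B always and for γ_E when α₁ < 1, and G is shown bounded below on the γ_E set. *)

theory Defs
  imports "HOL-Probability.Probability"
begin

text \<open>
  Vectors \<open>h\<close>, \<open>\<alpha>\<close>, \<open>x\<close> are functions on \<open>nat\<close> of which only the
  components with indices \<open>1, \<dots>, n\<close> matter. The law of the random vector \<open>X\<close> is a probability measure
  on \<^term>\<open>Pi\<^sub>M {1..n} (\<lambda>_. borel)\<close>.
\<close>

abbreviation input_space :: "nat \<Rightarrow> (nat \<Rightarrow> real) measure" where
  "input_space n \<equiv> (\<Pi>\<^sub>M k\<in>{1..n}. (borel :: real measure))"

definition bounded_input_laws :: "nat \<Rightarrow> (nat \<Rightarrow> real) measure set" where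
  "bounded_input_laws n =
     {\<mu>. prob_space \<mu> \<and> sets \<mu> = sets (input_space n) \<and>
         (\<forall>k\<in>{1..n}. AE x in \<mu>. 0 \<le> x k \<and> x k \<le> 1)}"

definition EC_laws :: "nat \<Rightarrow> (nat \<Rightarrow> real) \<Rightarrow> (nat \<Rightarrow> real) measure set" where
  "EC_laws n \<alpha> = {\<mu> \<in> bounded_input_laws n. \<forall>k\<in>{1..n}. (\<integral>x. x k \<partial>\<mu>) = \<alpha> k}"

definition BC_laws :: "nat \<Rightarrow> (nat \<Rightarrow> real) \<Rightarrow> (nat \<Rightarrow> real) measure set" where
  "BC_laws n \<alpha> = {\<mu> \<in> bounded_input_laws n. \<forall>k\<in>{1..n}. (\<integral>x. x k \<partial>\<mu>) \<le> \<alpha> k}"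

text \<open>
  The joint law of \<open>(X, Z)\<close> is a product measure, so \<open>Z\<close> is independent of \<open>X\<close>.
  The logarithm to base \<^term>\<open>exp 1\<close> measures information in nats.
\<close>

definition channel_space :: "real \<Rightarrow> (nat \<Rightarrow> real) measure \<Rightarrow> ((nat \<Rightarrow> real) \<times> real) measure" where
  "channel_space \<sigma> \<mu> = \<mu> \<Otimes>\<^sub>M density lborel (\<lambda>z. ennreal (normal_density 0 \<sigma> z))"

definition channel_output :: "nat \<Rightarrow> (nat \<Rightarrow> real) \<Rightarrow> (nat \<Rightarrow> real) \<times> real \<Rightarrow> real" where
  "channel_output n h = (\<lambda>(x, z). (\<Sum>k=1..n. h k * x k) + z)"

definition channel_information ::
    "nat \<Rightarrow> (nat \<Rightarrow> real) \<Rightarrow> real \<Rightarrow> (nat \<Rightarrow> real) measure \<Rightarrow> real" where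
  "channel_information n h \<sigma> \<mu> =
     prob_space.mutual_information (channel_space \<sigma> \<mu>) (exp 1) (input_space n) borel
       fst (channel_output n h)"

definition capacity_EC :: "nat \<Rightarrow> (nat \<Rightarrow> real) \<Rightarrow> (nat \<Rightarrow> real) \<Rightarrow> real \<Rightarrow> ereal" where
  "capacity_EC n h \<alpha> \<sigma> = (SUP \<mu>\<in>EC_laws n \<alpha>. ereal (channel_information n h \<sigma> \<mu>))"

definition capacity_BC :: "nat \<Rightarrow> (nat \<Rightarrow> real) \<Rightarrow> (nat \<Rightarrow> real) \<Rightarrow> real \<Rightarrow> ereal" where
  "capacity_BC n h \<alpha> \<sigma> = (SUP \<mu>\<in>BC_laws n \<alpha>. ereal (channel_information n h \<sigma> \<mu>))"

definition H_sum :: "(nat \<Rightarrow> real) \<Rightarrow> nat \<Rightarrow> real" where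
  "H_sum h k = (\<Sum>i=1..k. h i)"

definition alpha_bar :: "nat \<Rightarrow> (nat \<Rightarrow> real) \<Rightarrow> (nat \<Rightarrow> real) \<Rightarrow> nat \<Rightarrow> real" where
  "alpha_bar n h \<alpha> k = (\<Sum>i=k+1..n. h i * \<alpha> i) / (1 - H_sum h k)"

definition zeta :: "real \<Rightarrow> real" where
  "zeta x = (if x = 0 then 1 else (exp x - 1) / x)"

text \<open>
  The argument is the pair \<open>(\<nu>\<^sub>0, \<lambda>)\<close>. For \<open>k = 1\<close>
  the truncated \<open>k - 2\<close> gives the empty sum, as intended.
\<close>

definition G ::
    "nat \<Rightarrow> (nat \<Rightarrow> real) \<Rightarrow> (nat \<Rightarrow> real) \<Rightarrow> real \<times> (nat \<Rightarrow> real) \<Rightarrow> real" where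
  "G n h \<alpha> = (\<lambda>(\<nu>\<^sub>0, l).
     (\<Sum>i=0..n-1. l i * (1 - H_sum h i) * alpha_bar n h \<alpha> i) - 1 - \<nu>\<^sub>0 +
     exp \<nu>\<^sub>0 *
       (\<Sum>k=1..n. h k *
          exp (- l 0 * H_sum h (k - 1) + (\<Sum>i=1..k-2. l i * (H_sum h i - H_sum h (k - 1)))) *
          zeta ((- (\<Sum>i=0..k-1. l i)) * h k)))"

definition EC_multipliers :: "nat \<Rightarrow> (real \<times> (nat \<Rightarrow> real)) set" where
  "EC_multipliers n = {(\<nu>\<^sub>0, l). \<forall>i\<in>{1..n-1}. 0 \<le> l i}"

definition BC_multipliers :: "nat \<Rightarrow> (real \<times> (nat \<Rightarrow> real)) set" where
  "BC_multipliers n = {(\<nu>\<^sub>0, l). \<forall>i\<in>{0..n-1}. 0 \<le> l i}"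

text \<open>
  Infima rather than minima: for \<open>\<alpha> 1 = 1\<close> the function \<open>G\<close>
  has no minimum over \<^term>\<open>EC_multipliers n\<close>, since it strictly decreases along
  \<open>(\<nu>\<^sub>0 - t * h 1, \<lambda>\<^sub>0 - t, \<lambda>\<^sub>1 + t, \<lambda>\<^sub>2, \<dots>)\<close> as \<open>t\<close> increases.
\<close>

definition gamma_EC :: "nat \<Rightarrow> (nat \<Rightarrow> real) \<Rightarrow> (nat \<Rightarrow> real) \<Rightarrow> real" where
  "gamma_EC n h \<alpha> = (INF p\<in>EC_multipliers n. G n h \<alpha> p)"

definition gamma_BC :: "nat \<Rightarrow> (nat \<Rightarrow> real) \<Rightarrow> (nat \<Rightarrow> real) \<Rightarrow> real" where
  "gamma_BC n h \<alpha> = (INF p\<in>BC_multipliers n. G n h \<alpha> p)"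

end

theory Submission
  imports Defs
begin

text \<open>
  Put \<open>S = \<Sum> h\<^sub>k X\<^sub>k\<close>. The information equals the differential entropy of \<open>S + Z\<close> minus that of the
  noise, so the limit is governed by the largest entropy of a law of \<open>S\<close> on the unit interval. Since
  the first \<open>k\<close> channels contribute at most \<open>H\<^sub>k\<close>, the mean of \<open>max 0 (S - H\<^sub>k)\<close> is at most the sum of
  \<open>h\<^sub>i \<alpha>\<^sub>i\<close> over \<open>i > k\<close>. Conversely these
  constraints suffice: filling the channels greedily in order gives means with the right suffix
  sums, and weighted Robin Hood transfers turn them into the prescribed decreasing means.

  \<open>G\<close> is the Lagrange dual of entropy maximization under these constraints. Each multiplier gives an
  upper bound by the Gibbs inequality with an exponential density. At a minimizer the first order
  conditions say that this exponential density is itself feasible with entropy \<open>G\<close>, and adding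
  noise to it does not lower the entropy.
\<close>

section \<open>The dual function\<close>

text \<open>Everything happens on the dual side, so no entropy maximizing density has to be found by
  a limiting argument; what must be secured is a minimizer of the dual function. Its linear part is
  minus the mean of the log-density under a law on the knots with weights
  \<open>\<alpha> j - \<alpha> (j + 1)\<close>, where 1 precedes \<open>\<alpha> 1\<close> and 0
  follows \<open>\<alpha> n\<close>. Strict decrease makes these weights positive, an interior point
  condition in the sense of Slater, and this makes the dual function coercive. The weight of the
  knot 0 is \<open>1 - \<alpha> 1\<close>; that it vanishes for \<open>\<alpha> 1 = 1\<close> is the
  obstacle behind the separate treatment of that case. The hinge at 0 is \<open>S\<close> itself, so
  prescribed means fix its expectation and free the sign of \<open>\<lambda>\<^sub>0\<close>; the
  other hinges give only inequalities, hence nonnegative multipliers. Both bounds must survive the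
  supremum over input laws: the upper one has an error of order \<open>sqrt \<sigma>\<close>
  independent of the law, and the lower one uses a single law for all \<sigma>.\<close>

definition hinge :: "real \<Rightarrow> real \<Rightarrow> real" where
  "hinge b s = max 0 (s - b)"

definition hinge_sum :: "nat \<Rightarrow> (nat \<Rightarrow> real) \<Rightarrow> (nat \<Rightarrow> real) \<Rightarrow> real \<Rightarrow> real" where
  "hinge_sum N a l s = (\<Sum>i<N. l i * hinge (a i) s)"

text \<open>Lagrange dual of maximizing the entropy of a density on \<open>{a 0..a N}\<close> whose
  hinge moments are bounded by \<open>c\<close>. The knots are parameters because
  \<open>EC_saturated\<close> needs the problem on \<open>{h 1..1}\<close> as well.\<close>

definition dual :: "nat \<Rightarrow> (nat \<Rightarrow> real) \<Rightarrow> (nat \<Rightarrow> real) \<Rightarrow> real \<Rightarrow> (nat \<Rightarrow> real) \<Rightarrow> real" where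
  "dual N a c \<nu> l = (\<Sum>i<N. l i * c i) - 1 - \<nu> +
     integral {a 0..a N} (\<lambda>s. exp (\<nu> - hinge_sum N a l s))"

lemma continuous_on_hinge [continuous_intros]: "continuous_on A (hinge b)"
  unfolding hinge_def by (intro continuous_intros)

lemma hinge_lipschitz: "\<bar>hinge b s - hinge b t\<bar> \<le> \<bar>s - t\<bar>"
  by (simp add: hinge_def max_def)

lemma continuous_on_hinge_sum [continuous_intros]: "continuous_on A (hinge_sum N a l)"
  unfolding hinge_sum_def by (intro continuous_intros)

lemma hinge_sum_lipschitz:
  "\<bar>hinge_sum N a l s - hinge_sum N a l t\<bar> \<le> (\<Sum>i<N. \<bar>l i\<bar>) * \<bar>s - t\<bar>"
proof -
  have "\<bar>hinge_sum N a l s - hinge_sum N a l t\<bar> = \<bar>\<Sum>i<N. l i * (hinge (a i) s - hinge (a i) t)\<bar>"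
    by (simp add: hinge_sum_def sum_subtractf right_diff_distrib)
  also have "\<dots> \<le> (\<Sum>i<N. \<bar>l i * (hinge (a i) s - hinge (a i) t)\<bar>)"
    by (rule sum_abs)
  also have "\<dots> \<le> (\<Sum>i<N. \<bar>l i\<bar> * \<bar>s - t\<bar>)"
    by (intro sum_mono) (auto simp: abs_mult intro!: mult_left_mono hinge_lipschitz)
  finally show ?thesis
    by (simp add: sum_distrib_right)
qed

section \<open>Coercivity of the dual function\<close>

text \<open>\<open>M\<close> will be the maximum of the log-density at the knots and
  \<open>D\<close> its oscillation there. Minimizing over \<open>M\<close> leaves
  \<open>1 + ln (A / (1 + D))\<close>, a loss only logarithmic in \<open>D\<close>, which
  \<open>q * D\<close> outweighs; once \<open>D\<close> is bounded, the exponential outweighs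
  \<open>M\<close>.\<close>

lemma coercive_scalar:
  fixes A q B :: real
  assumes "A > 0" "q > 0"
  shows "\<exists>R. \<forall>M D. 0 \<le> D \<longrightarrow> A * exp M / (1 + D) - M + q * D \<le> B \<longrightarrow> \<bar>M\<bar> \<le> R \<and> D \<le> R"
proof -
  define D0 where "D0 = \<bar>2 * (B - ln A - ln (q / 2)) / q\<bar> + 1"
  define \<kappa> where "\<kappa> = A / (1 + D0)"
  have "D0 > 0" unfolding D0_def by (rule add_nonneg_pos) auto
  hence \<kappa>: "\<kappa> > 0" using assms by (simp add: \<kappa>_def)
  define R where "R = max D0 (max \<bar>B\<bar> (2 * (1 + \<bar>B\<bar>) / \<kappa> + 1))"
  show ?thesis
  proof (intro exI[of _ R] allI impI)
    fix M D :: real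
    assume D: "0 \<le> D" and le: "A * exp M / (1 + D) - M + q * D \<le> B"
    have "exp (M + ln (A / (1 + D))) = A * exp M / (1 + D)"
      using assms D by (simp add: exp_add)
    moreover have "1 + (M + ln (A / (1 + D))) \<le> exp (M + ln (A / (1 + D)))"
      by (rule exp_ge_add_one_self)
    ultimately have 1: "1 + ln (A / (1 + D)) + q * D \<le> B"
      using le by linarith
    \<comment> \<open>A tangent bound of slope \<open>q / 2\<close> on the logarithm consumes half
      of \<open>q * D\<close> and leaves the other half; this is the origin of
      \<open>D0\<close>.\<close>
    have "ln ((q / 2) * (1 + D)) \<le> (q / 2) * (1 + D) - 1"
      using assms D by (intro ln_le_minus_one) auto
    hence 2: "ln (1 + D) \<le> (q / 2) * (1 + D) - 1 - ln (q / 2)"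
      using ln_mult_pos[of "q / 2" "1 + D"] assms D by simp
    have "ln (A / (1 + D)) = ln A - ln (1 + D)"
      using assms D by (simp add: ln_div)
    hence "(q / 2) * D \<le> B - ln A - ln (q / 2) + q / 2"
      using 1 2 by (simp add: algebra_simps)
    hence "D \<le> (B - ln A - ln (q / 2) + q / 2) / (q / 2)"
      using assms by (simp add: pos_le_divide_eq mult.commute)
    also have "\<dots> = 2 * (B - ln A - ln (q / 2)) / q + 1"
      using assms by (simp add: add_divide_distrib)
    also have "\<dots> \<le> D0"
      unfolding D0_def by (intro add_right_mono abs_ge_self)
    finally have D_le: "D \<le> D0" .
    have lo: "- M \<le> B" 
    proof -
      have "0 \<le> q * D" "0 \<le> A * exp M / (1 + D)" using assms D by simp_all
      thus ?thesis using le by linarith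
    qed
    have "\<kappa> * exp M \<le> A * exp M / (1 + D)"
      unfolding \<kappa>_def times_divide_eq_left
      using assms D D_le by (intro divide_left_mono) auto
    hence 3: "\<kappa> * exp M - M \<le> B"
      using le mult_nonneg_nonneg[of q D] assms D by linarith
    have "M \<le> 2 * (1 + \<bar>B\<bar>) / \<kappa> + 1"
    proof (cases "M \<ge> 1")
      case True
      have "1 + M + M\<^sup>2 / 2 \<le> exp M"
        using True by (intro exp_lower_Taylor_quadratic) auto
      hence "\<kappa> * (M\<^sup>2 / 2) \<le> \<kappa> * exp M"
        using \<kappa> True by (intro mult_left_mono) auto
      hence "\<kappa> * M\<^sup>2 / 2 \<le> \<bar>B\<bar> + M" using 3 by simp
      also have "\<dots> \<le> (1 + \<bar>B\<bar>) * M"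
        using mult_left_mono[of 1 M "\<bar>B\<bar>"] True by (simp add: algebra_simps)
      finally have "\<kappa> * M / 2 * M \<le> (1 + \<bar>B\<bar>) * M" by (simp add: power2_eq_square)
      hence "\<kappa> * M / 2 \<le> 1 + \<bar>B\<bar>" using True by (simp add: mult_le_cancel_right)
      thus ?thesis using \<kappa> by (simp add: field_simps)
    next
      case False
      moreover have "0 \<le> 2 * (1 + \<bar>B\<bar>) / \<kappa>" using \<kappa> by simp
      ultimately show ?thesis by linarith
    qed
    thus "\<bar>M\<bar> \<le> R \<and> D \<le> R"
      using lo D_le unfolding R_def by (auto simp: abs_le_iff)
  qed
qed

locale knots =
  fixes N :: nat and a :: "nat \<Rightarrow> real"
  assumes N_pos: "0 < N" and knot_less: "\<And>k. k < N \<Longrightarrow> a k < a (Suc k)"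
begin

lemma knot_mono: "i \<le> j \<Longrightarrow> j \<le> N \<Longrightarrow> a i \<le> a j"
proof (induction j rule: nat_induct)
  case (Suc j)
  thus ?case using knot_less[of j] by (cases "i = Suc j") force+
qed simp

text \<open>On a gap the hinges at knots up to \<open>a k\<close> have slope 1 and the later ones
  vanish. Values at the knots thus determine the partial sums of \<open>l\<close>, which is how
  bounds on the multipliers are recovered.\<close>

lemma hinge_sum_piece:
  assumes "k < N" "a k \<le> s" "s \<le> a (Suc k)"
  shows "hinge_sum N a l s = hinge_sum N a l (a k) + (\<Sum>i\<le>k. l i) * (s - a k)"
proof -
  have "hinge_sum N a l s - hinge_sum N a l (a k) =
      (\<Sum>i<N. l i * (hinge (a i) s - hinge (a i) (a k)))"
    by (simp add: hinge_sum_def sum_subtractf right_diff_distrib)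
  also have "\<dots> = (\<Sum>i<N. if i \<le> k then l i * (s - a k) else 0)"
  proof (intro sum.cong refl)
    fix i assume "i \<in> {..<N}"
    show "l i * (hinge (a i) s - hinge (a i) (a k)) = (if i \<le> k then l i * (s - a k) else 0)"
    proof (cases "i \<le> k")
      case True
      thus ?thesis using knot_mono[of i k] assms by (simp add: hinge_def)
    next
      case False
      thus ?thesis using knot_mono[of "Suc k" i] knot_less[of k] \<open>i \<in> {..<N}\<close> assms
        by (auto simp: hinge_def max_def)
    qed
  qed
  also have "\<dots> = (\<Sum>i\<in>{i\<in>{..<N}. i \<le> k}. l i * (s - a k))"
    by (rule sum.inter_filter [symmetric]) simp
  also have "{i\<in>{..<N}. i \<le> k} = {..k}" using assms(1) by auto
  finally show ?thesis by (simp add: sum_distrib_right)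
qed

lemma hinge_sum_first: "hinge_sum N a l (a 0) = 0"
  using knot_mono[of 0] unfolding hinge_sum_def hinge_def by (intro sum.neutral) auto

text \<open>It suffices to integrate over a piece of length \<open>\<delta> / (1 + D)\<close> next
  to the knot \<open>a j\<close>. A rise of at most \<open>D\<close> across a gap of length at least
  \<delta> means a slope of at most \<open>D / \<delta>\<close>, so the exponent drops by at most 1
  on that piece.\<close>

lemma integral_exp_ge:
  assumes \<delta>: "0 < \<delta>" "\<And>k. k < N \<Longrightarrow> \<delta> \<le> a (Suc k) - a k"
    and j: "j \<le> N" and D: "0 \<le> D"
    and osc: "\<And>k. k \<le> N \<Longrightarrow> hinge_sum N a l (a k) - hinge_sum N a l (a j) \<le> D"
  shows "\<delta> / (1 + D) * exp (\<nu> - hinge_sum N a l (a j) - 1)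
           \<le> integral {a 0..a N} (\<lambda>s. exp (\<nu> - hinge_sum N a l s))"
proof -
  define \<eta> where "\<eta> = \<delta> / (1 + D)"
  have \<eta>: "\<eta> > 0" "\<eta> \<le> \<delta>" "\<eta> * D \<le> \<delta>"
    using \<delta> D by (auto simp: \<eta>_def field_simps)
  obtain b where b: "a 0 \<le> b" "b + \<eta> \<le> a N"
    and L: "\<And>s. s \<in> {b..b + \<eta>} \<Longrightarrow> hinge_sum N a l s \<le> hinge_sum N a l (a j) + 1"
  proof (cases "j < N")
    case True
    define \<Lambda> where "\<Lambda> = (\<Sum>i\<le>j. l i)"
    have gap: "\<delta> \<le> a (Suc j) - a j" using \<delta> True by blast
    have "\<Lambda> * (a (Suc j) - a j) \<le> D"
      using hinge_sum_piece[of j "a (Suc j)" l] True knot_less[OF True] osc[of "Suc j"]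
      by (simp add: \<Lambda>_def)
    hence *: "\<Lambda> \<le> D / \<delta>"
      using \<delta> gap D by (smt (verit) pos_le_divide_eq mult_left_mono divide_nonneg_pos)
    show ?thesis
    proof (rule that[of "a j"])
      show "a 0 \<le> a j" using knot_mono[of 0 j] j by simp
      show "a j + \<eta> \<le> a N" using gap \<eta> knot_mono[of "Suc j" N] True by simp
    next
      fix s assume s: "s \<in> {a j..a j + \<eta>}"
      have "\<Lambda> * (s - a j) \<le> D / \<delta> * (s - a j)"
        using * s by (intro mult_right_mono) auto
      also have "\<dots> \<le> D / \<delta> * \<eta>"
        using s D \<delta> by (intro mult_left_mono) auto
      also have "\<dots> \<le> 1" using \<eta> \<delta> by (simp add: field_simps)
      finally show "hinge_sum N a l s \<le> hinge_sum N a l (a j) + 1"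
        using hinge_sum_piece[of j s l] True s gap \<eta> by (simp add: \<Lambda>_def)
    qed
  next
    case False
    \<comment> \<open>The last knot has no gap to its right, so the piece is taken to its
      left.\<close>
    then obtain k where k: "j = Suc k" "N = Suc k" using j N_pos by (cases N) auto
    define \<Lambda> where "\<Lambda> = (\<Sum>i\<le>k. l i)"
    have gap: "\<delta> \<le> a (Suc k) - a k" using \<delta> k by blast
    have e: "hinge_sum N a l (a j) = hinge_sum N a l (a k) + \<Lambda> * (a (Suc k) - a k)"
      using hinge_sum_piece[of k "a (Suc k)" l] k knot_less[of k] by (simp add: \<Lambda>_def)
    hence "- \<Lambda> * (a (Suc k) - a k) \<le> D"
      using osc[of k] k by simp
    hence *: "- \<Lambda> \<le> D / \<delta>"
      using \<delta> gap D by (smt (verit) pos_le_divide_eq mult_left_mono divide_nonneg_pos)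
    show ?thesis
    proof (rule that[of "a N - \<eta>"])
      show "a 0 \<le> a N - \<eta>" using gap \<eta> knot_mono[of 0 k] k by simp
      show "a N - \<eta> + \<eta> \<le> a N" by simp
    next
      fix s assume s: "s \<in> {a N - \<eta>..a N - \<eta> + \<eta>}"
      have "- \<Lambda> * (a N - s) \<le> D / \<delta> * (a N - s)"
        using * s by (intro mult_right_mono) auto
      also have "\<dots> \<le> D / \<delta> * \<eta>"
        using s D \<delta> by (intro mult_left_mono) auto
      also have "\<dots> \<le> 1" using \<eta> \<delta> by (simp add: field_simps)
      finally show "hinge_sum N a l s \<le> hinge_sum N a l (a j) + 1"
        using hinge_sum_piece[of k s l] k e s gap \<eta> by (simp add: \<Lambda>_def algebra_simps)
    qed
  qed
  have "\<eta> * exp (\<nu> - hinge_sum N a l (a j) - 1) =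
      integral {b..b + \<eta>} (\<lambda>s. exp (\<nu> - hinge_sum N a l (a j) - 1))"
    using \<eta> by simp
  also have "\<dots> \<le> integral {b..b + \<eta>} (\<lambda>s. exp (\<nu> - hinge_sum N a l s))"
    using L by (intro integral_le integrable_continuous_interval continuous_intros) force+
  also have "\<dots> \<le> integral {a 0..a N} (\<lambda>s. exp (\<nu> - hinge_sum N a l s))"
    using b by (intro integral_subset_le integrable_continuous_interval continuous_intros) auto
  finally show ?thesis by (simp add: \<eta>_def)
qed

text \<open>
  In terms of the values \<open>w\<^sub>j\<close> of the log-density at the knots, the dual function is
  \<open>\<integral> exp w - \<Sum> p\<^sub>j w\<^sub>j - 1\<close>. The linear part falls below the maximum of the \<open>w\<^sub>j\<close> by a multiple of
  their oscillation, and the integral controls the exponential of that maximum.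
\<close>

lemma dual_coercive:
  assumes p: "\<And>j. j \<le> N \<Longrightarrow> 0 < p j" "(\<Sum>j\<le>N. p j) = 1"
    and c: "\<And>i. i < N \<Longrightarrow> c i = (\<Sum>j\<le>N. p j * hinge (a i) (a j))"
  shows "\<exists>R. \<forall>\<nu> l. dual N a c \<nu> l \<le> B \<longrightarrow> \<bar>\<nu>\<bar> \<le> R \<and> (\<forall>i<N. \<bar>l i\<bar> \<le> R)"
proof -
  define \<delta> where "\<delta> = Min ((\<lambda>k. a (Suc k) - a k) ` {..<N})"
  have \<delta>_le: "\<delta> \<le> a (Suc k) - a k" if "k < N" for k
    unfolding \<delta>_def using that by (intro Min_le) auto
  have \<delta>: "\<delta> > 0"
    unfolding \<delta>_def using N_pos knot_less by (subst Min_gr_iff) auto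
  define q where "q = Min (p ` {..N})"
  have q_le: "q \<le> p j" if "j \<le> N" for j
    unfolding q_def using that by (intro Min_le) auto
  have q: "q > 0"
    unfolding q_def using p(1) by (subst Min_gr_iff) auto
  obtain R where R: "\<And>M D. 0 \<le> D \<Longrightarrow> \<delta> * exp (-1) * exp M / (1 + D) - M + q * D \<le> B + 1 \<Longrightarrow>
      \<bar>M\<bar> \<le> R \<and> D \<le> R"
    using coercive_scalar[of "\<delta> * exp (-1)" q "B + 1"] \<delta> q by auto
  \<comment> \<open>The knot values will be bounded by \<open>2 * R\<close>, hence the partial sums
    of \<open>l\<close>, being slopes, by \<open>4 * R / \<delta>\<close>, and each
    \<open>l i\<close>, a difference of two of them, by twice that. The value at the first knot is
    \<nu>.\<close>
  define R' where "R' = max (2 * R) (8 * R / \<delta>)"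
  show ?thesis
  proof (intro exI[of _ R'] allI impI)
    fix \<nu> l assume le: "dual N a c \<nu> l \<le> B"
    define L where "L = hinge_sum N a l"
    define w where "w j = \<nu> - L (a j)" for j
    define M m where "M = Max (w ` {..N})" and "m = Min (w ` {..N})"
    have w_le: "w j \<le> M" and w_ge: "m \<le> w j" if "j \<le> N" for j
      using that by (auto simp: M_def m_def intro: Max_ge Min_le)
    have "M \<in> w ` {..N}" "m \<in> w ` {..N}"
      unfolding M_def m_def by (intro Max_in Min_in; simp)+
    then obtain j1 j2 where j1: "j1 \<le> N" "w j1 = M" and j2: "j2 \<le> N" "w j2 = m" by auto
    have D: "0 \<le> M - m" using w_le[of 0] w_ge[of 0] by simp
    have "\<delta> / (1 + (M - m)) * exp (\<nu> - L (a j1) - 1)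
           \<le> integral {a 0..a N} (\<lambda>s. exp (\<nu> - L s))"
      unfolding L_def
    proof (rule integral_exp_ge[OF \<delta> \<delta>_le j1(1) D])
      fix k assume "k \<le> N"
      thus "hinge_sum N a l (a k) - hinge_sum N a l (a j1) \<le> M - m"
        using w_ge[of k] j1(2) by (simp add: w_def L_def)
    qed
    moreover have "\<nu> - L (a j1) = M" using j1 by (simp add: w_def)
    ultimately have int: "\<delta> * exp (-1) * exp M / (1 + (M - m)) \<le> integral {a 0..a N} (\<lambda>s. exp (\<nu> - L s))"
      by (simp add: exp_diff exp_minus field_simps)
    have "(\<Sum>i<N. l i * c i) = (\<Sum>i<N. \<Sum>j\<le>N. p j * (l i * hinge (a i) (a j)))"
      by (intro sum.cong refl) (simp add: c sum_distrib_left mult_ac)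
    also have "\<dots> = (\<Sum>j\<le>N. p j * L (a j))"
      by (subst sum.swap) (simp add: L_def hinge_sum_def sum_distrib_left)
    also have "\<dots> = (\<Sum>j\<le>N. p j * \<nu>) - (\<Sum>j\<le>N. p j * w j)"
      by (simp add: w_def right_diff_distrib sum_subtractf)
    also have "(\<Sum>j\<le>N. p j * \<nu>) = \<nu>"
      using p(2) by (simp add: sum_distrib_right[symmetric])
    finally have lin: "(\<Sum>i<N. l i * c i) = \<nu> - (\<Sum>j\<le>N. p j * w j)" .
    have "q * (M - m) \<le> p j2 * (M - w j2)"
      using q_le[OF j2(1)] D j2 by (intro mult_mono) (use q in auto)
    also have "\<dots> \<le> (\<Sum>j\<le>N. p j * (M - w j))"
    proof (rule member_le_sum)
      show "0 \<le> p x * (M - w x)" if "x \<in> {..N} - {j2}" for x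
        using that p(1)[of x] w_le[of x] by simp
    qed (use j2 in auto)
    also have "\<dots> = M - (\<Sum>j\<le>N. p j * w j)"
      using p(2) by (simp add: right_diff_distrib sum_subtractf sum_distrib_right[symmetric])
    finally have "\<delta> * exp (-1) * exp M / (1 + (M - m)) - M + q * (M - m) \<le> B + 1"
      using int le lin by (simp add: dual_def L_def)
    from R[OF D this] have bnd: "\<bar>M\<bar> \<le> R" "M - m \<le> R" by auto
    have w_bnd: "\<bar>w j\<bar> \<le> 2 * R" if "j \<le> N" for j
      using w_le[OF that] w_ge[OF that] bnd by (auto simp: abs_le_iff)
    have "\<bar>\<nu>\<bar> \<le> R'"
      using w_bnd[of 0] hinge_sum_first[of l] by (simp add: w_def L_def R'_def)
    moreover have sl: "\<bar>\<Sum>i\<le>k. l i\<bar> \<le> 4 * R / \<delta>" if k: "k < N" for k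
    proof -
      have "(\<Sum>i\<le>k. l i) * (a (Suc k) - a k) = w k - w (Suc k)"
        using hinge_sum_piece[of k "a (Suc k)" l] k knot_less[OF k] by (simp add: w_def L_def)
      hence "\<bar>\<Sum>i\<le>k. l i\<bar> * (a (Suc k) - a k) = \<bar>w k - w (Suc k)\<bar>"
        using knot_less[OF k] by (metis abs_mult abs_of_pos diff_gt_0_iff_gt)
      also have "\<dots> \<le> 4 * R"
        using w_bnd[of k] w_bnd[of "Suc k"] k by linarith
      finally have "\<bar>\<Sum>i\<le>k. l i\<bar> * \<delta> \<le> 4 * R"
        using \<delta>_le[OF k] by (smt (verit) mult_left_mono abs_ge_zero)
      thus ?thesis using \<delta> by (simp add: field_simps)
    qed
    have "\<bar>l i\<bar> \<le> R'" if i: "i < N" for i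
    proof -
      have R0: "R \<ge> 0" using bnd by linarith
      have "\<bar>l i\<bar> \<le> 8 * R / \<delta>"
      proof (cases i)
        case 0
        thus ?thesis using sl[OF i] R0 \<delta> by (simp add: field_simps)
      next
        case (Suc k)
        thus ?thesis using sl[OF i] sl[of k] i by simp
      qed
      thus ?thesis by (simp add: R'_def)
    qed
    ultimately show "\<bar>\<nu>\<bar> \<le> R' \<and> (\<forall>i<N. \<bar>l i\<bar> \<le> R')" by blast
  qed
qed

section \<open>Existence of a minimizer\<close>

lemma dual_cong: "(\<And>i. i < N \<Longrightarrow> l i = l' i) \<Longrightarrow> dual N a c \<nu> l = dual N a c \<nu> l'"
  by (simp add: dual_def hinge_sum_def cong: sum.cong_simp)

text \<open>The multipliers carry the product topology, in which the boxes of
  \<open>dual_has_min\<close> are compact by Tychonoff's theorem.\<close>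

lemma continuous_on_dual: "continuous_on UNIV (\<lambda>(\<nu>, l). dual N a c \<nu> l)"
proof -
  have coord: "continuous_on A (\<lambda>x. l x i)" if "continuous_on A l"
    for A i and l :: "'b::topological_space \<Rightarrow> nat \<Rightarrow> real"
    using that by (rule continuous_on_product_then_coordinatewise)
  have "continuous_on A (\<lambda>x. snd (fst x) i * hinge b (snd x))" for i b
    and A :: "((real \<times> (nat \<Rightarrow> real)) \<times> real) set"
    unfolding hinge_def
    by (intro continuous_on_mult continuous_on_max continuous_on_diff continuous_on_snd continuous_on_fst
        continuous_on_id continuous_on_const coord)
  hence "continuous_on (UNIV \<times> cbox (a 0) (a N))
      (\<lambda>x :: (real \<times> (nat \<Rightarrow> real)) \<times> real. exp (fst (fst x) - hinge_sum N a (snd (fst x)) (snd x)))"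
    unfolding hinge_sum_def
    by (intro continuous_on_exp continuous_on_diff continuous_on_sum continuous_on_fst continuous_on_id)
  hence "continuous_on UNIV (\<lambda>x :: real \<times> (nat \<Rightarrow> real).
      integral (cbox (a 0) (a N)) (\<lambda>s. exp (fst x - hinge_sum N a (snd x) s)))"
    by (intro integral_continuous_on_param) (simp add: case_prod_beta)
  moreover have "continuous_on UNIV (\<lambda>x :: real \<times> (nat \<Rightarrow> real). snd x i * c i)" for i
    by (intro continuous_on_mult continuous_on_snd continuous_on_id continuous_on_const coord)
  ultimately show ?thesis
    unfolding dual_def case_prod_beta
    by (intro continuous_on_add continuous_on_diff continuous_on_sum continuous_on_const
        continuous_on_fst continuous_on_id) simp_all
qed

text \<open>\<open>J\<close> collects the sign constrained multipliers. A bound is demanded only on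
  their cone and on the sublevel set of the zero multiplier, which lies in the box. Asking for it on
  the cone alone is what admits \<open>\<alpha> 1 = 1\<close> in
  \<open>BC_minimizer\<close>.\<close>

lemma dual_has_min:
  assumes J: "J \<subseteq> {..<N}"
    and coercive: "\<forall>\<nu> l. (\<forall>i\<in>J. 0 \<le> l i) \<longrightarrow> dual N a c \<nu> l \<le> dual N a c 0 (\<lambda>_. 0) \<longrightarrow>
      \<bar>\<nu>\<bar> \<le> R \<and> (\<forall>i<N. \<bar>l i\<bar> \<le> R)"
  shows "\<exists>\<nu> l. (\<forall>i\<in>J. 0 \<le> l i) \<and>
    (\<forall>\<nu>' l'. (\<forall>i\<in>J. 0 \<le> l' i) \<longrightarrow> dual N a c \<nu> l \<le> dual N a c \<nu>' l')"
proof -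
  \<comment> \<open>Coordinates from \<open>N\<close> on do not enter \<open>dual\<close>; pinning
    them to 0 keeps the infinite product compact.\<close>
  define S where "S i = (if i < N then (if i \<in> J then {0..R} else {-R..R}) else {0})" for i
  define K where "K = {-R..R} \<times> (PiE UNIV S)"
  have "R \<ge> 0" using coercive[THEN spec, THEN spec, of "\<lambda>_. 0" 0] by auto
  have "compactin (product_topology (\<lambda>i. euclidean) UNIV) (PiE UNIV S)"
    unfolding compactin_PiE by (auto simp: S_def)
  hence "compact (PiE UNIV S)"
    by (simp add: euclidean_product_topology)
  hence cK: "compact K" unfolding K_def by (intro compact_Times) auto
  have z: "(0, \<lambda>_. 0) \<in> K" using \<open>R \<ge> 0\<close> by (auto simp: K_def S_def)
  have "continuous_on K (\<lambda>(\<nu>, l). dual N a c \<nu> l)"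
    using continuous_on_dual by (rule continuous_on_subset) simp
  then obtain p where p: "p \<in> K" "\<And>p'. p' \<in> K \<Longrightarrow>
      (case p of (\<nu>, l) \<Rightarrow> dual N a c \<nu> l) \<le> (case p' of (\<nu>, l) \<Rightarrow> dual N a c \<nu> l)"
    using continuous_attains_inf[OF cK, of "\<lambda>(\<nu>, l). dual N a c \<nu> l"] z by blast
  obtain \<nu> l where nl: "p = (\<nu>, l)" by fastforce
  show ?thesis
  proof (intro exI[of _ \<nu>] exI[of _ l] conjI allI impI)
    show "\<forall>i\<in>J. 0 \<le> l i"
    proof
      fix i assume "i \<in> J"
      have "l i \<in> S i" using p(1) nl by (auto simp: K_def)
      thus "0 \<le> l i" using \<open>i \<in> J\<close> J by (auto simp: S_def split: if_splits)
    qed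
  next
    fix \<nu>' and l' :: "nat \<Rightarrow> real" assume l': "\<forall>i\<in>J. 0 \<le> l' i"
    show "dual N a c \<nu> l \<le> dual N a c \<nu>' l'"
    proof (cases "dual N a c \<nu>' l' \<le> dual N a c 0 (\<lambda>_. 0)")
      case True
      define l'' where "l'' i = (if i < N then l' i else 0)" for i
      have "(\<nu>', l'') \<in> K"
        using coercive[THEN spec, THEN spec, THEN mp, THEN mp, OF l' True] l' by (auto simp: K_def S_def l''_def abs_le_iff minus_le_iff)
      from p(2)[OF this] have "dual N a c \<nu> l \<le> dual N a c \<nu>' l''" by (simp add: nl)
      also have "\<dots> = dual N a c \<nu>' l'" by (intro dual_cong) (simp add: l''_def)
      finally show ?thesis .
    next
      case False
      thus ?thesis using p(2)[OF z] nl by simp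
    qed
  qed
qed

end

section \<open>First order conditions at a minimizer\<close>

text \<open>For negative \<open>x\<close>, \<open>exp x\<close> is at most
  \<open>1 / (1 - x)\<close>, and \<open>(1 + x + x^2) * (1 - x) = 1 - x^3\<close> is at least
  1.\<close>

lemma exp_le_quadratic: "\<bar>x\<bar> \<le> 1 \<Longrightarrow> exp x \<le> 1 + x + x\<^sup>2" for x :: real
proof (cases "x \<ge> 0")
  case False
  assume "\<bar>x\<bar> \<le> 1"
  have "1 - x \<le> exp (-x)" using exp_ge_add_one_self[of "-x"] by simp
  hence "exp x \<le> 1 / (1 - x)" using False by (simp add: exp_minus field_simps)
  moreover have "x ^ 3 \<le> 0" using False by (simp add: power_le_zero_eq)
  hence "1 \<le> (1 + x + x\<^sup>2) * (1 - x)"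
    by (simp add: algebra_simps power2_eq_square power3_eq_cube)
  hence "1 / (1 - x) \<le> 1 + x + x\<^sup>2"
    using False by (simp add: pos_divide_le_eq)
  ultimately show ?thesis by simp
qed (auto intro: exp_bound)

text \<open>The right derivative at \<open>t = 0\<close> of the expression in \<open>min\<close> is
  \<kappa> minus the integral of \<open>f * \<psi>\<close>. Only positive \<open>t\<close> are used,
  since a multiplier on the boundary of the cone can only grow. The quadratic bound on
  \<open>exp\<close> replaces differentiation under the integral.\<close>

lemma first_order_condition:
  fixes f \<psi> :: "real \<Rightarrow> real"
  assumes f: "continuous_on {b..d} f" "\<And>s. s \<in> {b..d} \<Longrightarrow> 0 \<le> f s"
    and \<psi>: "continuous_on {b..d} \<psi>"
    and \<tau>: "0 < \<tau>"
    and min: "\<And>t. 0 < t \<Longrightarrow> t \<le> \<tau> \<Longrightarrow>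
      0 \<le> t * \<kappa> + (integral {b..d} (\<lambda>s. f s * exp (- t * \<psi> s)) - integral {b..d} f)"
  shows "integral {b..d} (\<lambda>s. f s * \<psi> s) \<le> \<kappa>"
proof -
  obtain B where B: "B > 0" "\<And>s. s \<in> {b..d} \<Longrightarrow> \<bar>\<psi> s\<bar> \<le> B"
  proof -
    have "bounded (\<psi> ` {b..d})"
      using \<psi> by (intro compact_imp_bounded compact_continuous_image) auto
    thus ?thesis using that unfolding bounded_pos by auto
  qed
  define I where "I = integral {b..d} (\<lambda>s. f s * \<psi> s)"
  define F where "F = integral {b..d} f"
  have int: "g integrable_on {b..d}" if "continuous_on {b..d} g" for g :: "real \<Rightarrow> real"
    using that by (rule integrable_continuous_interval)
  have "F \<ge> 0" unfolding F_def using f by (intro integral_nonneg int) auto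
  have key: "I \<le> \<kappa> + t * (B\<^sup>2 * F)" if t: "0 < t" "t \<le> min \<tau> (1 / B)" for t
  proof -
    have "integral {b..d} (\<lambda>s. f s * exp (- t * \<psi> s)) \<le>
        integral {b..d} (\<lambda>s. f s - t * (f s * \<psi> s) + (t\<^sup>2 * B\<^sup>2) * f s)"
    proof (intro integral_le int continuous_intros f \<psi>)
      fix s assume s: "s \<in> {b..d}"
      have "\<bar>t * \<psi> s\<bar> \<le> 1 / B * B"
        unfolding abs_mult using t B s by (intro mult_mono) auto
      hence "exp (- t * \<psi> s) \<le> 1 + (- t * \<psi> s) + (- t * \<psi> s)\<^sup>2"
        using B by (intro exp_le_quadratic) auto
      also have "(- t * \<psi> s)\<^sup>2 \<le> t\<^sup>2 * B\<^sup>2"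
        using B(2)[OF s] B(1) power2_le_iff_abs_le[of B "\<psi> s"]
        by (simp add: power_mult_distrib mult_left_mono)
      finally have "f s * exp (- t * \<psi> s) \<le> f s * (1 + (- t * \<psi> s) + t\<^sup>2 * B\<^sup>2)"
        using f(2)[OF s] by (intro mult_left_mono) auto
      thus "f s * exp (- t * \<psi> s) \<le> f s - t * (f s * \<psi> s) + (t\<^sup>2 * B\<^sup>2) * f s"
        by (simp add: algebra_simps)
    qed
    also have "\<dots> = integral {b..d} (\<lambda>s. f s - t * (f s * \<psi> s)) + integral {b..d} (\<lambda>s. (t\<^sup>2 * B\<^sup>2) * f s)"
      by (intro integral_add int continuous_intros f \<psi>)
    also have "integral {b..d} (\<lambda>s. f s - t * (f s * \<psi> s)) =
        integral {b..d} f - integral {b..d} (\<lambda>s. t * (f s * \<psi> s))"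
      by (intro integral_diff int continuous_intros f \<psi>)
    also have "\<dots> + integral {b..d} (\<lambda>s. (t\<^sup>2 * B\<^sup>2) * f s) = F - t * I + t\<^sup>2 * B\<^sup>2 * F"
      by (simp add: F_def I_def)
    finally have "0 \<le> t * \<kappa> + (- t * I + t\<^sup>2 * B\<^sup>2 * F)"
      using min[of t] t by (simp add: F_def)
    hence "t * I \<le> t * (\<kappa> + t * (B\<^sup>2 * F))"
      by (simp add: algebra_simps power2_eq_square)
    thus ?thesis using t by (simp add: mult_le_cancel_left)
  qed
  have "\<forall>\<^sub>F t in at_right 0. I \<le> \<kappa> + t * (B\<^sup>2 * F)"
    unfolding eventually_at_right_field using key \<tau> B
    by (intro exI[of _ "min \<tau> (1 / B)"]) auto
  moreover have "((\<lambda>t. \<kappa> + t * (B\<^sup>2 * F)) \<longlongrightarrow> \<kappa> + 0 * (B\<^sup>2 * F)) (at_right 0)"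
    by (intro tendsto_intros)
  ultimately have "I \<le> \<kappa> + 0 * (B\<^sup>2 * F)"
    by (intro tendsto_lowerbound) auto
  thus ?thesis by (simp add: I_def)
qed

context knots
begin

text \<open>Moving \<nu> both ways fixes the mass. Raising \<open>l i\<close> is always allowed and
  bounds the hinge moment; lowering it is allowed when it is positive or its sign is free, and gives
  the reverse bound. By complementary slackness the linear term of \<open>dual\<close> is then the
  mean of \<open>hinge_sum\<close>, so the entropy of \<open>f\<close> is the dual value.\<close>

lemma dual_kkt:
  assumes J: "J \<subseteq> {..<N}" and l: "\<forall>i\<in>J. 0 \<le> l i"
    and min: "\<And>\<nu>' l'. (\<forall>i\<in>J. 0 \<le> l' i) \<Longrightarrow> dual N a c \<nu> l \<le> dual N a c \<nu>' l'"
  defines "f \<equiv> \<lambda>s. exp (\<nu> - hinge_sum N a l s)"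
  shows "integral {a 0..a N} f = 1"
    and "\<And>i. i < N \<Longrightarrow> integral {a 0..a N} (\<lambda>s. f s * hinge (a i) s) \<le> c i"
    and "\<And>i. i < N \<Longrightarrow> i \<notin> J \<Longrightarrow> integral {a 0..a N} (\<lambda>s. f s * hinge (a i) s) = c i"
    and "integral {a 0..a N} (\<lambda>s. f s * (\<nu> - hinge_sum N a l s)) = - dual N a c \<nu> l"
proof -
  have cf: "continuous_on {a 0..a N} f" unfolding f_def by (intro continuous_intros)
  have f0: "0 \<le> f s" for s by (simp add: f_def)
  \<comment> \<open>Shifting \<nu> by \<open>t * u\<close> multiplies \<open>f\<close> by
    \<open>exp (t * u)\<close>, so here both \<psi> and \<kappa> are the constant
    \<open>- u\<close>.\<close>
  have nu: "0 \<le> t * (- u) + (integral {a 0..a N} (\<lambda>s. f s * exp (- t * (- u))) - integral {a 0..a N} f)"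
    for t u :: real
    using min[OF l, of "\<nu> + t * u"]
    by (simp add: dual_def f_def exp_add exp_diff algebra_simps)
  have "integral {a 0..a N} (\<lambda>s. f s * (- 1)) \<le> - 1"
    by (rule first_order_condition[where \<tau> = 1]) (use cf f0 nu[of _ 1] in auto)
  moreover have "integral {a 0..a N} (\<lambda>s. f s * 1) \<le> 1"
    by (rule first_order_condition[where \<tau> = 1]) (use cf f0 nu[of _ "-1"] in auto)
  ultimately show one: "integral {a 0..a N} f = 1" by simp
  have upd: "hinge_sum N a (l(i := l i + x)) s = hinge_sum N a l s + x * hinge (a i) s"
    "(\<Sum>j<N. (l(i := l i + x)) j * c j) = (\<Sum>j<N. l j * c j) + x * c i" if "i < N" for i x s
  proof -
    have *: "(\<Sum>j<N. (l(i := l i + x)) j * g j) = (\<Sum>j<N. l j * g j) + x * g i" for g :: "nat \<Rightarrow> real"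
    proof -
      have "(\<Sum>j<N. (l(i := l i + x)) j * g j) = (\<Sum>j<N. l j * g j + (if j = i then x * g i else 0))"
        by (intro sum.cong) (auto simp: algebra_simps)
      thus ?thesis using that by (simp add: sum.distrib)
    qed
    show "hinge_sum N a (l(i := l i + x)) s = hinge_sum N a l s + x * hinge (a i) s"
      unfolding hinge_sum_def by (rule *)
    show "(\<Sum>j<N. (l(i := l i + x)) j * c j) = (\<Sum>j<N. l j * c j) + x * c i"
      by (rule *)
  qed
  have li: "0 \<le> t * (u * c i) + (integral {a 0..a N} (\<lambda>s. f s * exp (- t * (u * hinge (a i) s))) - integral {a 0..a N} f)"
    if "i < N" "i \<in> J \<longrightarrow> 0 \<le> l i + t * u" for t u i
  proof -
    have "dual N a c \<nu> l \<le> dual N a c \<nu> (l(i := l i + t * u))"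
      using that l by (intro min) auto
    thus ?thesis unfolding dual_def upd[OF that(1)]
      by (simp add: f_def exp_diff exp_minus exp_add field_simps)
  qed
  have ch: "continuous_on {a 0..a N} (\<lambda>s. u * hinge (a i) s)" for u i
    by (intro continuous_intros)
  show le: "integral {a 0..a N} (\<lambda>s. f s * hinge (a i) s) \<le> c i" if i: "i < N" for i
  proof -
    have "integral {a 0..a N} (\<lambda>s. f s * (1 * hinge (a i) s)) \<le> 1 * c i"
      by (rule first_order_condition[where \<tau> = 1, OF cf f0 ch])
        (use li[OF i, of _ 1] l in auto)
    thus ?thesis by simp
  qed
  \<comment> \<open>For constrained \<open>i\<close> the multiplier can be lowered as long as it
    stays nonnegative, so the admissible range of \<open>t\<close> is \<tau> =
    \<open>l i\<close>.\<close>
  have ge: "c i \<le> integral {a 0..a N} (\<lambda>s. f s * hinge (a i) s)" if i: "i < N" "i \<notin> J \<or> 0 < l i" for i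
  proof -
    have "integral {a 0..a N} (\<lambda>s. f s * ((- 1) * hinge (a i) s)) \<le> (- 1) * c i"
      by (rule first_order_condition[where \<tau> = "if i \<in> J then l i else 1", OF cf f0 ch])
        (use li[OF i(1), of _ "-1"] i in \<open>auto split: if_splits\<close>)
    thus ?thesis by simp
  qed
  show "integral {a 0..a N} (\<lambda>s. f s * hinge (a i) s) = c i" if "i < N" "i \<notin> J" for i
    using le[of i] ge[of i] that by simp
  have int: "g integrable_on {a 0..a N}" if "continuous_on {a 0..a N} g" for g :: "real \<Rightarrow> real"
    using that by (rule integrable_continuous_interval)
  \<comment> \<open>Complementary slackness: each constraint is tight or its multiplier is
    zero.\<close>
  have "(\<Sum>i<N. l i * c i) = (\<Sum>i<N. l i * integral {a 0..a N} (\<lambda>s. f s * hinge (a i) s))"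
  proof (intro sum.cong refl)
    fix i assume "i \<in> {..<N}"
    hence "i < N" by simp
    show "l i * c i = l i * integral {a 0..a N} (\<lambda>s. f s * hinge (a i) s)"
    proof (cases "i \<notin> J \<or> 0 < l i")
      case True
      thus ?thesis using le[OF \<open>i < N\<close>] ge[OF \<open>i < N\<close>] by simp
    next
      case False
      hence "l i = 0" using l by force
      thus ?thesis by simp
    qed
  qed
  also have "\<dots> = (\<Sum>i<N. integral {a 0..a N} (\<lambda>s. l i * (f s * hinge (a i) s)))"
    by simp
  also have "\<dots> = integral {a 0..a N} (\<lambda>s. \<Sum>i<N. l i * (f s * hinge (a i) s))"
    by (intro integral_sum [symmetric] int continuous_intros cf) auto
  also have "(\<lambda>s. \<Sum>i<N. l i * (f s * hinge (a i) s)) = (\<lambda>s. f s * hinge_sum N a l s)"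
    by (simp add: hinge_sum_def sum_distrib_left mult_ac)
  finally have *: "(\<Sum>i<N. l i * c i) = integral {a 0..a N} (\<lambda>s. f s * hinge_sum N a l s)" .
  have "integral {a 0..a N} (\<lambda>s. f s * (\<nu> - hinge_sum N a l s)) =
      integral {a 0..a N} (\<lambda>s. \<nu> * f s - f s * hinge_sum N a l s)"
    by (simp add: algebra_simps)
  also have "\<dots> = integral {a 0..a N} (\<lambda>s. \<nu> * f s) - integral {a 0..a N} (\<lambda>s. f s * hinge_sum N a l s)"
    by (intro integral_diff int continuous_intros cf)
  finally show "integral {a 0..a N} (\<lambda>s. f s * (\<nu> - hinge_sum N a l s)) = - dual N a c \<nu> l"
    using * one by (simp add: dual_def f_def)
qed

end

section \<open>Closed form of the dual function\<close>

text \<open>This is where \<open>zeta\<close> comes from: it is the mean of an exponential over a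
  gap, normalized at the left end, and \<open>zeta 0 = 1\<close> is the flat case.\<close>

lemma zeta_integral:
  assumes "0 \<le> d"
  shows "integral {b..b + d} (\<lambda>s. exp (A - B * (s - b))) = exp A * d * zeta (- B * d)"
proof (cases "B = 0")
  case False
  have "((\<lambda>s. exp (A - B * (s - b))) has_integral
      (- exp (A - B * (b + d - b)) / B - - exp (A - B * (b - b)) / B)) {b..b + d}"
  proof (intro fundamental_theorem_of_calculus)
    fix s
    have "((\<lambda>s. - exp (A - B * (s - b)) / B) has_real_derivative exp (A - B * (s - b))) (at s within {b..b + d})"
      by (rule derivative_eq_intros refl | simp add: False)+
    thus "((\<lambda>s. - exp (A - B * (s - b)) / B) has_vector_derivative exp (A - B * (s - b))) (at s within {b..b + d})"
      by (simp add: has_real_derivative_iff_has_vector_derivative)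
  qed (use assms in simp)
  hence I: "integral {b..b + d} (\<lambda>s. exp (A - B * (s - b))) = (exp A - exp (A - B * d)) / B"
    by (simp add: integral_unique diff_divide_distrib)
  show ?thesis
  proof (cases "d = 0")
    case d: False
    have "exp (A - B * d) = exp A * exp (- B * d)" by (simp flip: exp_add)
    hence "(exp A - exp (A - B * d)) / B = exp A * ((1 - exp (- B * d)) / B)" by (simp add: right_diff_distrib)
    also have "(1 - exp (- B * d)) / B = d * zeta (- B * d)"
      using False d by (simp add: zeta_def minus_divide_left)
    finally show ?thesis using I by simp
  qed simp
qed (use assms in \<open>simp add: zeta_def\<close>)

context knots
begin

lemma integral_pieces:
  fixes f :: "real \<Rightarrow> real"
  assumes "continuous_on {a 0..a N} f" "m \<le> N"
  shows "integral {a 0..a m} f = (\<Sum>k<m. integral {a k..a (Suc k)} f)"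
  using assms(2)
proof (induction m)
  case (Suc m)
  have "integral {a 0..a m} f + integral {a m..a (Suc m)} f = integral {a 0..a (Suc m)} f"
  proof (rule Henstock_Kurzweil_Integration.integral_combine)
    show "f integrable_on {a 0..a (Suc m)}"
      using assms(1) knot_mono[of "Suc m" N] Suc.prems
      by (intro integrable_continuous_interval continuous_on_subset[OF assms(1)]) auto
  qed (use Suc.prems knot_mono[of 0 m] knot_less[of m] in auto)
  thus ?case using Suc by simp
qed simp

lemma integral_exp_hinge_sum:
  "integral {a 0..a N} (\<lambda>s. exp (\<nu> - hinge_sum N a l s)) = exp \<nu> *
     (\<Sum>k<N. (a (Suc k) - a k) * exp (- hinge_sum N a l (a k)) * zeta (- (\<Sum>i\<le>k. l i) * (a (Suc k) - a k)))"
proof -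
  have "integral {a 0..a N} (\<lambda>s. exp (\<nu> - hinge_sum N a l s)) =
      (\<Sum>k<N. integral {a k..a (Suc k)} (\<lambda>s. exp (\<nu> - hinge_sum N a l s)))"
    by (intro integral_pieces continuous_intros) auto
  also have "\<dots> = (\<Sum>k<N. exp \<nu> * ((a (Suc k) - a k) * exp (- hinge_sum N a l (a k)) *
      zeta (- (\<Sum>i\<le>k. l i) * (a (Suc k) - a k))))"
  proof (intro sum.cong refl)
    fix k assume "k \<in> {..<N}"
    hence k: "k < N" by simp
    have "integral {a k..a (Suc k)} (\<lambda>s. exp (\<nu> - hinge_sum N a l s)) =
        integral {a k..a k + (a (Suc k) - a k)} (\<lambda>s. exp ((\<nu> - hinge_sum N a l (a k)) - (\<Sum>i\<le>k. l i) * (s - a k)))"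
    proof -
      have e: "a k + (a (Suc k) - a k) = a (Suc k)" by simp
      have *: "\<nu> - hinge_sum N a l s = (\<nu> - hinge_sum N a l (a k)) - (\<Sum>i\<le>k. l i) * (s - a k)"
        if "s \<in> {a k..a (Suc k)}" for s
        using hinge_sum_piece[OF k, of s l] that by simp
      show ?thesis unfolding e by (intro integral_cong arg_cong[where f = exp] *)
    qed
    also have "\<dots> = exp (\<nu> - hinge_sum N a l (a k)) * (a (Suc k) - a k) * zeta (- (\<Sum>i\<le>k. l i) * (a (Suc k) - a k))"
      using knot_less[OF k] by (intro zeta_integral) simp
    also have "exp (\<nu> - hinge_sum N a l (a k)) = exp \<nu> * exp (- hinge_sum N a l (a k))"
      by (simp flip: exp_add)
    finally show "integral {a k..a (Suc k)} (\<lambda>s. exp (\<nu> - hinge_sum N a l s)) =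
        exp \<nu> * ((a (Suc k) - a k) * exp (- hinge_sum N a l (a k)) * zeta (- (\<Sum>i\<le>k. l i) * (a (Suc k) - a k)))"
      by (simp only: mult_ac)
  qed
  finally show ?thesis by (simp only: sum_distrib_left)
qed

text \<open>Read \<open>b j\<close> as the probability of lying at the knot \<open>a j\<close> or
  beyond. Summation by parts shows that \<open>c\<close> consists of the hinge moments of the law
  with weights \<open>b j - b (Suc j)\<close>, which are positive exactly because \<open>b\<close>
  decreases strictly from 1 to 0.\<close>

lemma dual_coercive_steps:
  assumes b: "b 0 = 1" "b (Suc N) = 0" "\<And>j. j \<le> N \<Longrightarrow> b (Suc j) < b j"
    and c: "\<And>i. i < N \<Longrightarrow> c i = (\<Sum>j=Suc i..N. b j * (a j - a (j - 1)))"
  shows "\<exists>R. \<forall>\<nu> l. dual N a c \<nu> l \<le> B \<longrightarrow> \<bar>\<nu>\<bar> \<le> R \<and> (\<forall>i<N. \<bar>l i\<bar> \<le> R)"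
proof -
  have parts: "(\<Sum>j\<le>m. (b j - b (Suc j)) * u j) = b 0 * u 0 + (\<Sum>j=1..m. b j * (u j - u (j - 1))) - b (Suc m) * u m"
    for m and u :: "nat \<Rightarrow> real"
    by (induction m) (auto simp: algebra_simps)
  show ?thesis
  proof (rule dual_coercive[where p = "\<lambda>j. b j - b (Suc j)"])
    show "0 < b j - b (Suc j)" if "j \<le> N" for j using b(3)[OF that] by simp
    show "(\<Sum>j\<le>N. b j - b (Suc j)) = 1"
      using parts[of "\<lambda>_. 1" N] b by simp
    fix i assume i: "i < N"
    have "(\<Sum>j\<le>N. (b j - b (Suc j)) * hinge (a i) (a j)) = (\<Sum>j=1..N. b j * (hinge (a i) (a j) - hinge (a i) (a (j - 1))))"
      unfolding parts using b knot_mono[of 0 i] i by (simp add: hinge_def)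
    also have "\<dots> = (\<Sum>j=1..N. if Suc i \<le> j then b j * (a j - a (j - 1)) else 0)"
    proof (intro sum.cong refl)
      fix j assume "j \<in> {1..N}"
      then obtain k where k: "j = Suc k" "k < N" by (cases j) auto
      show "b j * (hinge (a i) (a j) - hinge (a i) (a (j - 1))) = (if Suc i \<le> j then b j * (a j - a (j - 1)) else 0)"
      proof (cases "i \<le> k")
        case True
        thus ?thesis using knot_mono[of i k] knot_less[of k] k by (simp add: hinge_def)
      next
        case False
        thus ?thesis using knot_mono[of "Suc k" i] knot_less[of k] k i by (simp add: hinge_def)
      qed
    qed
    also have "\<dots> = (\<Sum>j\<in>{j\<in>{1..N}. Suc i \<le> j}. b j * (a j - a (j - 1)))"
      by (rule sum.inter_filter [symmetric]) simp
    also have "{j\<in>{1..N}. Suc i \<le> j} = {Suc i..N}" by auto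
    finally show "c i = (\<Sum>j\<le>N. (b j - b (Suc j)) * hinge (a i) (a j))"
      using c[OF i] by simp
  qed
qed

end

section \<open>Input laws with a given law of the output\<close>

text \<open>Both entries move the fraction \<theta> of the way to their \<open>h\<close>-weighted
  mean. This keeps \<open>h i * x i + h j * x j\<close> and, for \<theta> between 0 and 1, common
  bounds on the two entries. Being linear in \<open>x\<close>, it commutes with expectation, so it
  acts alike on inputs and on their means.\<close>

definition transfer ::
    "(nat \<Rightarrow> real) \<Rightarrow> nat \<Rightarrow> nat \<Rightarrow> real \<Rightarrow> (nat \<Rightarrow> real) \<Rightarrow> nat \<Rightarrow> real" where
  "transfer h i j \<theta> x = (let m = (h i * x i + h j * x j) / (h i + h j) in
     x(i := (1 - \<theta>) * x i + \<theta> * m, j := (1 - \<theta>) * x j + \<theta> * m))"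

lemma sum_fun_upd2:
  fixes f :: "nat \<Rightarrow> real \<Rightarrow> real"
  assumes "finite A" "i \<noteq> j"
  shows "(\<Sum>k\<in>A. f k ((x(i := u, j := v)) k)) =
    (\<Sum>k\<in>A. f k (x k)) + (if i \<in> A then f i u - f i (x i) else 0) + (if j \<in> A then f j v - f j (x j) else 0)"
proof -
  have "(\<Sum>k\<in>A. f k ((x(i := u, j := v)) k)) =
      (\<Sum>k\<in>A. f k (x k) + (if k = i then f i u - f i (x i) else 0) + (if k = j then f j v - f j (x j) else 0))"
    using assms(2) by (intro sum.cong) auto
  thus ?thesis using assms by (simp add: sum.distrib)
qed

text \<open>
  Transfer from the last index above its target to the first later index below its target, as much
  as brings one of the two onto its target. Since the targets decrease, this is a Robin Hood step,
  and the entries in between already agree with their targets, so the suffix sums stay admissible.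
\<close>

lemma transfer_closed_reaches_below:
  fixes h \<alpha> \<beta> :: "nat \<Rightarrow> real" and Q :: "(nat \<Rightarrow> real) \<Rightarrow> bool"
  assumes h: "\<And>k. k \<in> {1..n} \<Longrightarrow> h k > 0"
    and \<alpha>: "\<And>i j. i \<in> {1..n} \<Longrightarrow> j \<in> {1..n} \<Longrightarrow> i \<le> j \<Longrightarrow> \<alpha> j \<le> \<alpha> i"
    and closed: "\<And>\<beta> i j \<theta>. Q \<beta> \<Longrightarrow> i \<in> {1..n} \<Longrightarrow> j \<in> {1..n} \<Longrightarrow> i \<noteq> j \<Longrightarrow>
      0 \<le> \<theta> \<Longrightarrow> \<theta> \<le> 1 \<Longrightarrow> Q (transfer h i j \<theta> \<beta>)"
    and "Q \<beta>"
    and "\<And>k. k \<in> {1..n} \<Longrightarrow> (\<Sum>i=k..n. h i * (\<beta> i - \<alpha> i)) \<le> 0"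
  shows "\<exists>\<beta>'. Q \<beta>' \<and> (\<forall>k\<in>{1..n}. \<beta>' k \<le> \<alpha> k) \<and> (\<Sum>k=1..n. h k * \<beta>' k) = (\<Sum>k=1..n. h k * \<beta> k)"
  using assms(4,5)
proof (induction "card {k\<in>{1..n}. \<beta> k \<noteq> \<alpha> k}" arbitrary: \<beta> rule: less_induct)
  case less
  define S where "S k = (\<Sum>i=k..n. h i * (\<beta> i - \<alpha> i))" for k
  have S_le: "S k \<le> 0" if "k \<in> {1..n}" for k
    using less.prems(2)[OF that] by (simp add: S_def)
  have S_rec: "S k = h k * (\<beta> k - \<alpha> k) + S (Suc k)" if "k \<in> {1..n}" for k
    using that by (simp add: S_def sum.atLeast_Suc_atMost)
  show ?case
  proof (cases "\<forall>k\<in>{1..n}. \<beta> k \<le> \<alpha> k")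
    case True
    thus ?thesis using less.prems(1) by blast
  next
    case False
    define I where "I = {k\<in>{1..n}. \<beta> k > \<alpha> k}"
    obtain k where "k \<in> {1..n}" "\<beta> k > \<alpha> k" using False by (meson not_le)
    hence I: "finite I" "I \<noteq> {}" unfolding I_def by auto
    define i where "i = Max I"
    have i: "i \<in> {1..n}" "\<beta> i > \<alpha> i" using Max_in[OF I] by (auto simp: i_def I_def)
    have above_i: "\<beta> k \<le> \<alpha> k" if "k \<in> {i<..n}" for k
    proof (rule ccontr)
      assume "\<not> \<beta> k \<le> \<alpha> k"
      hence "k \<in> I" using that by (auto simp: I_def)
      hence "k \<le> i" unfolding i_def using I(1) by simp
      thus False using that by simp
    qed
    define J where "J = {k\<in>{i<..n}. \<beta> k < \<alpha> k}"
    \<comment> \<open>With no later deficit the suffix sum at \<open>i\<close> would reduce to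
      \<open>h i * (\<beta> i - \<alpha> i)\<close>, which is positive.\<close>
    have "J \<noteq> {}"
    proof
      assume "J = {}"
      hence "\<beta> k = \<alpha> k" if "k \<in> {i<..n}" for k
      proof -
        have "\<not> \<beta> k < \<alpha> k" using that \<open>J = {}\<close> unfolding J_def by blast
        thus ?thesis using above_i[OF that] by simp
      qed
      hence "S (Suc i) = 0"
        unfolding S_def by (intro sum.neutral) auto
      hence "S i > 0" using S_rec[OF i(1)] i h by simp
      thus False using S_le[OF i(1)] by simp
    qed
    hence J: "finite J" "J \<noteq> {}" by (auto simp: J_def)
    define j where "j = Min J"
    have j: "j \<in> {i<..n}" "\<beta> j < \<alpha> j" using Min_in[OF J] by (auto simp: j_def J_def)
    have between: "\<beta> k = \<alpha> k" if "i < k" "k < j" for k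
    proof -
      have "k \<in> {i<..n}" using that j(1) by simp
      moreover have "k \<notin> J" using Min_le[OF J(1), of k] that by (auto simp: j_def)
      ultimately show ?thesis using above_i[of k] by (auto simp: J_def)
    qed
    have jn: "j \<in> {1..n}" "i \<noteq> j" using i j by auto
    have hi: "h i > 0" and hj: "h j > 0" using h i jn by auto
    define \<delta> where "\<delta> = min (h i * (\<beta> i - \<alpha> i)) (h j * (\<alpha> j - \<beta> j))"
    have \<delta>: "\<delta> > 0" "\<delta> \<le> h i * (\<beta> i - \<alpha> i)" "\<delta> \<le> h j * (\<alpha> j - \<beta> j)"
      using hi hj i j by (auto simp: \<delta>_def)
    have "\<alpha> j \<le> \<alpha> i" using \<alpha>[OF i(1) jn(1)] j by simp
    hence gap: "\<beta> i - \<beta> j > 0" using i j by simp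
    \<comment> \<open>\<delta> is the weighted amount carried from \<open>i\<close> to
      \<open>j\<close>; solving for the fraction that moves this amount gives \<theta>. It is at
      most 1 because the target at \<open>j\<close> does not exceed the one at \<open>i\<close>, so
      the two entries never cross.\<close>
    define \<theta> where "\<theta> = \<delta> * (h i + h j) / (h i * h j * (\<beta> i - \<beta> j))"
    have "\<delta> * h j \<le> h i * (\<beta> i - \<alpha> i) * h j" "\<delta> * h i \<le> h j * (\<alpha> j - \<beta> j) * h i"
      using \<delta> hi hj by simp_all
    hence "\<delta> * (h i + h j) \<le> h i * h j * (\<beta> i - \<beta> j) - h i * h j * (\<alpha> i - \<alpha> j)"
      by (simp add: algebra_simps)
    also have "\<dots> \<le> h i * h j * (\<beta> i - \<beta> j)"
      using hi hj \<open>\<alpha> j \<le> \<alpha> i\<close> by simp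
    finally have \<theta>: "0 \<le> \<theta>" "\<theta> \<le> 1"
      using hi hj gap \<delta> by (simp_all add: \<theta>_def)
    define \<beta>' where "\<beta>' = \<beta>(i := \<beta> i - \<delta> / h i, j := \<beta> j + \<delta> / h j)"
    have tr: "transfer h i j \<theta> \<beta> = \<beta>'"
    proof -
      define m where "m = (h i * \<beta> i + h j * \<beta> j) / (h i + h j)"
      have hh: "h i + h j \<noteq> 0" "h i * h j * (\<beta> i - \<beta> j) \<noteq> 0" using hi hj gap by auto
      have "\<beta> i - m = h j * (\<beta> i - \<beta> j) / (h i + h j)" "m - \<beta> j = h i * (\<beta> i - \<beta> j) / (h i + h j)"
        unfolding m_def using hh(1) by (simp_all add: field_simps)
      moreover have "\<theta> * (h j * (\<beta> i - \<beta> j) / (h i + h j)) = \<delta> / h i"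
        "\<theta> * (h i * (\<beta> i - \<beta> j) / (h i + h j)) = \<delta> / h j"
        unfolding \<theta>_def using hi hj gap hh by (simp_all add: divide_simps)
      ultimately have "\<theta> * (\<beta> i - m) = \<delta> / h i" "\<theta> * (m - \<beta> j) = \<delta> / h j" by simp_all
      hence "(1 - \<theta>) * \<beta> i + \<theta> * m = \<beta> i - \<delta> / h i" "(1 - \<theta>) * \<beta> j + \<theta> * m = \<beta> j + \<delta> / h j"
        by (simp_all add: algebra_simps)
      thus ?thesis by (simp add: transfer_def \<beta>'_def m_def[symmetric])
    qed
    have Q': "Q \<beta>'"
      using closed[OF less.prems(1) i(1) jn \<theta>] tr by simp
    have sum': "(\<Sum>k\<in>A. h k * (\<beta>' k - g k)) = (\<Sum>k\<in>A. h k * (\<beta> k - g k)) + (if i \<in> A then - \<delta> else 0) + (if j \<in> A then \<delta> else 0)"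
      if "finite A" for A g
      unfolding \<beta>'_def using that jn(2) hi hj
      by (subst sum_fun_upd2[where f = "\<lambda>k x. h k * (x - g k)"]) (auto simp: algebra_simps)
    have S': "(\<Sum>m=k..n. h m * (\<beta>' m - \<alpha> m)) \<le> 0" if k: "k \<in> {1..n}" for k
    \<comment> \<open>Only suffixes starting after \<open>i\<close> and not after \<open>j\<close>
      gain \<delta>. All of these sums equal the one starting at \<open>Suc i\<close>, and the
      surplus at \<open>i\<close> had forced that one down to \<open>- \<delta>\<close> or
      less.\<close>
    proof (cases "i < k \<and> k \<le> j")
      case True
      have "S (Suc i) = S k"
      proof -
        have "{Suc i..n} = {Suc i..<k} \<union> {k..n}" using True jn by auto
        hence "S (Suc i) = (\<Sum>m=Suc i..<k. h m * (\<beta> m - \<alpha> m)) + S k"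
          unfolding S_def by (simp add: sum.union_disjoint ivl_disj_int_two)
        also have "(\<Sum>m=Suc i..<k. h m * (\<beta> m - \<alpha> m)) = 0"
          using True by (intro sum.neutral) (auto simp: between)
        finally show ?thesis by simp
      qed
      hence "S k \<le> - \<delta>" using S_rec[OF i(1)] S_le[OF i(1)] \<delta> by linarith
      thus ?thesis using True k jn by (subst sum') (auto simp: S_def)
    next
      case False
      thus ?thesis using S_le[OF k] i jn j by (subst sum') (auto simp: S_def)
    qed
    have "\<beta>' i = \<alpha> i \<or> \<beta>' j = \<alpha> j"
    proof (cases "h i * (\<beta> i - \<alpha> i) \<le> h j * (\<alpha> j - \<beta> j)")
      case True
      hence "\<delta> / h i = \<beta> i - \<alpha> i" using hi by (simp add: \<delta>_def)
      thus ?thesis using jn(2) by (simp add: \<beta>'_def)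
    next
      case False
      hence "\<delta> / h j = \<alpha> j - \<beta> j" using hj by (simp add: \<delta>_def)
      thus ?thesis by (simp add: \<beta>'_def)
    qed
    hence "{k\<in>{1..n}. \<beta>' k \<noteq> \<alpha> k} \<subset> {k\<in>{1..n}. \<beta> k \<noteq> \<alpha> k}"
    proof -
      have "k = i \<or> k = j \<or> \<beta>' k = \<beta> k" for k by (simp add: \<beta>'_def)
      moreover have "\<beta> i \<noteq> \<alpha> i" "\<beta> j \<noteq> \<alpha> j" using i j by auto
      ultimately show ?thesis
        using \<open>\<beta>' i = \<alpha> i \<or> \<beta>' j = \<alpha> j\<close> i(1) jn(1) by (auto; metis)
    qed
    hence "card {k\<in>{1..n}. \<beta>' k \<noteq> \<alpha> k} < card {k\<in>{1..n}. \<beta> k \<noteq> \<alpha> k}"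
      by (intro psubset_card_mono) auto
    from less.hyps[OF this Q' S'] obtain \<beta>'' where "Q \<beta>''" "\<forall>k\<in>{1..n}. \<beta>'' k \<le> \<alpha> k"
      "(\<Sum>k=1..n. h k * \<beta>'' k) = (\<Sum>k=1..n. h k * \<beta>' k)" by blast
    moreover have "(\<Sum>k=1..n. h k * \<beta>' k) = (\<Sum>k=1..n. h k * \<beta> k)"
      using sum'[of "{1..n}" "\<lambda>_. 0"] i jn by simp
    ultimately show ?thesis by auto
  qed
qed

section \<open>Inputs as functions of the output\<close>

text \<open>Projection onto the unit interval. It changes nothing almost surely under the laws of
  \<open>S\<close>, but lets inputs be bounded at every point, and it also carries the Gaussian
  tails of \<open>nn_integral_tailed_exp_le\<close>.\<close>

definition clamp01 :: "real \<Rightarrow> real" where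
  "clamp01 s = max 0 (min 1 s)"

lemma clamp01_measurable [measurable]: "clamp01 \<in> borel_measurable borel"
  unfolding clamp01_def by measurable

lemma hinge_measurable [measurable]: "hinge b \<in> borel_measurable borel"
  unfolding hinge_def by measurable

lemma H_sum_Suc: "H_sum h (Suc k) = H_sum h k + h (Suc k)"
  by (simp add: H_sum_def)

text \<open>All inputs are taken to be deterministic functions of the noiseless output
  \<open>s\<close>. The law of the output is then automatically \<rho>, and only the means remain to
  be adjusted.\<close>

lemma laws_with_given_output:
  fixes h \<alpha> :: "nat \<Rightarrow> real" and \<rho> :: "real measure"
  assumes h: "\<And>k. k \<in> {1..n} \<Longrightarrow> h k > 0" and h1: "(\<Sum>k=1..n. h k) = 1"
    and \<alpha>: "\<And>i j. i \<in> {1..n} \<Longrightarrow> j \<in> {1..n} \<Longrightarrow> i \<le> j \<Longrightarrow> \<alpha> j \<le> \<alpha> i"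
    and \<rho>: "prob_space \<rho>" "sets \<rho> = sets borel" "AE s in \<rho>. 0 \<le> s \<and> s \<le> 1"
    and mean: "\<And>k. k < n \<Longrightarrow> (\<integral>s. hinge (H_sum h k) s \<partial>\<rho>) \<le> (\<Sum>i=k+1..n. h i * \<alpha> i)"
  shows "\<exists>\<mu>\<in>BC_laws n \<alpha>. distr \<mu> borel (\<lambda>x. \<Sum>k=1..n. h k * x k) = \<rho> \<and>
    ((\<integral>s. s \<partial>\<rho>) = (\<Sum>i=1..n. h i * \<alpha> i) \<longrightarrow> \<mu> \<in> EC_laws n \<alpha>)"
proof -
  interpret \<rho>: prob_space \<rho> by fact
  have [measurable_cong]: "sets \<rho> = sets borel" by fact
  \<comment> \<open>A way of sharing out the value \<open>s\<close> among the channels;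
    \<open>Q\<close> then holds of the mean vectors that such a sharing can produce under
    \<rho>.\<close>
  define rep where "rep \<psi> \<longleftrightarrow> (\<forall>k\<in>{1..n}. \<psi> k \<in> borel_measurable borel \<and> (\<forall>s. 0 \<le> \<psi> k s \<and> \<psi> k s \<le> 1)) \<and>
    (\<forall>s. (\<Sum>k=1..n. h k * \<psi> k s) = clamp01 s)" for \<psi> :: "nat \<Rightarrow> real \<Rightarrow> real"
  define Q where "Q \<beta> \<longleftrightarrow> (\<exists>\<psi>. rep \<psi> \<and> (\<forall>k\<in>{1..n}. \<beta> k = (\<integral>s. \<psi> k s \<partial>\<rho>)))" for \<beta>
  have rep_int: "integrable \<rho> (\<psi> k)" if "rep \<psi>" "k \<in> {1..n}" for \<psi> k
  proof -
    have "\<psi> k \<in> borel_measurable borel" "\<And>s. 0 \<le> \<psi> k s \<and> \<psi> k s \<le> 1"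
      using that unfolding rep_def by blast+
    thus ?thesis by (intro \<rho>.integrable_const_bound[where B = 1]) auto
  qed
  have closed: "Q (transfer h i j \<theta> \<beta>)"
    if Q: "Q \<beta>" and i: "i \<in> {1..n}" and j: "j \<in> {1..n}" and ij: "i \<noteq> j" and \<theta>: "0 \<le> \<theta>" "\<theta> \<le> 1"
    for \<beta> i j \<theta>
  proof -
    obtain \<psi> where \<psi>: "rep \<psi>" "\<And>k. k \<in> {1..n} \<Longrightarrow> \<beta> k = (\<integral>s. \<psi> k s \<partial>\<rho>)"
      using Q unfolding Q_def by blast
    have hi: "h i > 0" and hj: "h j > 0" using h i j by auto
    \<comment> \<open>The transfer is made separately at every \<open>s\<close>; linearity carries
      it over to the means.\<close>
    define m where "m s = (h i * \<psi> i s + h j * \<psi> j s) / (h i + h j)" for s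
    define \<psi>' where "\<psi>' = \<psi>(i := \<lambda>s. (1 - \<theta>) * \<psi> i s + \<theta> * m s, j := \<lambda>s. (1 - \<theta>) * \<psi> j s + \<theta> * m s)"
    have meas [measurable]: "\<psi> i \<in> borel_measurable borel" "\<psi> j \<in> borel_measurable borel"
      using \<psi>(1) i j unfolding rep_def by auto
    have bnd: "0 \<le> \<psi> k s" "\<psi> k s \<le> 1" if "k \<in> {1..n}" for k s
      using \<psi>(1) that unfolding rep_def by auto
    have m: "0 \<le> m s" "m s \<le> 1" for s
    proof -
      show "0 \<le> m s" using bnd[OF i] bnd[OF j] hi hj by (simp add: m_def)
      have "h i * \<psi> i s \<le> h i * 1" "h j * \<psi> j s \<le> h j * 1"
        using bnd[OF i, of s] bnd[OF j, of s] hi hj by simp_all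
      hence "h i * \<psi> i s + h j * \<psi> j s \<le> h i + h j" by linarith
      thus "m s \<le> 1" using hi hj by (simp add: m_def)
    qed
    have cvx: "0 \<le> (1 - \<theta>) * u + \<theta> * v \<and> (1 - \<theta>) * u + \<theta> * v \<le> 1"
      if "0 \<le> u" "u \<le> 1" "0 \<le> v" "v \<le> 1" for u v :: real
      using \<theta> that convex_bound_le[of u 1 v "1 - \<theta>" \<theta>] by simp
    have "rep \<psi>'"
      unfolding rep_def
    proof (intro conjI ballI allI)
      fix k assume k: "k \<in> {1..n}"
      have [measurable]: "\<psi> k \<in> borel_measurable borel"
        using \<psi>(1) k unfolding rep_def by auto
      have [measurable]: "m \<in> borel_measurable borel" unfolding m_def by measurable
      show "\<psi>' k \<in> borel_measurable borel" unfolding \<psi>'_def fun_upd_def by (cases "k = j"; cases "k = i") auto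
      fix s
      show "0 \<le> \<psi>' k s" "\<psi>' k s \<le> 1"
        using cvx[OF bnd[OF i, of s] m[of s]] cvx[OF bnd[OF j, of s] m[of s]] bnd[OF k, of s] by (auto simp: \<psi>'_def)
    next
      fix s
      have "(\<Sum>k=1..n. h k * \<psi>' k s) =
          (\<Sum>k=1..n. h k * ((\<lambda>k. \<psi> k s)(i := (1 - \<theta>) * \<psi> i s + \<theta> * m s, j := (1 - \<theta>) * \<psi> j s + \<theta> * m s)) k)"
        by (intro sum.cong) (auto simp: \<psi>'_def)
      also have "\<dots> = (\<Sum>k=1..n. h k * \<psi> k s)
          + (h i * ((1 - \<theta>) * \<psi> i s + \<theta> * m s) - h i * \<psi> i s) + (h j * ((1 - \<theta>) * \<psi> j s + \<theta> * m s) - h j * \<psi> j s)"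
        using ij i j by (subst sum_fun_upd2[where f = "\<lambda>k x. h k * x"]) auto
      also have "\<dots> = (\<Sum>k=1..n. h k * \<psi> k s) + \<theta> * ((h i + h j) * m s - (h i * \<psi> i s + h j * \<psi> j s))"
        by (simp add: algebra_simps)
      also have "(h i + h j) * m s = h i * \<psi> i s + h j * \<psi> j s"
        using hi hj by (simp add: m_def)
      finally show "(\<Sum>k=1..n. h k * \<psi>' k s) = clamp01 s"
        using \<psi>(1) unfolding rep_def by simp
    qed
    moreover have "transfer h i j \<theta> \<beta> k = (\<integral>s. \<psi>' k s \<partial>\<rho>)" if k: "k \<in> {1..n}" for k
      using ij \<psi>(2)[OF k] \<psi>(2)[OF i] \<psi>(2)[OF j] rep_int[OF \<psi>(1) i] rep_int[OF \<psi>(1) j]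
      by (auto simp: transfer_def \<psi>'_def Let_def m_def)
    ultimately show ?thesis unfolding Q_def by blast
  qed
  \<comment> \<open>Greedy filling: \<open>\<phi> k\<close> climbs from 0 to 1 while
    \<open>s\<close> runs from \<open>H_sum h (k - 1)\<close> to \<open>H_sum h k\<close>, so
    weighted suffix sums telescope to hinges.\<close>
  define \<phi> where "\<phi> k s = (hinge (H_sum h (k - 1)) (clamp01 s) - hinge (H_sum h k) (clamp01 s)) / h k" for k s
  have tele: "(\<Sum>k=i..n. h k * \<phi> k s) = hinge (H_sum h (i - 1)) (clamp01 s)" if i: "i \<in> {1..n}" for i s
  proof -
    have "(\<Sum>k=i..n. h k * \<phi> k s) =
        (\<Sum>k=i..n. - hinge (H_sum h k) (clamp01 s) - (- hinge (H_sum h (k - 1)) (clamp01 s)))"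
    proof (intro sum.cong refl)
      fix k assume "k \<in> {i..n}"
      hence "h k > 0" using h i by simp
      thus "h k * \<phi> k s = - hinge (H_sum h k) (clamp01 s) - (- hinge (H_sum h (k - 1)) (clamp01 s))"
        by (simp add: \<phi>_def)
    qed
    also have "\<dots> = - hinge (H_sum h n) (clamp01 s) - (- hinge (H_sum h (i - 1)) (clamp01 s))"
    proof -
      obtain m where "i = Suc m" "m \<le> n" using i by (cases i) auto
      thus ?thesis using sum_telescope''[of m n "\<lambda>k. - hinge (H_sum h k) (clamp01 s)"] by simp
    qed
    also have "hinge (H_sum h n) (clamp01 s) = 0"
      unfolding H_sum_def h1 by (simp add: hinge_def clamp01_def)
    finally show ?thesis by simp
  qed
  have rep\<phi>: "rep \<phi>"
    unfolding rep_def
  proof (intro conjI ballI allI)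
    fix k assume k: "k \<in> {1..n}"
    show "\<phi> k \<in> borel_measurable borel" unfolding \<phi>_def by measurable
    have "H_sum h k = H_sum h (k - 1) + h k" using H_sum_Suc[of h "k - 1"] k by simp
    thus "0 \<le> \<phi> k s" "\<phi> k s \<le> 1" for s
      using h[OF k] by (auto simp: \<phi>_def hinge_def max_def field_simps)
  next
    fix s
    show "(\<Sum>k=1..n. h k * \<phi> k s) = clamp01 s"
    proof (cases "n = 0")
      case False
      thus ?thesis using tele[of 1 s] by (simp add: H_sum_def hinge_def clamp01_def)
    qed (use h1 in simp)
  qed
  define \<beta> where "\<beta> k = (\<integral>s. \<phi> k s \<partial>\<rho>)" for k
  have Q\<beta>: "Q \<beta>" unfolding Q_def \<beta>_def using rep\<phi> by blast
  have AEc: "AE s in \<rho>. clamp01 s = s"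
    using \<rho>(3) by eventually_elim (simp add: clamp01_def)
  have "(\<Sum>i=k..n. h i * (\<beta> i - \<alpha> i)) \<le> 0" if k: "k \<in> {1..n}" for k
  proof -
    have "(\<Sum>i=k..n. h i * \<beta> i) = (\<Sum>i=k..n. (\<integral>s. h i * \<phi> i s \<partial>\<rho>))"
      by (simp add: \<beta>_def)
    also have "\<dots> = (\<integral>s. (\<Sum>i=k..n. h i * \<phi> i s) \<partial>\<rho>)"
      using k by (intro Bochner_Integration.integral_sum [symmetric] integrable_mult_right rep_int[OF rep\<phi>]) auto
    also have "\<dots> = (\<integral>s. hinge (H_sum h (k - 1)) (clamp01 s) \<partial>\<rho>)"
      by (simp add: tele[OF k])
    also have "\<dots> = (\<integral>s. hinge (H_sum h (k - 1)) s \<partial>\<rho>)"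
      using AEc by (intro integral_cong_AE) auto
    also have "\<dots> \<le> (\<Sum>i=k..n. h i * \<alpha> i)"
    proof -
      have "k - 1 < n" "k - 1 + 1 = k" using k by auto
      thus ?thesis using mean[of "k - 1"] by metis
    qed
    finally show ?thesis by (simp add: right_diff_distrib sum_subtractf)
  qed
  from transfer_closed_reaches_below[OF h \<alpha> closed Q\<beta> this]
  obtain \<beta>' where \<beta>': "Q \<beta>'" "\<And>k. k \<in> {1..n} \<Longrightarrow> \<beta>' k \<le> \<alpha> k"
    "(\<Sum>k=1..n. h k * \<beta>' k) = (\<Sum>k=1..n. h k * \<beta> k)" by blast
  obtain \<psi> where \<psi>: "rep \<psi>" "\<And>k. k \<in> {1..n} \<Longrightarrow> \<beta>' k = (\<integral>s. \<psi> k s \<partial>\<rho>)"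
    using \<beta>'(1) unfolding Q_def by blast
  have \<psi>_meas [measurable]: "\<psi> k \<in> borel_measurable borel" if "k \<in> {1..n}" for k
    using \<psi>(1) that unfolding rep_def by auto
  have \<psi>_sum: "(\<Sum>k=1..n. h k * \<psi> k s) = clamp01 s" for s
    using \<psi>(1) unfolding rep_def by auto
  define X where "X s = (\<lambda>k\<in>{1..n}. \<psi> k s)" for s
  have X [measurable]: "X \<in> \<rho> \<rightarrow>\<^sub>M input_space n"
    unfolding X_def by (rule measurable_restrict) measurable
  have component: "(\<lambda>x. x k) \<in> borel_measurable (input_space n)" if "k \<in> {1..n}" for k
    using that by (rule measurable_component_singleton)
  hence out_meas [measurable]: "(\<lambda>x. \<Sum>k=1..n. h k * x k) \<in> borel_measurable (input_space n)"
    by (intro borel_measurable_sum borel_measurable_times) auto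
  define \<mu> where "\<mu> = distr \<rho> (input_space n) X"
  have \<mu>_mean: "(\<integral>x. x k \<partial>\<mu>) = \<beta>' k" if k: "k \<in> {1..n}" for k
  proof -
    have "(\<integral>x. x k \<partial>\<mu>) = (\<integral>s. X s k \<partial>\<rho>)"
      unfolding \<mu>_def by (rule integral_distr[OF X component[OF k]])
    thus ?thesis using \<psi>(2)[OF k] k by (simp add: X_def)
  qed
  have \<mu>_bdd: "\<mu> \<in> bounded_input_laws n"
    unfolding bounded_input_laws_def
  proof (intro CollectI conjI ballI)
    show "prob_space \<mu>" unfolding \<mu>_def by (rule \<rho>.prob_space_distr) measurable
    show "sets \<mu> = sets (input_space n)" by (simp add: \<mu>_def)
    fix k assume k: "k \<in> {1..n}"
    show "AE x in \<mu>. 0 \<le> x k \<and> x k \<le> 1"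
    proof -
      have "0 \<le> X s k \<and> X s k \<le> 1" for s using \<psi>(1) k by (auto simp: X_def rep_def)
      moreover note [measurable] = component[OF k]
      have "{x \<in> space (input_space n). 0 \<le> x k \<and> x k \<le> 1} \<in> sets (input_space n)" by measurable
      ultimately show ?thesis unfolding \<mu>_def by (subst AE_distr_iff[OF X]) simp_all
    qed
  qed
  have "\<mu> \<in> BC_laws n \<alpha>"
    using \<mu>_bdd \<mu>_mean \<beta>'(2) by (simp add: BC_laws_def)
  moreover have "distr \<mu> borel (\<lambda>x. \<Sum>k=1..n. h k * x k) = \<rho>"
  proof -
    have "distr \<mu> borel (\<lambda>x. \<Sum>k=1..n. h k * x k) = distr \<rho> borel (\<lambda>s. \<Sum>k=1..n. h k * X s k)"
      unfolding \<mu>_def by (subst distr_distr[OF out_meas X]) (simp add: comp_def)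
    also have "(\<lambda>s. \<Sum>k=1..n. h k * X s k) = clamp01"
      using \<psi>_sum by (simp add: X_def)
    also have "distr \<rho> borel clamp01 = distr \<rho> borel (\<lambda>s. s)"
      using AEc by (intro distr_cong_AE) auto
    also have "\<dots> = \<rho>" using \<rho>(2) by (simp add: distr_id2)
    finally show ?thesis .
  qed
  moreover have "\<mu> \<in> EC_laws n \<alpha>" if m: "(\<integral>s. s \<partial>\<rho>) = (\<Sum>i=1..n. h i * \<alpha> i)"
  proof -
    have "(\<Sum>k=1..n. h k * \<beta> k) = (\<integral>s. (\<Sum>k=1..n. h k * \<phi> k s) \<partial>\<rho>)"
      unfolding \<beta>_def by (subst Bochner_Integration.integral_sum) (auto intro!: integrable_mult_right rep_int[OF rep\<phi>])
    also have "\<dots> = (\<integral>s. clamp01 s \<partial>\<rho>)" using rep\<phi> by (simp add: rep_def)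
    also have "\<dots> = (\<integral>s. s \<partial>\<rho>)" using AEc by (intro integral_cong_AE) auto
    \<comment> \<open>Transfers preserve the weighted total. If it equals the target total, the
      slacks are nonnegative with sum zero, so each of them vanishes.\<close>
    finally have "(\<Sum>k=1..n. h k * (\<alpha> k - \<beta>' k)) = 0"
      using m \<beta>'(3) by (simp add: right_diff_distrib sum_subtractf)
    hence "\<forall>k\<in>{1..n}. h k * (\<alpha> k - \<beta>' k) = 0"
      using h \<beta>'(2) by (subst (asm) sum_nonneg_eq_0_iff) (auto intro!: mult_nonneg_nonneg simp: less_imp_le)
    hence "\<And>k. k \<in> {1..n} \<Longrightarrow> \<beta>' k = \<alpha> k" using h by force
    thus ?thesis using \<mu>_bdd \<mu>_mean by (simp add: EC_laws_def)
  qed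
  ultimately show ?thesis by blast
qed

section \<open>Additive Gaussian noise\<close>

abbreviation noise :: "real \<Rightarrow> real measure" where
  "noise \<sigma> \<equiv> density lborel (\<lambda>z. ennreal (normal_density 0 \<sigma> z))"

lemma (in prob_space) distr_pair_snd:
  assumes "sigma_finite_measure N" shows "distr (M \<Otimes>\<^sub>M N) N snd = N"
proof (rule measure_eqI)
  interpret N: sigma_finite_measure N by fact
  fix A assume A: "A \<in> sets (distr (M \<Otimes>\<^sub>M N) N snd)"
  hence "snd -` A \<inter> space (M \<Otimes>\<^sub>M N) = space M \<times> A"
    by (auto simp: space_pair_measure dest: sets.sets_into_space)
  thus "emeasure (distr (M \<Otimes>\<^sub>M N) N snd) A = emeasure N A"
    using A by (simp add: emeasure_distr N.emeasure_pair_measure_Times emeasure_space_1)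
qed simp

lemma nn_integral_noise_shift:
  assumes [measurable]: "g \<in> borel_measurable borel"
  shows "(\<integral>\<^sup>+z. g (s + z) \<partial>noise \<sigma>) = (\<integral>\<^sup>+y. ennreal (normal_density 0 \<sigma> (y - s)) * g y \<partial>lborel)"
proof -
  have "(\<integral>\<^sup>+z. g (s + z) \<partial>noise \<sigma>) = (\<integral>\<^sup>+z. ennreal (normal_density 0 \<sigma> z) * g (s + z) \<partial>lborel)"
    by (subst nn_integral_density) auto
  also have "\<dots> = (\<integral>\<^sup>+y. ennreal (normal_density 0 \<sigma> (y - s)) * g y \<partial>lborel)"
    by (subst nn_integral_real_affine[where c = 1 and t = s]) auto
  finally show ?thesis .
qed

section \<open>Density and entropy of the output\<close>

text \<open>Only the scalar \<open>S\<close> is seen through the noise, so the space of inputs is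
  left arbitrary.\<close>

locale noisy_channel = prob_space M for M :: "'a measure" +
  fixes S :: "'a \<Rightarrow> real" and \<sigma> :: real
  assumes S_meas [measurable]: "S \<in> borel_measurable M"
    and S_bounds: "AE x in M. 0 \<le> S x \<and> S x \<le> 1"
    and \<sigma>_pos: "0 < \<sigma>"
begin

sublocale noise: prob_space "noise \<sigma>"
  using \<sigma>_pos by (rule prob_space_normal_density)

sublocale joint: pair_prob_space M "noise \<sigma>" ..

sublocale lb: pair_sigma_finite M lborel ..

definition out_density :: "real \<Rightarrow> real" where
  "out_density y = (\<integral>x. normal_density 0 \<sigma> (y - S x) \<partial>M)"

lemma normal_density_le: "normal_density 0 \<sigma> z \<le> 1 / sqrt (2 * pi * \<sigma>\<^sup>2)"
  using \<sigma>_pos by (simp add: normal_density_def divide_right_mono)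

lemma kernel_integrable: "integrable M (\<lambda>x. normal_density 0 \<sigma> (y - S x))"
  by (intro integrable_const_bound[where B = "1 / sqrt (2 * pi * \<sigma>\<^sup>2)"]) (auto simp: normal_density_le)

lemma out_density_measurable [measurable]: "out_density \<in> borel_measurable borel"
  unfolding out_density_def by measurable

lemma ennreal_out_density: "ennreal (out_density y) = (\<integral>\<^sup>+x. ennreal (normal_density 0 \<sigma> (y - S x)) \<partial>M)"
  unfolding out_density_def using kernel_integrable by (subst nn_integral_eq_integral) auto

lemma out_density_le: "out_density y \<le> 1 / sqrt (2 * pi * \<sigma>\<^sup>2)"
proof -
  have "out_density y \<le> (\<integral>x. 1 / sqrt (2 * pi * \<sigma>\<^sup>2) \<partial>M)"
    unfolding out_density_def by (intro integral_mono kernel_integrable) (auto simp: normal_density_le)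
  thus ?thesis by (simp add: prob_space)
qed

text \<open>No value of \<open>S\<close> is further than \<open>\<bar>y\<bar> + 1\<close> from
  \<open>y\<close>. Besides positivity, this gives the quadratic lower bound on
  \<open>ln out_density\<close> from which its integrability follows.\<close>

lemma out_density_ge:
  "1 / sqrt (2 * pi * \<sigma>\<^sup>2) * exp (- (\<bar>y\<bar> + 1)\<^sup>2 / (2 * \<sigma>\<^sup>2)) \<le> out_density y"
proof -
  have "(\<integral>x. 1 / sqrt (2 * pi * \<sigma>\<^sup>2) * exp (- (\<bar>y\<bar> + 1)\<^sup>2 / (2 * \<sigma>\<^sup>2)) \<partial>M) \<le> out_density y"
    unfolding out_density_def
  proof (intro integral_mono_AE kernel_integrable)
    show "AE x in M. 1 / sqrt (2 * pi * \<sigma>\<^sup>2) * exp (- (\<bar>y\<bar> + 1)\<^sup>2 / (2 * \<sigma>\<^sup>2)) \<le> normal_density 0 \<sigma> (y - S x)"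
      using S_bounds
    proof eventually_elim
      case (elim x)
      have "\<bar>y - S x\<bar> \<le> \<bar>y\<bar> + 1" using elim by linarith
      hence "\<bar>y - S x\<bar>\<^sup>2 \<le> (\<bar>y\<bar> + 1)\<^sup>2" by (intro power_mono) auto
      hence "- (\<bar>y\<bar> + 1)\<^sup>2 / (2 * \<sigma>\<^sup>2) \<le> - (y - S x)\<^sup>2 / (2 * \<sigma>\<^sup>2)"
        by (intro divide_right_mono) auto
      thus ?case unfolding normal_density_def by (intro mult_left_mono) auto
    qed
  qed auto
  thus ?thesis by (simp add: prob_space)
qed

lemma out_density_pos: "0 < out_density y"
  by (rule less_le_trans[OF _ out_density_ge]) (use \<sigma>_pos in simp)

lemma joint_density:
  "distr (M \<Otimes>\<^sub>M noise \<sigma>) (M \<Otimes>\<^sub>M lborel) (\<lambda>p. (fst p, S (fst p) + snd p)) =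
     density (M \<Otimes>\<^sub>M lborel) (\<lambda>p. ennreal (normal_density 0 \<sigma> (snd p - S (fst p))))"
proof (rule measure_eqI)
  fix A assume "A \<in> sets (distr (M \<Otimes>\<^sub>M noise \<sigma>) (M \<Otimes>\<^sub>M lborel) (\<lambda>p. (fst p, S (fst p) + snd p)))"
  hence A [measurable]: "A \<in> sets (M \<Otimes>\<^sub>M borel)" by simp
  have meas [measurable]: "(\<lambda>p. (fst p, S (fst p) + snd p)) \<in> M \<Otimes>\<^sub>M noise \<sigma> \<rightarrow>\<^sub>M M \<Otimes>\<^sub>M lborel"
    by measurable
  have "emeasure (distr (M \<Otimes>\<^sub>M noise \<sigma>) (M \<Otimes>\<^sub>M lborel) (\<lambda>p. (fst p, S (fst p) + snd p))) A =
      (\<integral>\<^sup>+p. indicator A p \<partial>distr (M \<Otimes>\<^sub>M noise \<sigma>) (M \<Otimes>\<^sub>M lborel) (\<lambda>p. (fst p, S (fst p) + snd p)))"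
    by simp
  also have "\<dots> = (\<integral>\<^sup>+p. indicator A (fst p, S (fst p) + snd p) \<partial>(M \<Otimes>\<^sub>M noise \<sigma>))"
    by (subst nn_integral_distr[OF meas]) (auto simp: case_prod_beta)
  also have "\<dots> = (\<integral>\<^sup>+x. \<integral>\<^sup>+z. indicator A (x, S x + z) \<partial>noise \<sigma> \<partial>M)"
    by (subst noise.nn_integral_fst[symmetric]) auto
  also have "\<dots> = (\<integral>\<^sup>+x. \<integral>\<^sup>+y. ennreal (normal_density 0 \<sigma> (y - S x)) * indicator A (x, y) \<partial>lborel \<partial>M)"
  proof (intro nn_integral_cong)
    fix x assume [simp]: "x \<in> space M"
    show "(\<integral>\<^sup>+z. indicator A (x, S x + z) \<partial>noise \<sigma>) =
        (\<integral>\<^sup>+y. ennreal (normal_density 0 \<sigma> (y - S x)) * indicator A (x, y) \<partial>lborel)"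
      by (rule nn_integral_noise_shift[where g = "\<lambda>y. indicator A (x, y)"]) measurable
  qed
  also have "\<dots> = (\<integral>\<^sup>+p. ennreal (normal_density 0 \<sigma> (snd p - S (fst p))) * indicator A p \<partial>(M \<Otimes>\<^sub>M lborel))"
    by (subst lborel.nn_integral_fst[symmetric]) auto
  also have "\<dots> = emeasure (density (M \<Otimes>\<^sub>M lborel) (\<lambda>p. ennreal (normal_density 0 \<sigma> (snd p - S (fst p))))) A"
    by (subst emeasure_density) auto
  finally show "emeasure (distr (M \<Otimes>\<^sub>M noise \<sigma>) (M \<Otimes>\<^sub>M lborel) (\<lambda>p. (fst p, S (fst p) + snd p))) A = \<dots>" .
qed simp

text \<open>Stated for nonnegative integrals, because it is applied to the ratio
  \<open>q / out_density\<close> before that ratio is known to be integrable.\<close>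

lemma nn_integral_output:
  assumes [measurable]: "g \<in> borel_measurable borel"
  shows "(\<integral>\<^sup>+p. g (S (fst p) + snd p) \<partial>(M \<Otimes>\<^sub>M noise \<sigma>)) = (\<integral>\<^sup>+y. ennreal (out_density y) * g y \<partial>lborel)"
proof -
  have "(\<integral>\<^sup>+p. g (S (fst p) + snd p) \<partial>(M \<Otimes>\<^sub>M noise \<sigma>)) = (\<integral>\<^sup>+x. \<integral>\<^sup>+z. g (S x + z) \<partial>noise \<sigma> \<partial>M)"
    by (subst noise.nn_integral_fst[symmetric]) auto
  also have "\<dots> = (\<integral>\<^sup>+x. \<integral>\<^sup>+y. ennreal (normal_density 0 \<sigma> (y - S x)) * g y \<partial>lborel \<partial>M)"
    by (intro nn_integral_cong nn_integral_noise_shift) auto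
  also have "\<dots> = (\<integral>\<^sup>+y. \<integral>\<^sup>+x. ennreal (normal_density 0 \<sigma> (y - S x)) * g y \<partial>M \<partial>lborel)"
    by (rule lb.Fubini'[symmetric]) measurable
  also have "\<dots> = (\<integral>\<^sup>+y. ennreal (out_density y) * g y \<partial>lborel)"
    by (simp add: ennreal_out_density nn_integral_multc)
  finally show ?thesis .
qed

lemma output_density:
  "distr (M \<Otimes>\<^sub>M noise \<sigma>) lborel (\<lambda>p. S (fst p) + snd p) = density lborel (\<lambda>y. ennreal (out_density y))"
proof (rule measure_eqI)
  fix A assume "A \<in> sets (distr (M \<Otimes>\<^sub>M noise \<sigma>) lborel (\<lambda>p. S (fst p) + snd p))"
  hence A [measurable]: "A \<in> sets borel" by simp
  have meas [measurable]: "(\<lambda>p. S (fst p) + snd p) \<in> M \<Otimes>\<^sub>M noise \<sigma> \<rightarrow>\<^sub>M lborel"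
    by measurable
  have "emeasure (distr (M \<Otimes>\<^sub>M noise \<sigma>) lborel (\<lambda>p. S (fst p) + snd p)) A =
      (\<integral>\<^sup>+p. indicator A p \<partial>distr (M \<Otimes>\<^sub>M noise \<sigma>) lborel (\<lambda>p. S (fst p) + snd p))"
    by simp
  also have "\<dots> = (\<integral>\<^sup>+p. indicator A (S (fst p) + snd p) \<partial>(M \<Otimes>\<^sub>M noise \<sigma>))"
    by (subst nn_integral_distr[OF meas]) (auto simp: case_prod_beta)
  also have "\<dots> = (\<integral>\<^sup>+y. ennreal (out_density y) * indicator A y \<partial>lborel)"
    by (rule nn_integral_output) measurable
  also have "\<dots> = emeasure (density lborel (\<lambda>y. ennreal (out_density y))) A"
    by (subst emeasure_density) auto
  finally show "emeasure (distr (M \<Otimes>\<^sub>M noise \<sigma>) lborel (\<lambda>p. S (fst p) + snd p)) A = \<dots>" .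
qed simp

lemma nn_integral_out_density: "(\<integral>\<^sup>+y. ennreal (out_density y) \<partial>lborel) = 1"
  using nn_integral_output[of "\<lambda>_. 1"] joint.emeasure_space_1 by simp

lemma joint_fst:
  fixes g :: "'a \<Rightarrow> real"
  shows "integrable M g \<Longrightarrow> integrable (M \<Otimes>\<^sub>M noise \<sigma>) (\<lambda>p. g (fst p))"
    and "g \<in> borel_measurable M \<Longrightarrow> (\<integral>p. g (fst p) \<partial>(M \<Otimes>\<^sub>M noise \<sigma>)) = (\<integral>x. g x \<partial>M)"
proof -
  have d: "distr (M \<Otimes>\<^sub>M noise \<sigma>) M fst = M" by (rule noise.distr_pair_fst)
  show "integrable M g \<Longrightarrow> integrable (M \<Otimes>\<^sub>M noise \<sigma>) (\<lambda>p. g (fst p))"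
    using integrable_distr[of fst "M \<Otimes>\<^sub>M noise \<sigma>" M g] by (simp add: d case_prod_beta)
  show "g \<in> borel_measurable M \<Longrightarrow> (\<integral>p. g (fst p) \<partial>(M \<Otimes>\<^sub>M noise \<sigma>)) = (\<integral>x. g x \<partial>M)"
    using integral_distr[of fst "M \<Otimes>\<^sub>M noise \<sigma>" M g] by (simp add: d case_prod_beta)
qed

lemma joint_snd:
  fixes g :: "real \<Rightarrow> real"
  shows "integrable (noise \<sigma>) g \<Longrightarrow> integrable (M \<Otimes>\<^sub>M noise \<sigma>) (\<lambda>p. g (snd p))"
    and "g \<in> borel_measurable borel \<Longrightarrow> (\<integral>p. g (snd p) \<partial>(M \<Otimes>\<^sub>M noise \<sigma>)) = (\<integral>z. g z \<partial>noise \<sigma>)"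
proof -
  have d: "distr (M \<Otimes>\<^sub>M noise \<sigma>) (noise \<sigma>) snd = noise \<sigma>"
    by (intro distr_pair_snd) unfold_locales
  show "integrable (noise \<sigma>) g \<Longrightarrow> integrable (M \<Otimes>\<^sub>M noise \<sigma>) (\<lambda>p. g (snd p))"
    using integrable_distr[of snd "M \<Otimes>\<^sub>M noise \<sigma>" "noise \<sigma>" g] by (simp add: d case_prod_beta)
  show "g \<in> borel_measurable borel \<Longrightarrow> (\<integral>p. g (snd p) \<partial>(M \<Otimes>\<^sub>M noise \<sigma>)) = (\<integral>z. g z \<partial>noise \<sigma>)"
    using integral_distr[of snd "M \<Otimes>\<^sub>M noise \<sigma>" "noise \<sigma>" g] by (simp add: d case_prod_beta)
qed

lemma noise_second_moment:
  shows "integrable (noise \<sigma>) (\<lambda>z. z\<^sup>2)" and "(\<integral>z. z\<^sup>2 \<partial>noise \<sigma>) = \<sigma>\<^sup>2"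
proof -
  show "integrable (noise \<sigma>) (\<lambda>z. z\<^sup>2)"
    using integrable_normal_moment[OF \<sigma>_pos, of 0 2] by (subst integrable_density) auto
  show "(\<integral>z. z\<^sup>2 \<partial>noise \<sigma>) = \<sigma>\<^sup>2"
    using integral_normal_moment_even[OF \<sigma>_pos, of 0 1] by (subst integral_density) (auto simp: fact_numeral)
qed

lemma ln_out_density_integrable: "integrable (M \<Otimes>\<^sub>M noise \<sigma>) (\<lambda>p. ln (out_density (S (fst p) + snd p)))"
proof (rule Bochner_Integration.integrable_bound)
  define C where "C = \<bar>ln (1 / sqrt (2 * pi * \<sigma>\<^sup>2))\<bar>"
  \<comment> \<open>From \<open>\<bar>y\<bar> + 1 \<le> 2 + \<bar>z\<bar>\<close> and
    \<open>(2 + x)^2 \<le> 8 + 2 * x^2\<close>.\<close>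
  show "integrable (M \<Otimes>\<^sub>M noise \<sigma>) (\<lambda>p. C + (8 + 2 * (snd p)\<^sup>2) / (2 * \<sigma>\<^sup>2))"
    using noise_second_moment(1) by (intro joint_snd) auto
  have b: "\<bar>ln (out_density y)\<bar> \<le> C + (\<bar>y\<bar> + 1)\<^sup>2 / (2 * \<sigma>\<^sup>2)" for y
  proof -
    have p: "1 / sqrt (2 * pi * \<sigma>\<^sup>2) > 0" using \<sigma>_pos by simp
    have "ln (out_density y) \<le> C"
      using out_density_le[of y] out_density_pos[of y] p
      by (smt (verit) C_def ln_le_cancel_iff)
    moreover have "ln (1 / sqrt (2 * pi * \<sigma>\<^sup>2) * exp (- (\<bar>y\<bar> + 1)\<^sup>2 / (2 * \<sigma>\<^sup>2))) \<le> ln (out_density y)"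
      using out_density_ge[of y] out_density_pos[of y] p by (subst ln_le_cancel_iff) auto
    moreover have "ln (1 / sqrt (2 * pi * \<sigma>\<^sup>2) * exp (- (\<bar>y\<bar> + 1)\<^sup>2 / (2 * \<sigma>\<^sup>2))) =
        ln (1 / sqrt (2 * pi * \<sigma>\<^sup>2)) - (\<bar>y\<bar> + 1)\<^sup>2 / (2 * \<sigma>\<^sup>2)"
      using p by (subst ln_mult_pos) auto
    moreover have "0 \<le> (\<bar>y\<bar> + 1)\<^sup>2 / (2 * \<sigma>\<^sup>2)" by simp
    ultimately show ?thesis unfolding C_def by linarith
  qed
  have "AE p in M \<Otimes>\<^sub>M noise \<sigma>. 0 \<le> S (fst p) \<and> S (fst p) \<le> 1"
    using AE_distrD[of fst "M \<Otimes>\<^sub>M noise \<sigma>" M "\<lambda>x. 0 \<le> S x \<and> S x \<le> 1"] S_bounds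
    unfolding noise.distr_pair_fst by simp
  thus "AE p in M \<Otimes>\<^sub>M noise \<sigma>. norm (ln (out_density (S (fst p) + snd p)))
      \<le> norm (C + (8 + 2 * (snd p)\<^sup>2) / (2 * \<sigma>\<^sup>2))"
  proof eventually_elim
    case (elim p)
    define y z where "y = S (fst p) + snd p" and "z = snd p"
    have "\<bar>y\<bar> + 1 \<le> 2 + \<bar>z\<bar>" using elim unfolding y_def z_def by linarith
    hence "(\<bar>y\<bar> + 1)\<^sup>2 \<le> (2 + \<bar>z\<bar>)\<^sup>2" by (intro power_mono) auto
    also have "\<dots> \<le> 8 + 2 * z\<^sup>2"
      using zero_le_power2[of "2 - \<bar>z\<bar>"] by (simp add: power2_eq_square algebra_simps)
    finally have "(\<bar>y\<bar> + 1)\<^sup>2 / (2 * \<sigma>\<^sup>2) \<le> (8 + 2 * z\<^sup>2) / (2 * \<sigma>\<^sup>2)"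
      by (intro divide_right_mono) auto
    thus ?case using b[of y] by (auto simp: case_prod_beta y_def z_def)
  qed
qed measurable

text \<open>Gibbs inequality from \<open>ln r \<le> r - 1\<close> for
  \<open>r = q / out_density\<close>, whose mean under the output law is the mass of
  \<open>q\<close>. Leaving \<open>q\<close> unnormalized lets the mass enter as
  \<open>B - 1\<close>, the form in which it occurs in the dual function.\<close>

lemma output_entropy_le:
  assumes q [measurable]: "q \<in> borel_measurable borel" and q_pos: "\<And>y. 0 < q y"
    and q_le: "(\<integral>\<^sup>+y. ennreal (q y) \<partial>lborel) \<le> ennreal B" and "0 \<le> B"
    and int: "integrable (M \<Otimes>\<^sub>M noise \<sigma>) (\<lambda>p. ln (q (S (fst p) + snd p)))"
  shows "- (\<integral>p. ln (out_density (S (fst p) + snd p)) \<partial>(M \<Otimes>\<^sub>M noise \<sigma>))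
      \<le> - (\<integral>p. ln (q (S (fst p) + snd p)) \<partial>(M \<Otimes>\<^sub>M noise \<sigma>)) + B - 1"
proof -
  have nn: "(\<integral>\<^sup>+p. ennreal (q (S (fst p) + snd p) / out_density (S (fst p) + snd p)) \<partial>(M \<Otimes>\<^sub>M noise \<sigma>)) \<le> ennreal B"
  proof -
    have "(\<integral>\<^sup>+p. ennreal (q (S (fst p) + snd p) / out_density (S (fst p) + snd p)) \<partial>(M \<Otimes>\<^sub>M noise \<sigma>)) =
        (\<integral>\<^sup>+y. ennreal (out_density y) * ennreal (q y / out_density y) \<partial>lborel)"
      by (rule nn_integral_output) measurable
    also have "\<dots> = (\<integral>\<^sup>+y. ennreal (q y) \<partial>lborel)"
      using out_density_pos q_pos
      by (intro nn_integral_cong) (simp add: ennreal_mult[symmetric] less_imp_le less_imp_neq[symmetric])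
    finally show ?thesis using q_le by simp
  qed
  have I: "integrable (M \<Otimes>\<^sub>M noise \<sigma>) (\<lambda>p. q (S (fst p) + snd p) / out_density (S (fst p) + snd p))"
    using nn q_pos out_density_pos
    by (intro integrableI_bounded) (auto simp: case_prod_beta abs_of_pos intro: le_less_trans)
  have "(\<integral>p. q (S (fst p) + snd p) / out_density (S (fst p) + snd p) \<partial>(M \<Otimes>\<^sub>M noise \<sigma>)) \<le> B"
  proof -
    have "ennreal (\<integral>p. (q (S (fst p) + snd p) / out_density (S (fst p) + snd p)) \<partial>(M \<Otimes>\<^sub>M noise \<sigma>)) \<le> ennreal B"
      using nn q_pos out_density_pos
      by (subst nn_integral_eq_integral[OF I, symmetric]) (auto simp: case_prod_beta less_imp_le)
    thus ?thesis using \<open>0 \<le> B\<close> by simp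
  qed
  moreover have "(\<integral>p. ln (q (S (fst p) + snd p)) - ln (out_density (S (fst p) + snd p)) \<partial>(M \<Otimes>\<^sub>M noise \<sigma>))
      \<le> (\<integral>p. q (S (fst p) + snd p) / out_density (S (fst p) + snd p) - 1 \<partial>(M \<Otimes>\<^sub>M noise \<sigma>))"
  proof (intro integral_mono)
    show "integrable (M \<Otimes>\<^sub>M noise \<sigma>) (\<lambda>p. ln (q (S (fst p) + snd p)) - ln (out_density (S (fst p) + snd p)))"
      using Bochner_Integration.integrable_diff[OF int ln_out_density_integrable] by (simp add: case_prod_beta)
    show "integrable (M \<Otimes>\<^sub>M noise \<sigma>) (\<lambda>p. q (S (fst p) + snd p) / out_density (S (fst p) + snd p) - 1)"
      using Bochner_Integration.integrable_diff[OF I, of "\<lambda>_. 1"] by (simp add: case_prod_beta)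
    fix p
    have "ln (q (S (fst p) + snd p)) - ln (out_density (S (fst p) + snd p)) =
        ln (q (S (fst p) + snd p) / out_density (S (fst p) + snd p))"
      using q_pos out_density_pos by (simp add: ln_divide_pos)
    also have "\<dots> \<le> q (S (fst p) + snd p) / out_density (S (fst p) + snd p) - 1"
      using q_pos out_density_pos by (intro ln_le_minus_one) simp
    finally show "(ln (q (S (fst p) + snd p)) - ln (out_density (S (fst p) + snd p)))
        \<le> (q (S (fst p) + snd p) / out_density (S (fst p) + snd p) - 1)"
      by (simp add: case_prod_beta)
  qed
  ultimately show ?thesis
    using Bochner_Integration.integral_diff[OF int ln_out_density_integrable]
      Bochner_Integration.integral_diff[OF I, of "\<lambda>_. 1"]
    by (simp add: case_prod_beta joint.prob_space)
qed

text \<open>Noise cannot lower the entropy: with the density \<open>f = exp w\<close> of \<open>S\<close> this is \<open>ln r \<le> r - 1\<close>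
  for \<open>r = out_density (S + Z) / f S\<close>, whose mean is at most 1.\<close>

lemma output_entropy_ge:
  fixes w :: "real \<Rightarrow> real"
  assumes w [measurable]: "w \<in> borel_measurable borel"
    and law: "distr M borel S = density lborel (\<lambda>s. ennreal (indicator {b..d} s * exp (w s)))"
    and int: "integrable M (\<lambda>x. w (S x))"
  shows "- (\<integral>x. w (S x) \<partial>M) \<le> - (\<integral>p. ln (out_density (S (fst p) + snd p)) \<partial>(M \<Otimes>\<^sub>M noise \<sigma>))"
proof -
  \<comment> \<open>At fixed noise \<open>z\<close> the density of \<open>S\<close> cancels against
    \<open>exp (- w)\<close>, leaving a translate of \<open>out_density\<close> integrated over
    \<open>{b..d}\<close>.\<close>
  have inner: "(\<integral>\<^sup>+x. ennreal (out_density (S x + z) * exp (- w (S x))) \<partial>M) \<le> 1" for z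
  proof -
    have "(\<integral>\<^sup>+x. ennreal (out_density (S x + z) * exp (- w (S x))) \<partial>M) =
        (\<integral>\<^sup>+s. ennreal (out_density (s + z) * exp (- w s)) \<partial>distr M borel S)"
      by (subst nn_integral_distr) auto
    also have "\<dots> = (\<integral>\<^sup>+s. ennreal (indicator {b..d} s * exp (w s)) * ennreal (out_density (s + z) * exp (- w s)) \<partial>lborel)"
      unfolding law by (subst nn_integral_density) auto
    also have "\<dots> \<le> (\<integral>\<^sup>+s. ennreal (out_density (z + 1 * s)) \<partial>lborel)"
    proof (intro nn_integral_mono)
      fix s
      show "ennreal (indicator {b..d} s * exp (w s)) * ennreal (out_density (s + z) * exp (- w s))
          \<le> ennreal (out_density (z + 1 * s))"
        using out_density_pos[of "s + z"]
        by (simp add: ennreal_mult[symmetric] exp_minus indicator_def add.commute)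
    qed
    also have "\<dots> = 1"
      using nn_integral_real_affine[of "\<lambda>y. ennreal (out_density y)" 1 z] nn_integral_out_density by simp
    finally show ?thesis .
  qed
  have nn: "(\<integral>\<^sup>+p. ennreal (out_density (S (fst p) + snd p) * exp (- w (S (fst p)))) \<partial>(M \<Otimes>\<^sub>M noise \<sigma>)) \<le> 1"
  proof -
    have "(\<integral>\<^sup>+p. ennreal (out_density (S (fst p) + snd p) * exp (- w (S (fst p)))) \<partial>(M \<Otimes>\<^sub>M noise \<sigma>)) =
        (\<integral>\<^sup>+z. \<integral>\<^sup>+x. ennreal (out_density (S x + z) * exp (- w (S x))) \<partial>M \<partial>noise \<sigma>)"
      by (subst joint.nn_integral_snd[symmetric]) auto
    also have "\<dots> \<le> (\<integral>\<^sup>+z. 1 \<partial>noise \<sigma>)"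
      by (intro nn_integral_mono inner)
    finally show ?thesis using noise.emeasure_space_1 by simp
  qed
  have I: "integrable (M \<Otimes>\<^sub>M noise \<sigma>) (\<lambda>p. out_density (S (fst p) + snd p) * exp (- w (S (fst p))))"
    using nn out_density_pos
    by (intro integrableI_bounded) (auto simp: case_prod_beta abs_of_pos intro: le_less_trans)
  have "(\<integral>p. out_density (S (fst p) + snd p) * exp (- w (S (fst p))) \<partial>(M \<Otimes>\<^sub>M noise \<sigma>)) \<le> 1"
  proof -
    have "ennreal (\<integral>p. (out_density (S (fst p) + snd p) * exp (- w (S (fst p)))) \<partial>(M \<Otimes>\<^sub>M noise \<sigma>)) \<le> ennreal 1"
      using nn out_density_pos
      by (subst nn_integral_eq_integral[OF I, symmetric]) (auto simp: case_prod_beta less_imp_le)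
    thus ?thesis by simp
  qed
  moreover have wint: "integrable (M \<Otimes>\<^sub>M noise \<sigma>) (\<lambda>p. w (S (fst p)))"
    using int by (rule joint_fst)
  moreover have "(\<integral>p. ln (out_density (S (fst p) + snd p)) - w (S (fst p)) \<partial>(M \<Otimes>\<^sub>M noise \<sigma>))
      \<le> (\<integral>p. out_density (S (fst p) + snd p) * exp (- w (S (fst p))) - 1 \<partial>(M \<Otimes>\<^sub>M noise \<sigma>))"
  proof (intro integral_mono)
    show "integrable (M \<Otimes>\<^sub>M noise \<sigma>) (\<lambda>p. ln (out_density (S (fst p) + snd p)) - w (S (fst p)))"
      using Bochner_Integration.integrable_diff[OF ln_out_density_integrable wint] by (simp add: case_prod_beta)
    show "integrable (M \<Otimes>\<^sub>M noise \<sigma>) (\<lambda>p. out_density (S (fst p) + snd p) * exp (- w (S (fst p))) - 1)"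
      using Bochner_Integration.integrable_diff[OF I, of "\<lambda>_. 1"] by (simp add: case_prod_beta)
    fix p
    have "ln (out_density (S (fst p) + snd p)) - w (S (fst p)) =
        ln (out_density (S (fst p) + snd p) * exp (- w (S (fst p))))"
      using out_density_pos by (simp add: ln_mult_pos)
    also have "\<dots> \<le> out_density (S (fst p) + snd p) * exp (- w (S (fst p))) - 1"
      using out_density_pos by (intro ln_le_minus_one) simp
    finally show "(ln (out_density (S (fst p) + snd p)) - w (S (fst p)))
        \<le> (out_density (S (fst p) + snd p) * exp (- w (S (fst p))) - 1)"
      by (simp add: case_prod_beta)
  qed
  moreover have "(\<integral>p. w (S (fst p)) \<partial>(M \<Otimes>\<^sub>M noise \<sigma>)) = (\<integral>x. w (S x) \<partial>M)"
    by (rule joint_fst) measurable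
  ultimately show ?thesis
    using Bochner_Integration.integral_diff[OF ln_out_density_integrable wint]
      Bochner_Integration.integral_diff[OF I, of "\<lambda>_. 1"]
    by (simp add: case_prod_beta joint.prob_space)
qed

text \<open>Information is output entropy minus noise entropy: given the input, the output has the
  normal density centred at \<open>S\<close>, and the mean of its logarithm is computed from the
  second moment of the noise.\<close>

lemma mutual_information_eq:
  "joint.mutual_information (exp 1) M lborel fst (\<lambda>p. S (fst p) + snd p) =
     - (1 / 2) * ln (2 * pi * exp 1) + ln (1 / \<sigma>)
     - (\<integral>p. ln (out_density (S (fst p) + snd p)) \<partial>(M \<Otimes>\<^sub>M noise \<sigma>))"
proof -
  interpret I: information_space "M \<Otimes>\<^sub>M noise \<sigma>" "exp 1"
    by unfold_locales simp
  let ?n = "\<lambda>p. normal_density 0 \<sigma> (snd p - S (fst p))"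
  let ?g = "\<lambda>p. log (exp 1) (?n p / (1 * out_density (snd p)))"
  \<comment> \<open>The input law need not have a Lebesgue density. Taking \<open>M\<close> itself
    as reference measure gives the input the density 1.\<close>
  have dX: "distributed (M \<Otimes>\<^sub>M noise \<sigma>) M fst (\<lambda>x. ennreal 1)"
    unfolding distributed_def by (simp add: noise.distr_pair_fst density_1)
  have dY: "distributed (M \<Otimes>\<^sub>M noise \<sigma>) lborel (\<lambda>p. S (fst p) + snd p) (\<lambda>y. ennreal (out_density y))"
    unfolding distributed_def by (simp add: output_density)
  have dXY: "distributed (M \<Otimes>\<^sub>M noise \<sigma>) (M \<Otimes>\<^sub>M lborel) (\<lambda>p. (fst p, S (fst p) + snd p)) (\<lambda>p. ennreal (?n p))"
    unfolding distributed_def by (simp add: joint_density)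
  have "joint.mutual_information (exp 1) M lborel fst (\<lambda>p. S (fst p) + snd p) =
      (\<integral>p. ?n p * ?g p \<partial>(M \<Otimes>\<^sub>M lborel))"
    by (rule I.mutual_information_distr[OF _ _ dX _ dY _ dXY])
      (auto simp: out_density_pos less_imp_le intro: sigma_finite_measure_axioms lborel.sigma_finite_measure_axioms)
  also have "\<dots> = (\<integral>p. ?g (fst p, S (fst p) + snd p) \<partial>(M \<Otimes>\<^sub>M noise \<sigma>))"
    by (rule distributed_integral[OF dXY]) auto
  also have "\<dots> = (\<integral>p. ((- (1 / 2) * ln (2 * pi * \<sigma>\<^sup>2) - (snd p)\<^sup>2 / (2 * \<sigma>\<^sup>2)))
      - (ln (out_density (S (fst p) + snd p))) \<partial>(M \<Otimes>\<^sub>M noise \<sigma>))"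
  proof (intro Bochner_Integration.integral_cong refl)
    fix p :: "'a \<times> real"
    have "ln (normal_density 0 \<sigma> z) = - (1 / 2) * ln (2 * pi * \<sigma>\<^sup>2) - z\<^sup>2 / (2 * \<sigma>\<^sup>2)" for z
      unfolding normal_density_def using \<sigma>_pos by (subst ln_mult_pos) (auto simp: ln_div ln_sqrt)
    thus "?g (fst p, S (fst p) + snd p) =
        ((- (1 / 2) * ln (2 * pi * \<sigma>\<^sup>2) - (snd p)\<^sup>2 / (2 * \<sigma>\<^sup>2))) - (ln (out_density (S (fst p) + snd p)))"
      using out_density_pos[of "S (fst p) + snd p"] normal_density_pos[OF \<sigma>_pos, of 0 "snd p"]
      by (simp add: case_prod_beta log_def ln_div)
  qed
  also have "\<dots> = (\<integral>p. (- (1 / 2) * ln (2 * pi * \<sigma>\<^sup>2) - (snd p)\<^sup>2 / (2 * \<sigma>\<^sup>2)) \<partial>(M \<Otimes>\<^sub>M noise \<sigma>))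
      - (\<integral>p. ln (out_density (S (fst p) + snd p)) \<partial>(M \<Otimes>\<^sub>M noise \<sigma>))"
    using noise_second_moment(1)
    by (intro Bochner_Integration.integral_diff ln_out_density_integrable joint_snd) auto
  also have "(\<integral>p. (- (1 / 2) * ln (2 * pi * \<sigma>\<^sup>2) - (snd p)\<^sup>2 / (2 * \<sigma>\<^sup>2)) \<partial>(M \<Otimes>\<^sub>M noise \<sigma>)) =
      (\<integral>z. (- (1 / 2) * ln (2 * pi * \<sigma>\<^sup>2) - z\<^sup>2 / (2 * \<sigma>\<^sup>2)) \<partial>noise \<sigma>)"
    by (rule joint_snd) measurable
  also have "\<dots> = - (1 / 2) * ln (2 * pi * \<sigma>\<^sup>2) - 1 / 2"
    using noise_second_moment \<sigma>_pos noise.prob_space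
    by (subst Bochner_Integration.integral_diff) auto
  also have "\<dots> = - (1 / 2) * ln (2 * pi * exp 1) + ln (1 / \<sigma>)"
  proof -
    have "ln (2 * pi * \<sigma>\<^sup>2) = ln (2 * pi) + 2 * ln \<sigma>" "ln (2 * pi * exp 1) = ln (2 * pi) + 1"
      using \<sigma>_pos by (simp_all add: ln_mult_pos ln_realpow)
    thus ?thesis using \<sigma>_pos by (simp add: ln_div field_simps)
  qed
  finally show ?thesis .
qed

lemma integral_abs_noise_le: "(\<integral>p. \<bar>snd p\<bar> \<partial>(M \<Otimes>\<^sub>M noise \<sigma>)) \<le> \<sigma>"
  and integrable_abs_noise: "integrable (M \<Otimes>\<^sub>M noise \<sigma>) (\<lambda>p. \<bar>snd p\<bar>)"
  and integral_square_noise: "(\<integral>p. (snd p)\<^sup>2 \<partial>(M \<Otimes>\<^sub>M noise \<sigma>)) = \<sigma>\<^sup>2"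
  and integrable_square_noise: "integrable (M \<Otimes>\<^sub>M noise \<sigma>) (\<lambda>p. (snd p)\<^sup>2)"
proof -
  show sq: "integrable (M \<Otimes>\<^sub>M noise \<sigma>) (\<lambda>p. (snd p)\<^sup>2)"
    using noise_second_moment(1) by (rule joint_snd)
  show sq_eq: "(\<integral>p. (snd p)\<^sup>2 \<partial>(M \<Otimes>\<^sub>M noise \<sigma>)) = \<sigma>\<^sup>2"
    using joint_snd(2)[of "\<lambda>z. z\<^sup>2"] noise_second_moment(2) by simp
  \<comment> \<open>The inequality of arithmetic and geometric means reduces the first absolute
    moment to the second moment.\<close>
  have le: "\<bar>z\<bar> \<le> (z\<^sup>2 / \<sigma> + \<sigma>) / 2" for z
  proof -
    have "0 \<le> (\<bar>z\<bar> - \<sigma>)\<^sup>2" by simp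
    hence "\<bar>z\<bar> * (2 * \<sigma>) \<le> z\<^sup>2 + \<sigma> * \<sigma>" by (simp add: power2_eq_square algebra_simps)
    thus ?thesis using \<sigma>_pos by (simp add: field_simps)
  qed
  have I: "integrable (M \<Otimes>\<^sub>M noise \<sigma>) (\<lambda>p. ((snd p)\<^sup>2 / \<sigma> + \<sigma>) / 2)"
    using sq by simp
  show abs: "integrable (M \<Otimes>\<^sub>M noise \<sigma>) (\<lambda>p. \<bar>snd p\<bar>)"
    by (rule Bochner_Integration.integrable_bound[OF I]) 
      (measurable, intro AE_I2, simp only: real_norm_def abs_idempotent, rule order_trans[OF le abs_ge_self])
  have "(\<integral>p. \<bar>snd p\<bar> \<partial>(M \<Otimes>\<^sub>M noise \<sigma>)) \<le> (\<integral>p. ((snd p)\<^sup>2 / \<sigma> + \<sigma>) / 2 \<partial>(M \<Otimes>\<^sub>M noise \<sigma>))"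
    using le by (intro integral_mono abs I)
  also have "\<dots> = \<sigma>"
    using sq sq_eq joint.prob_space \<sigma>_pos by (simp add: power2_eq_square)
  finally show "(\<integral>p. \<bar>snd p\<bar> \<partial>(M \<Otimes>\<^sub>M noise \<sigma>)) \<le> \<sigma>" .
qed

text \<open>
  The Gibbs inequality is applied to the exponential density on the unit interval with Gaussian tails
  of width \<open>sqrt \<sigma>\<close>: wide enough for the noise to cost only \<open>O(\<sigma>)\<close>, narrow enough to add
  only \<open>O(sqrt \<sigma>)\<close> to the mass.
\<close>

lemma nn_integral_tailed_exp_le:
  fixes w :: "real \<Rightarrow> real"
  assumes w: "continuous_on {0..1} w"
  shows "(\<integral>\<^sup>+y. ennreal (exp (w (clamp01 y) - (y - clamp01 y)\<^sup>2 / (2 * \<sigma>))) \<partial>lborel)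
    \<le> ennreal (integral {0..1} (\<lambda>s. exp (w s)) + sqrt (2 * pi) * (exp (w 0) + exp (w 1)) * sqrt \<sigma>)"
proof -
  define C where "C = sqrt (2 * pi) * sqrt \<sigma>"
  have C: "C > 0" using \<sigma>_pos by (simp add: C_def)
  have gauss: "exp (- (y - m)\<^sup>2 / (2 * \<sigma>)) = C * normal_density m (sqrt \<sigma>) y" for m y
    using \<sigma>_pos by (simp add: normal_density_def C_def real_sqrt_mult)
  have exp_int: "set_integrable lborel {0..1} (\<lambda>s. exp (w s))"
    by (intro borel_integrable_atLeastAtMost' continuous_intros w)
  have "(\<integral>\<^sup>+y. ennreal (exp (w (clamp01 y) - (y - clamp01 y)\<^sup>2 / (2 * \<sigma>))) \<partial>lborel) \<le>
      (\<integral>\<^sup>+y. ennreal (indicator {0..1} y *\<^sub>R exp (w y)) +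
        (ennreal (exp (w 0) * C) * ennreal (normal_density 0 (sqrt \<sigma>) y) +
         ennreal (exp (w 1) * C) * ennreal (normal_density 1 (sqrt \<sigma>) y)) \<partial>lborel)"
  proof (intro nn_integral_mono)
    fix y :: real
    have "exp (w (clamp01 y) - (y - clamp01 y)\<^sup>2 / (2 * \<sigma>)) \<le> indicator {0..1} y *\<^sub>R exp (w y) +
        (exp (w 0) * C * normal_density 0 (sqrt \<sigma>) y + exp (w 1) * C * normal_density 1 (sqrt \<sigma>) y)"
    proof -
      have nn: "0 \<le> exp (w 0) * C * normal_density 0 (sqrt \<sigma>) y" "0 \<le> exp (w 1) * C * normal_density 1 (sqrt \<sigma>) y"
        using C by simp_all
      consider "0 \<le> y" "y \<le> 1" | "y < 0" | "1 < y" by linarith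
      thus ?thesis
      proof cases
        case 1
        thus ?thesis using nn by (simp add: clamp01_def)
      next
        case 2
        hence "exp (w (clamp01 y) - (y - clamp01 y)\<^sup>2 / (2 * \<sigma>)) = exp (w 0) * exp (- (y - 0)\<^sup>2 / (2 * \<sigma>))"
          by (simp add: clamp01_def flip: exp_add)
        also have "\<dots> = exp (w 0) * C * normal_density 0 (sqrt \<sigma>) y" unfolding gauss by simp
        finally show ?thesis using nn 2 by simp
      next
        case 3
        hence "exp (w (clamp01 y) - (y - clamp01 y)\<^sup>2 / (2 * \<sigma>)) = exp (w 1) * exp (- (y - 1)\<^sup>2 / (2 * \<sigma>))"
          by (simp add: clamp01_def flip: exp_add)
        also have "\<dots> = exp (w 1) * C * normal_density 1 (sqrt \<sigma>) y" unfolding gauss by simp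
        finally show ?thesis using nn 3 by simp
      qed
    qed
    hence le: "ennreal (exp (w (clamp01 y) - (y - clamp01 y)\<^sup>2 / (2 * \<sigma>))) \<le> ennreal (indicator {0..1} y *\<^sub>R exp (w y) +
        (exp (w 0) * C * normal_density 0 (sqrt \<sigma>) y + exp (w 1) * C * normal_density 1 (sqrt \<sigma>) y))"
      by (rule ennreal_leI)
    show "ennreal (exp (w (clamp01 y) - (y - clamp01 y)\<^sup>2 / (2 * \<sigma>))) \<le> ennreal (indicator {0..1} y *\<^sub>R exp (w y)) +
        (ennreal (exp (w 0) * C) * ennreal (normal_density 0 (sqrt \<sigma>) y) +
         ennreal (exp (w 1) * C) * ennreal (normal_density 1 (sqrt \<sigma>) y))"
    proof -
      have "ennreal (a + (b + c)) = ennreal a + (ennreal b + ennreal c)" if "0 \<le> a" "0 \<le> b" "0 \<le> c" for a b c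
        using that by simp
      from this[of "indicator {0..1} y *\<^sub>R exp (w y)" "exp (w 0) * C * normal_density 0 (sqrt \<sigma>) y"
          "exp (w 1) * C * normal_density 1 (sqrt \<sigma>) y"]
      show ?thesis using le C by (simp add: ennreal_mult)
    qed
  qed
  also have "\<dots> = (\<integral>\<^sup>+y. ennreal (indicator {0..1} y *\<^sub>R exp (w y)) \<partial>lborel) +
      (ennreal (exp (w 0) * C) * (\<integral>\<^sup>+y. ennreal (normal_density 0 (sqrt \<sigma>) y) \<partial>lborel) +
       ennreal (exp (w 1) * C) * (\<integral>\<^sup>+y. ennreal (normal_density 1 (sqrt \<sigma>) y) \<partial>lborel))"
  proof -
    have [measurable]: "(\<lambda>y. indicator {0..1} y *\<^sub>R exp (w y)) \<in> borel_measurable lborel"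
      using exp_int unfolding set_integrable_def by (rule borel_measurable_integrable)
    show ?thesis
      by (subst nn_integral_add, measurable)+ (simp add: nn_integral_cmult)
  qed
  also have "(\<integral>\<^sup>+y. ennreal (indicator {0..1} y *\<^sub>R exp (w y)) \<partial>lborel) = ennreal (integral {0..1} (\<lambda>s. exp (w s)))"
    using exp_int set_borel_integral_eq_integral(2)[OF exp_int]
    unfolding set_integrable_def set_lebesgue_integral_def
    by (subst nn_integral_eq_integral) auto
  also have "ennreal (integral {0..1} (\<lambda>s. exp (w s))) +
      (ennreal (exp (w 0) * C) * (\<integral>\<^sup>+y. ennreal (normal_density 0 (sqrt \<sigma>) y) \<partial>lborel) +
       ennreal (exp (w 1) * C) * (\<integral>\<^sup>+y. ennreal (normal_density 1 (sqrt \<sigma>) y) \<partial>lborel)) =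
      ennreal (integral {0..1} (\<lambda>s. exp (w s)) + (exp (w 0) * C + exp (w 1) * C))"
  proof -
    have "(\<integral>\<^sup>+y. ennreal (normal_density m (sqrt \<sigma>) y) \<partial>lborel) = 1" for m
      using \<sigma>_pos by (subst nn_integral_eq_integral) auto
    thus ?thesis
      using C by (simp add: integral_nonneg integrable_continuous_interval continuous_intros w)
  qed
  also have "exp (w 0) * C + exp (w 1) * C = sqrt (2 * pi) * (exp (w 0) + exp (w 1)) * sqrt \<sigma>"
    by (simp add: C_def algebra_simps)
  finally show ?thesis .
qed

lemma integrable_hinge: "integrable M (\<lambda>x. hinge b (S x))"
proof (rule integrable_const_bound[where B = "1 + \<bar>b\<bar>"])
  show "AE x in M. norm (hinge b (S x)) \<le> 1 + \<bar>b\<bar>"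
    using S_bounds by eventually_elim (auto simp: hinge_def)
qed measurable

text \<open>The comparison density \<open>exp v\<close> uses the clamped output. Passing from
  \<open>v\<close> at the output back to \<open>w\<close> at \<open>S\<close> costs \<Lambda> times
  the mean of the absolute noise plus \<open>\<sigma> / 2\<close> from the quadratic tail. No term
  of the error depends on the law of \<open>S\<close>.\<close>

lemma output_entropy_upper:
  fixes w :: "real \<Rightarrow> real"
  assumes w: "continuous_on UNIV w" and lip: "\<And>s t. \<bar>w s - w t\<bar> \<le> \<Lambda> * \<bar>s - t\<bar>"
  shows "- (\<integral>p. ln (out_density (S (fst p) + snd p)) \<partial>(M \<Otimes>\<^sub>M noise \<sigma>))
    \<le> - (\<integral>x. w (S x) \<partial>M) + integral {0..1} (\<lambda>s. exp (w s)) - 1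
      + (\<Lambda> * \<sigma> + \<sigma> / 2 + sqrt (2 * pi) * (exp (w 0) + exp (w 1)) * sqrt \<sigma>)"
proof -
  let ?J = "M \<Otimes>\<^sub>M noise \<sigma>"
  let ?Y = "\<lambda>p. S (fst p) + snd p"
  define B where "B = integral {0..1} (\<lambda>s. exp (w s)) + sqrt (2 * pi) * (exp (w 0) + exp (w 1)) * sqrt \<sigma>"
  define v where "v y = w (clamp01 y) - (y - clamp01 y)\<^sup>2 / (2 * \<sigma>)" for y
  have [measurable]: "w \<in> borel_measurable borel" using w by (rule borel_measurable_continuous_onI)
  have [measurable]: "v \<in> borel_measurable borel" unfolding v_def by measurable
  have w01: "continuous_on {0..1} w" using w by (rule continuous_on_subset) simp
  have B: "0 \<le> B"
    unfolding B_def using \<sigma>_pos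
    by (intro add_nonneg_nonneg integral_nonneg integrable_continuous_interval continuous_intros w01) auto
  have \<Lambda>: "0 \<le> \<Lambda>" using lip[of 1 0] by simp
  have Sb: "AE p in ?J. 0 \<le> S (fst p) \<and> S (fst p) \<le> 1"
    using AE_distrD[of fst ?J M "\<lambda>x. 0 \<le> S x \<and> S x \<le> 1"] S_bounds
    unfolding noise.distr_pair_fst by simp
  have near: "\<bar>y - clamp01 y\<bar> \<le> \<bar>z\<bar>" "\<bar>clamp01 y - s\<bar> \<le> \<bar>z\<bar>" if "0 \<le> s" "s \<le> 1" "y = s + z" for s y z
    using that by (auto simp: clamp01_def)
  have bnd: "\<bar>v y\<bar> \<le> (\<bar>w 0\<bar> + \<Lambda>) + z\<^sup>2 / (2 * \<sigma>)" "w s - (\<Lambda> * \<bar>z\<bar> + z\<^sup>2 / (2 * \<sigma>)) \<le> v y"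
    if s: "0 \<le> s" "s \<le> 1" "y = s + z" for s y z
  proof -
    have "(y - clamp01 y)\<^sup>2 \<le> z\<^sup>2" using near(1)[OF s] by (simp add: abs_le_square_iff)
    hence sq: "(y - clamp01 y)\<^sup>2 / (2 * \<sigma>) \<le> z\<^sup>2 / (2 * \<sigma>)" "0 \<le> (y - clamp01 y)\<^sup>2 / (2 * \<sigma>)"
      using \<sigma>_pos by (auto intro: divide_right_mono)
    have "\<bar>w (clamp01 y) - w 0\<bar> \<le> \<Lambda> * \<bar>clamp01 y - 0\<bar>" by (rule lip)
    also have "\<dots> \<le> \<Lambda> * 1" using \<Lambda> by (intro mult_left_mono) (auto simp: clamp01_def)
    finally show "\<bar>v y\<bar> \<le> (\<bar>w 0\<bar> + \<Lambda>) + z\<^sup>2 / (2 * \<sigma>)" using sq unfolding v_def by linarith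
    have "\<bar>w (clamp01 y) - w s\<bar> \<le> \<Lambda> * \<bar>clamp01 y - s\<bar>" by (rule lip)
    also have "\<dots> \<le> \<Lambda> * \<bar>z\<bar>" using \<Lambda> near(2)[OF s] by (intro mult_left_mono)
    finally show "w s - (\<Lambda> * \<bar>z\<bar> + z\<^sup>2 / (2 * \<sigma>)) \<le> v y" using sq unfolding v_def by linarith
  qed
  have vI: "integrable ?J (\<lambda>p. v (?Y p))"
  proof (rule Bochner_Integration.integrable_bound)
    show "integrable ?J (\<lambda>p. (\<bar>w 0\<bar> + \<Lambda>) + (snd p)\<^sup>2 / (2 * \<sigma>))"
      using integrable_square_noise by simp
    show "AE p in ?J. norm (v (?Y p)) \<le> norm ((\<bar>w 0\<bar> + \<Lambda>) + (snd p)\<^sup>2 / (2 * \<sigma>))"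
      using Sb
    proof eventually_elim
      case (elim p)
      thus ?case using bnd(1)[of "S (fst p)" "?Y p" "snd p"] by (auto intro: order_trans[OF _ abs_ge_self])
    qed
  qed measurable
  have wI: "integrable ?J (\<lambda>p. w (S (fst p)))"
  proof (intro joint_fst(1) integrable_const_bound[where B = "\<bar>w 0\<bar> + \<Lambda>"])
    show "AE x in M. norm (w (S x)) \<le> \<bar>w 0\<bar> + \<Lambda>"
      using S_bounds
    proof eventually_elim
      case (elim x)
      have "\<bar>w (S x) - w 0\<bar> \<le> \<Lambda> * \<bar>S x - 0\<bar>" by (rule lip)
      also have "\<dots> \<le> \<Lambda> * 1" using \<Lambda> elim by (intro mult_left_mono) auto
      finally show ?case by simp
    qed
  qed measurable
  have "- (\<integral>p. ln (out_density (?Y p)) \<partial>?J) \<le> - (\<integral>p. ln (exp (v (?Y p))) \<partial>?J) + B - 1"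
  proof (rule output_entropy_le)
    show "(\<integral>\<^sup>+y. ennreal (exp (v y)) \<partial>lborel) \<le> ennreal B"
      unfolding v_def B_def by (rule nn_integral_tailed_exp_le[OF w01])
  qed (use B vI in auto)
  moreover have "(\<integral>p. w (S (fst p)) - (\<Lambda> * \<bar>snd p\<bar> + (snd p)\<^sup>2 / (2 * \<sigma>)) \<partial>?J) \<le> (\<integral>p. v (?Y p) \<partial>?J)"
  proof (intro integral_mono_AE vI)
    show "integrable ?J (\<lambda>p. w (S (fst p)) - (\<Lambda> * \<bar>snd p\<bar> + (snd p)\<^sup>2 / (2 * \<sigma>)))"
      using wI integrable_abs_noise integrable_square_noise by simp
    show "AE p in ?J. w (S (fst p)) - (\<Lambda> * \<bar>snd p\<bar> + (snd p)\<^sup>2 / (2 * \<sigma>)) \<le> v (?Y p)"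
      using Sb by eventually_elim (use bnd(2) in blast)
  qed
  moreover have "(\<integral>p. w (S (fst p)) - (\<Lambda> * \<bar>snd p\<bar> + (snd p)\<^sup>2 / (2 * \<sigma>)) \<partial>?J) =
      (\<integral>p. w (S (fst p)) \<partial>?J) - (\<Lambda> * (\<integral>p. \<bar>snd p\<bar> \<partial>?J) + \<sigma>\<^sup>2 / (2 * \<sigma>))"
    using wI integrable_abs_noise integrable_square_noise integral_square_noise by simp
  moreover have "(\<integral>p. w (S (fst p)) \<partial>?J) = (\<integral>x. w (S x) \<partial>M)"
    by (rule joint_fst(2)) measurable
  moreover have "\<Lambda> * (\<integral>p. \<bar>snd p\<bar> \<partial>?J) \<le> \<Lambda> * \<sigma>"
    using \<Lambda> integral_abs_noise_le by (rule mult_left_mono[rotated])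
  moreover have "\<sigma>\<^sup>2 / (2 * \<sigma>) = \<sigma> / 2" using \<sigma>_pos by (simp add: power2_eq_square)
  ultimately show ?thesis unfolding B_def by simp
qed

end

section \<open>The optical channel\<close>

lemma AE_input_bounds:
  assumes "\<mu> \<in> bounded_input_laws n"
  shows "AE x in \<mu>. \<forall>k\<in>{1..n}. 0 \<le> x k \<and> x k \<le> 1"
  using assms unfolding bounded_input_laws_def by (subst AE_ball_countable) auto

lemma integrable_component:
  assumes \<mu>: "\<mu> \<in> bounded_input_laws n" and k: "k \<in> {1..n}"
  shows "integrable \<mu> (\<lambda>x. x k)"
proof -
  interpret prob_space \<mu> using \<mu> by (simp add: bounded_input_laws_def)
  have sets: "sets \<mu> = sets (input_space n)" using \<mu> by (simp add: bounded_input_laws_def)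
  show ?thesis
  proof (rule integrable_const_bound[where B = 1])
    show "AE x in \<mu>. norm (x k) \<le> 1" using AE_input_bounds[OF \<mu>] by eventually_elim (use k in auto)
    show "(\<lambda>x. x k) \<in> borel_measurable \<mu>"
      using measurable_component_singleton[OF k, of "\<lambda>_. borel"] measurable_cong_sets[OF sets refl] by blast
  qed
qed

locale channel =
  fixes n :: nat and h :: "nat \<Rightarrow> real"
  assumes h_pos: "\<And>k. k \<in> {1..n} \<Longrightarrow> h k > 0" and h_sum: "(\<Sum>k=1..n. h k) = 1"
begin

definition total :: "(nat \<Rightarrow> real) \<Rightarrow> real" where
  "total x = (\<Sum>k=1..n. h k * x k)"

lemma n_pos: "0 < n"
  using h_sum by (cases n) auto

lemma H_sum_n: "H_sum h n = 1"
  using h_sum by (simp add: H_sum_def)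

sublocale H: knots n "H_sum h"
  using n_pos h_pos by unfold_locales (auto simp: H_sum_Suc)

lemma noisy_channel_input:
  assumes \<mu>: "\<mu> \<in> bounded_input_laws n" and \<sigma>: "0 < \<sigma>"
  shows "noisy_channel \<mu> total \<sigma>"
proof -
  interpret prob_space \<mu> using \<mu> by (simp add: bounded_input_laws_def)
  have sets: "sets \<mu> = sets (input_space n)" using \<mu> by (simp add: bounded_input_laws_def)
  have "total \<in> borel_measurable (input_space n)"
    unfolding total_def by (intro borel_measurable_sum borel_measurable_times) auto
  hence "total \<in> borel_measurable \<mu>" using measurable_cong_sets[OF sets refl] by blast
  moreover have "AE x in \<mu>. 0 \<le> total x \<and> total x \<le> 1"
    using AE_input_bounds[OF \<mu>]
  proof eventually_elim
    case (elim x)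
    have "total x \<le> (\<Sum>k=1..n. h k * 1)"
      unfolding total_def using elim h_pos by (intro sum_mono mult_left_mono) (auto simp: less_imp_le)
    moreover have "0 \<le> total x"
      unfolding total_def using elim h_pos by (intro sum_nonneg mult_nonneg_nonneg) (auto simp: less_imp_le)
    ultimately show ?case using h_sum by simp
  qed
  ultimately show ?thesis using \<sigma> by unfold_locales
qed

text \<open>\<open>distr\<close> depends on its target only through the measurable sets, so
  \<open>input_space n\<close> and \<open>borel\<close> may be exchanged for \<mu> and
  \<open>lborel\<close>, with respect to which the densities are taken.\<close>

lemma channel_information_eq:
  assumes \<mu>: "\<mu> \<in> bounded_input_laws n" and \<sigma>: "0 < \<sigma>"
  shows "channel_information n h \<sigma> \<mu> = - (1 / 2) * ln (2 * pi * exp 1) + ln (1 / \<sigma>)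
    - (\<integral>p. ln (noisy_channel.out_density \<mu> total \<sigma> (total (fst p) + snd p)) \<partial>(\<mu> \<Otimes>\<^sub>M noise \<sigma>))"
proof -
  interpret noisy_channel \<mu> total \<sigma> using noisy_channel_input[OF assms] .
  have sets: "sets \<mu> = sets (input_space n)" using \<mu> by (simp add: bounded_input_laws_def)
  have sets2: "sets (input_space n \<Otimes>\<^sub>M borel) = sets (\<mu> \<Otimes>\<^sub>M lborel)"
    using sets by (intro sets_pair_measure_cong) auto
  have out: "channel_output n h = (\<lambda>p. total (fst p) + snd p)"
    by (auto simp: channel_output_def total_def)
  have "channel_information n h \<sigma> \<mu> = joint.mutual_information (exp 1) \<mu> lborel fst (\<lambda>p. total (fst p) + snd p)"
    unfolding channel_information_def channel_space_def joint.mutual_information_def out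
    by (intro arg_cong2[where f = "KL_divergence (exp 1)"] arg_cong2[where f = pair_measure]
        distr_cong sets2 sets[symmetric]) auto
  thus ?thesis using mutual_information_eq by simp
qed

text \<open>Only the weighted combination \<open>lin\<close> of the constraints is assumed. This
  covers both problems at once, including an equality constraint whose multiplier has either
  sign.\<close>

lemma information_upper:
  fixes \<nu> :: real
  assumes \<mu>: "\<mu> \<in> bounded_input_laws n"
    and lin: "(\<Sum>i<n. l i * (\<integral>x. hinge (H_sum h i) (total x) \<partial>\<mu>)) \<le> (\<Sum>i<n. l i * c i)"
    and \<sigma>: "0 < \<sigma>" "\<sigma> \<le> 1"
  defines "w \<equiv> \<lambda>s. \<nu> - hinge_sum n (H_sum h) l s"
  shows "channel_information n h \<sigma> \<mu> \<le> - (1 / 2) * ln (2 * pi * exp 1) + ln (1 / \<sigma>) + dual n (H_sum h) c \<nu> l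
    + ((\<Sum>i<n. \<bar>l i\<bar>) + 1 / 2 + sqrt (2 * pi) * (exp (w 0) + exp (w 1))) * sqrt \<sigma>"
proof -
  interpret noisy_channel \<mu> total \<sigma> using noisy_channel_input[OF \<mu> \<sigma>(1)] .
  define \<Lambda> where "\<Lambda> = (\<Sum>i<n. \<bar>l i\<bar>)"
  have "- (\<integral>p. ln (out_density (total (fst p) + snd p)) \<partial>(\<mu> \<Otimes>\<^sub>M noise \<sigma>))
      \<le> - (\<integral>x. w (total x) \<partial>\<mu>) + integral {0..1} (\<lambda>s. exp (w s)) - 1
      + (\<Lambda> * \<sigma> + \<sigma> / 2 + sqrt (2 * pi) * (exp (w 0) + exp (w 1)) * sqrt \<sigma>)"
  proof (rule output_entropy_upper)
    show "continuous_on UNIV w" unfolding w_def by (intro continuous_intros)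
    show "\<bar>w s - w t\<bar> \<le> \<Lambda> * \<bar>s - t\<bar>" for s t
      using hinge_sum_lipschitz[of n "H_sum h" l t s] by (simp add: w_def \<Lambda>_def abs_minus_commute)
  qed
  moreover have "(\<integral>x. w (total x) \<partial>\<mu>) = \<nu> - (\<Sum>i<n. l i * (\<integral>x. hinge (H_sum h i) (total x) \<partial>\<mu>))"
  proof -
    show ?thesis by (simp add: w_def hinge_sum_def prob_space integrable_hinge)
  qed
  moreover have "integral {0..1} (\<lambda>s. exp (w s)) = integral {H_sum h 0..H_sum h n} (\<lambda>s. exp (w s))"
    by (simp add: H_sum_n) (simp add: H_sum_def)
  moreover have "\<Lambda> * \<sigma> + \<sigma> / 2 \<le> (\<Lambda> + 1 / 2) * sqrt \<sigma>"
  proof -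
    have "\<sigma> \<le> sqrt \<sigma>" using \<sigma> by (intro real_le_rsqrt) (simp add: power2_eq_square mult_left_le)
    moreover have "0 \<le> \<Lambda>" by (simp add: \<Lambda>_def sum_nonneg)
    ultimately have "(\<Lambda> + 1 / 2) * \<sigma> \<le> (\<Lambda> + 1 / 2) * sqrt \<sigma>" by (intro mult_left_mono) auto
    thus ?thesis by (simp add: algebra_simps)
  qed
  ultimately show ?thesis
    using lin unfolding channel_information_eq[OF \<mu> \<sigma>(1)] dual_def \<Lambda>_def
    by (simp add: w_def algebra_simps)
qed

lemma hinge_mean_le:
  assumes \<mu>: "\<mu> \<in> BC_laws n \<alpha>" and i: "i < n"
  shows "(\<integral>x. hinge (H_sum h i) (total x) \<partial>\<mu>) \<le> (\<Sum>j=i+1..n. h j * \<alpha> j)"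
proof -
  have \<mu>b: "\<mu> \<in> bounded_input_laws n" using \<mu> by (simp add: BC_laws_def)
  interpret noisy_channel \<mu> total 1 using noisy_channel_input[OF \<mu>b] by simp
  note xI = integrable_component[OF \<mu>b]
  have "(\<integral>x. hinge (H_sum h i) (total x) \<partial>\<mu>) \<le> (\<integral>x. (\<Sum>j=i+1..n. h j * x j) \<partial>\<mu>)"
  proof (rule integral_mono_AE)
    show "integrable \<mu> (\<lambda>x. hinge (H_sum h i) (total x))" by (rule integrable_hinge)
    show "integrable \<mu> (\<lambda>x. \<Sum>j=i+1..n. h j * x j)"
      by (intro Bochner_Integration.integrable_sum integrable_mult_right xI) auto
    show "AE x in \<mu>. hinge (H_sum h i) (total x) \<le> (\<Sum>j=i+1..n. h j * x j)"
      using AE_input_bounds[OF \<mu>b]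
    proof eventually_elim
      case (elim x)
      have "total x = (\<Sum>j=1..i. h j * x j) + (\<Sum>j=i+1..n. h j * x j)"
        unfolding total_def using i sum.ub_add_nat[of 1 i "\<lambda>j. h j * x j" "n - i"] by simp
      moreover have "(\<Sum>j=1..i. h j * x j) \<le> (\<Sum>j=1..i. h j * 1)"
        using elim h_pos i by (intro sum_mono mult_left_mono) (auto simp: less_imp_le)
      moreover have "0 \<le> (\<Sum>j=i+1..n. h j * x j)"
        using elim h_pos by (intro sum_nonneg mult_nonneg_nonneg) (auto simp: less_imp_le)
      ultimately show ?case by (simp add: hinge_def H_sum_def)
    qed
  qed
  also have "\<dots> = (\<Sum>j=i+1..n. h j * (\<integral>x. x j \<partial>\<mu>))"
    by (subst Bochner_Integration.integral_sum) (auto intro!: integrable_mult_right xI)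
  also have "\<dots> \<le> (\<Sum>j=i+1..n. h j * \<alpha> j)"
    using \<mu> h_pos by (intro sum_mono mult_left_mono) (auto simp: BC_laws_def less_imp_le)
  finally show ?thesis .
qed

text \<open>The first knot is 0, where the hinge is the identity on nonnegative outputs. Hence
  equality of the means survives here and no sign is imposed on
  \<open>\<lambda>\<^sub>0\<close>.\<close>

lemma hinge_mean_eq:
  assumes \<mu>: "\<mu> \<in> EC_laws n \<alpha>"
  shows "(\<integral>x. hinge (H_sum h 0) (total x) \<partial>\<mu>) = (\<Sum>j=1..n. h j * \<alpha> j)"
proof -
  have \<mu>b: "\<mu> \<in> bounded_input_laws n" using \<mu> by (simp add: EC_laws_def)
  interpret noisy_channel \<mu> total 1 using noisy_channel_input[OF \<mu>b] by simp
  note xI = integrable_component[OF \<mu>b]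
  have "(\<integral>x. hinge (H_sum h 0) (total x) \<partial>\<mu>) = (\<integral>x. (\<Sum>j=1..n. h j * x j) \<partial>\<mu>)"
  proof (rule integral_cong_AE)
    show "AE x in \<mu>. hinge (H_sum h 0) (total x) = (\<Sum>j=1..n. h j * x j)"
      using S_bounds by eventually_elim (simp add: hinge_def H_sum_def total_def)
    show "(\<lambda>x. \<Sum>j=1..n. h j * x j) \<in> borel_measurable \<mu>"
      using S_meas unfolding total_def .
  qed measurable
  also have "\<dots> = (\<Sum>j=1..n. h j * (\<integral>x. x j \<partial>\<mu>))"
    by (subst Bochner_Integration.integral_sum) (auto intro!: integrable_mult_right xI)
  also have "\<dots> = (\<Sum>j=1..n. h j * \<alpha> j)"
    using \<mu> by (intro sum.cong) (auto simp: EC_laws_def)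
  finally show ?thesis .
qed

lemma EC_subset_BC: "EC_laws n \<alpha> \<subseteq> BC_laws n \<alpha>"
  by (auto simp: EC_laws_def BC_laws_def)

definition tail_mean :: "(nat \<Rightarrow> real) \<Rightarrow> nat \<Rightarrow> real" where
  "tail_mean \<alpha> i = (\<Sum>j=i+1..n. h j * \<alpha> j)"

text \<open>\<open>(1 - H_sum h i) * alpha_bar n h \<alpha> i\<close> is
  \<open>tail_mean \<alpha> i\<close>, and the bracket of \<open>G\<close> is the integral evaluated
  gap by gap: its exponents are the log-density, up to \<nu>, at the left ends of the gaps, and its
  \<open>zeta\<close> factors carry the slopes.\<close>

lemma G_eq_dual: "G n h \<alpha> (\<nu>, l) = dual n (H_sum h) (tail_mean \<alpha>) \<nu> l"
proof -
  have lt1: "H_sum h i < 1" if "i < n" for i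
    using H.knot_mono[of "Suc i" n] H.knot_less[OF that] H_sum_n that by simp
  have "(\<Sum>i=0..n-1. l i * (1 - H_sum h i) * alpha_bar n h \<alpha> i) = (\<Sum>i<n. l i * tail_mean \<alpha> i)"
  proof (intro sum.cong)
    show "{0..n-1} = {..<n}" using n_pos by auto
    fix i assume "i \<in> {..<n}"
    thus "l i * (1 - H_sum h i) * alpha_bar n h \<alpha> i = l i * tail_mean \<alpha> i"
      using lt1[of i] by (simp add: alpha_bar_def tail_mean_def)
  qed
  moreover have "(\<Sum>k=1..n. h k *
      exp (- l 0 * H_sum h (k - 1) + (\<Sum>i=1..k-2. l i * (H_sum h i - H_sum h (k - 1)))) *
      zeta ((- (\<Sum>i=0..k-1. l i)) * h k)) =
    (\<Sum>k<n. (H_sum h (Suc k) - H_sum h k) * exp (- hinge_sum n (H_sum h) l (H_sum h k)) *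
      zeta (- (\<Sum>i\<le>k. l i) * (H_sum h (Suc k) - H_sum h k)))"
  proof (rule sum.reindex_bij_witness[of _ Suc "\<lambda>k. k - 1"])
    fix k assume "k \<in> {1..n}"
    then obtain m where k: "k = Suc m" "m < n" by (cases k) auto
    have "hinge_sum n (H_sum h) l (H_sum h m) = (\<Sum>i<m. l i * (H_sum h m - H_sum h i))"
    proof -
      have "hinge_sum n (H_sum h) l (H_sum h m) = (\<Sum>i<n. if i < m then l i * (H_sum h m - H_sum h i) else 0)"
        unfolding hinge_sum_def
      proof (intro sum.cong refl)
        fix i assume "i \<in> {..<n}"
        thus "l i * hinge (H_sum h i) (H_sum h m) = (if i < m then l i * (H_sum h m - H_sum h i) else 0)"
          using H.knot_mono[of i m] H.knot_mono[of m i] k by (simp add: hinge_def)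
      qed
      also have "\<dots> = (\<Sum>i\<in>{i\<in>{..<n}. i < m}. l i * (H_sum h m - H_sum h i))"
        by (rule sum.inter_filter [symmetric]) simp
      also have "{i\<in>{..<n}. i < m} = {..<m}" using k by auto
      finally show ?thesis .
    qed
    \<comment> \<open>The term \<open>i = 0\<close> is split off with \<open>H_sum h 0 = 0\<close>.
      For \<open>m = 0\<close> both sides are zero, the range \<open>{1..m-1}\<close> being
      empty.\<close>
    also have "\<dots> = l 0 * H_sum h m - (\<Sum>i=1..m-1. l i * (H_sum h i - H_sum h m))"
    proof (cases m)
      case (Suc q)
      have "(\<Sum>i<m. l i * (H_sum h m - H_sum h i)) = l 0 * (H_sum h m - H_sum h 0) + (\<Sum>i=1..q. l i * (H_sum h m - H_sum h i))"
        unfolding Suc by (simp add: lessThan_Suc_atMost atMost_atLeast0 sum.atLeast_Suc_atMost)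
      also have "(\<Sum>i=1..q. l i * (H_sum h m - H_sum h i)) = - (\<Sum>i=1..m-1. l i * (H_sum h i - H_sum h m))"
        by (simp add: Suc sum_negf[symmetric] algebra_simps)
      finally show ?thesis by (simp add: H_sum_def)
    qed (simp add: H_sum_def)
    finally show "(H_sum h (Suc (k - 1)) - H_sum h (k - 1)) * exp (- hinge_sum n (H_sum h) l (H_sum h (k - 1))) *
      zeta (- (\<Sum>i\<le>k - 1. l i) * (H_sum h (Suc (k - 1)) - H_sum h (k - 1))) =
      h k * exp (- l 0 * H_sum h (k - 1) + (\<Sum>i=1..k-2. l i * (H_sum h i - H_sum h (k - 1)))) *
      zeta ((- (\<Sum>i=0..k-1. l i)) * h k)"
      by (simp add: k H_sum_Suc atMost_atLeast0)
  qed auto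
  ultimately show ?thesis
    by (simp add: G_def dual_def H.integral_exp_hinge_sum)
qed

end

section \<open>High-SNR limits\<close>

text \<open>\<open>g\<close> is the common value of both optimization problems: one fixed law
  achieves it at every noise level, while multipliers need only approach it, since a minimizer can
  be missing. The supremum stays in \<open>ereal\<close> because its finiteness is not known
  beforehand.\<close>

lemma capacity_limit:
  fixes info :: "real \<Rightarrow> 'm \<Rightarrow> real" and G :: "'p \<Rightarrow> real"
  assumes upper: "\<And>p. p \<in> C \<Longrightarrow>
      \<exists>K. \<forall>\<sigma> \<mu>. 0 < \<sigma> \<longrightarrow> \<sigma> \<le> 1 \<longrightarrow> \<mu> \<in> L \<longrightarrow> info \<sigma> \<mu> \<le> b + ln (1 / \<sigma>) + G p + K * sqrt \<sigma>"
    and attained: "\<mu>0 \<in> L" "\<And>\<sigma>. 0 < \<sigma> \<Longrightarrow> b + ln (1 / \<sigma>) + g \<le> info \<sigma> \<mu>0"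
    and approx: "\<And>\<epsilon>. 0 < \<epsilon> \<Longrightarrow> \<exists>p\<in>C. G p \<le> g + \<epsilon>"
  shows "bdd_below (G ` C)"
    and "((\<lambda>\<sigma>. (SUP \<mu>\<in>L. ereal (info \<sigma> \<mu>)) - ereal (ln (1 / \<sigma>))) \<longlongrightarrow> ereal (b + (INF p\<in>C. G p))) (at_right 0)"
proof -
  have sqrt0: "((\<lambda>\<sigma>. K * sqrt \<sigma>) \<longlongrightarrow> 0) (at_right 0)" for K :: real
  proof -
    have "((\<lambda>\<sigma>. K * sqrt \<sigma>) \<longlongrightarrow> K * sqrt 0) (at_right 0)" by (intro tendsto_intros)
    thus ?thesis by simp
  qed
  have small: "\<forall>\<^sub>F \<sigma> in at_right 0. 0 < \<sigma> \<and> \<sigma> \<le> (1 :: real)"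
    unfolding eventually_at_right_field by (intro exI[of _ 1]) auto
  \<comment> \<open>Weak duality is read off the channel: both bounds are applied to the information
    of \<open>\<mu>0\<close>, and \<sigma> tends to 0.\<close>
  have g_le: "g \<le> G p" if p: "p \<in> C" for p
  proof -
    obtain K where K: "\<And>\<sigma> \<mu>. 0 < \<sigma> \<Longrightarrow> \<sigma> \<le> 1 \<Longrightarrow> \<mu> \<in> L \<Longrightarrow> info \<sigma> \<mu> \<le> b + ln (1 / \<sigma>) + G p + K * sqrt \<sigma>"
      using upper[OF p] by blast
    have "\<forall>\<^sub>F \<sigma> in at_right 0. g \<le> G p + K * sqrt \<sigma>"
      using small
    proof eventually_elim
      case (elim \<sigma>)
      have "b + ln (1 / \<sigma>) + g \<le> info \<sigma> \<mu>0" using attained(2) elim by blast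
      moreover have "info \<sigma> \<mu>0 \<le> b + ln (1 / \<sigma>) + G p + K * sqrt \<sigma>"
        using K attained(1) elim by blast
      ultimately show ?case by linarith
    qed
    moreover have "((\<lambda>\<sigma>. G p + K * sqrt \<sigma>) \<longlongrightarrow> G p + 0) (at_right 0)"
      by (intro tendsto_intros sqrt0)
    ultimately have "g \<le> G p + 0" by (intro tendsto_lowerbound) auto
    thus ?thesis by simp
  qed
  thus bdd: "bdd_below (G ` C)" by (intro bdd_belowI2)
  have INF: "(INF p\<in>C. G p) = g"
  proof (rule antisym)
    show "(INF p\<in>C. G p) \<le> g"
    proof (rule field_le_epsilon)
      fix \<epsilon> :: real assume "0 < \<epsilon>"
      then obtain p where "p \<in> C" "G p \<le> g + \<epsilon>" using approx by blast
      thus "(INF p\<in>C. G p) \<le> g + \<epsilon>" using cINF_lower[OF bdd] by fastforce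
    qed
    have "C \<noteq> {}" using approx[of 1] by auto
    thus "g \<le> (INF p\<in>C. G p)" using g_le by (intro cINF_greatest)
  qed
  show "((\<lambda>\<sigma>. (SUP \<mu>\<in>L. ereal (info \<sigma> \<mu>)) - ereal (ln (1 / \<sigma>))) \<longlongrightarrow> ereal (b + (INF p\<in>C. G p))) (at_right 0)"
    unfolding INF
  proof (rule order_tendstoI)
    fix u assume u: "u < ereal (b + g)"
    show "\<forall>\<^sub>F \<sigma> in at_right 0. u < (SUP \<mu>\<in>L. ereal (info \<sigma> \<mu>)) - ereal (ln (1 / \<sigma>))"
      using small
    proof eventually_elim
      case (elim \<sigma>)
      have "ereal (b + ln (1 / \<sigma>) + g) \<le> (SUP \<mu>\<in>L. ereal (info \<sigma> \<mu>))"
        using attained elim by (intro SUP_upper2[of \<mu>0]) auto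
      hence "ereal (b + g) \<le> (SUP \<mu>\<in>L. ereal (info \<sigma> \<mu>)) - ereal (ln (1 / \<sigma>))"
        by (cases "SUP \<mu>\<in>L. ereal (info \<sigma> \<mu>)") auto
      thus ?case using u by (rule less_le_trans[rotated])
    qed
  next
    fix u assume u: "ereal (b + g) < u"
    then obtain r where r: "ereal (b + g) < ereal r" "ereal r < u"
      using ereal_dense2 by blast
    \<comment> \<open>One half of the margin pays for \<open>G p\<close>, the other for
      \<open>K * sqrt \<sigma>\<close>.\<close>
    define \<epsilon> where "\<epsilon> = (r - (b + g)) / 2"
    have \<epsilon>: "\<epsilon> > 0" using r by (simp add: \<epsilon>_def)
    obtain p where p: "p \<in> C" "G p \<le> g + \<epsilon>" using approx[OF \<epsilon>] by blast
    obtain K where K: "\<And>\<sigma> \<mu>. 0 < \<sigma> \<Longrightarrow> \<sigma> \<le> 1 \<Longrightarrow> \<mu> \<in> L \<Longrightarrow> info \<sigma> \<mu> \<le> b + ln (1 / \<sigma>) + G p + K * sqrt \<sigma>"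
      using upper[OF p(1)] by blast
    have "\<forall>\<^sub>F \<sigma> in at_right 0. K * sqrt \<sigma> < \<epsilon>"
      using sqrt0[of K] \<epsilon> by (rule order_tendstoD)
    thus "\<forall>\<^sub>F \<sigma> in at_right 0. (SUP \<mu>\<in>L. ereal (info \<sigma> \<mu>)) - ereal (ln (1 / \<sigma>)) < u"
      using small
    proof eventually_elim
      case (elim \<sigma>)
      have le: "b + ln (1 / \<sigma>) + G p + K * sqrt \<sigma> \<le> r + ln (1 / \<sigma>)"
        using elim p(2) by (simp add: \<epsilon>_def field_simps)
      have "(SUP \<mu>\<in>L. ereal (info \<sigma> \<mu>)) \<le> ereal (r + ln (1 / \<sigma>))"
      proof (intro SUP_least)
        fix \<mu> assume "\<mu> \<in> L"
        hence "info \<sigma> \<mu> \<le> b + ln (1 / \<sigma>) + G p + K * sqrt \<sigma>" using K elim by blast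
        thus "ereal (info \<sigma> \<mu>) \<le> ereal (r + ln (1 / \<sigma>))" using le by simp
      qed
      hence "(SUP \<mu>\<in>L. ereal (info \<sigma> \<mu>)) - ereal (ln (1 / \<sigma>)) \<le> ereal r"
        by (cases "SUP \<mu>\<in>L. ereal (info \<sigma> \<mu>)") auto
      thus ?case using r(2) by (rule le_less_trans)
    qed
  qed
qed

lemma density_law:
  fixes w :: "real \<Rightarrow> real"
  assumes w: "continuous_on UNIV w" and b: "0 \<le> b" "b \<le> 1"
    and one: "integral {b..1} (\<lambda>s. exp (w s)) = 1"
  defines "\<rho> \<equiv> density lborel (\<lambda>s. ennreal (indicator {b..1} s * exp (w s)))"
  shows "prob_space \<rho>" and "AE s in \<rho>. b \<le> s \<and> s \<le> 1"
    and "\<And>g. continuous_on UNIV g \<Longrightarrow> integrable \<rho> g \<and> (\<integral>s. g s \<partial>\<rho>) = integral {b..1} (\<lambda>s. exp (w s) * g s)"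
proof -
  have [measurable]: "w \<in> borel_measurable borel" using w by (rule borel_measurable_continuous_onI)
  have ws: "continuous_on A w" for A using w by (rule continuous_on_subset) simp
  have set: "set_integrable lborel {b..1} f" "(LINT s:{b..1}|lborel. f s) = integral {b..1} f"
    if "continuous_on {b..1} f" for f :: "real \<Rightarrow> real"
    using that by (auto intro!: borel_integrable_atLeastAtMost' set_borel_integral_eq_integral)
  show g: "integrable \<rho> g \<and> (\<integral>s. g s \<partial>\<rho>) = integral {b..1} (\<lambda>s. exp (w s) * g s)"
    if "continuous_on UNIV g" for g
  proof -
    have [measurable]: "g \<in> borel_measurable borel" using that by (rule borel_measurable_continuous_onI)
    have gs: "continuous_on {b..1} g" using that by (rule continuous_on_subset) simp
    have c: "continuous_on {b..1} (\<lambda>s. exp (w s) * g s)" by (intro continuous_intros ws gs)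
    have eq: "(\<lambda>s. (indicator {b..1} s * exp (w s)) *\<^sub>R g s) = (\<lambda>s. indicator {b..1} s *\<^sub>R (exp (w s) * g s))"
      by (simp add: mult_ac)
    have "integrable \<rho> g"
      unfolding \<rho>_def using set(1)[OF c] eq unfolding set_integrable_def
      by (subst integrable_density) auto
    moreover have "(\<integral>s. g s \<partial>\<rho>) = integral {b..1} (\<lambda>s. exp (w s) * g s)"
      unfolding \<rho>_def using set(2)[OF c] eq unfolding set_lebesgue_integral_def
      by (subst integral_density) auto
    ultimately show ?thesis ..
  qed
  show "prob_space \<rho>"
  proof
    have c: "continuous_on {b..1} (\<lambda>s. exp (w s))" by (intro continuous_intros ws)
    have "emeasure \<rho> (space \<rho>) = (\<integral>\<^sup>+s. ennreal (indicator {b..1} s *\<^sub>R exp (w s)) \<partial>lborel)"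
      unfolding \<rho>_def by (subst emeasure_density) auto
    also have "\<dots> = ennreal (integral {b..1} (\<lambda>s. exp (w s)))"
      using set[OF c] unfolding set_integrable_def set_lebesgue_integral_def
      by (subst nn_integral_eq_integral) auto
    finally show "emeasure \<rho> (space \<rho>) = 1" using one by simp
  qed
  show "AE s in \<rho>. b \<le> s \<and> s \<le> 1"
    unfolding \<rho>_def by (subst AE_density) (auto simp: indicator_def)
qed

context channel
begin

text \<open>The same law serves all noise levels because noise never lowers the entropy. The left
  end \<open>b\<close> will be 0, or \<open>h 1\<close> when the first channel is saturated.\<close>

lemma law_attaining:
  fixes w :: "real \<Rightarrow> real"
  assumes \<alpha>: "\<And>i j. i \<in> {1..n} \<Longrightarrow> j \<in> {1..n} \<Longrightarrow> i \<le> j \<Longrightarrow> \<alpha> j \<le> \<alpha> i"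
    and w: "continuous_on UNIV w" and b: "0 \<le> b" "b \<le> 1"
    and one: "integral {b..1} (\<lambda>s. exp (w s)) = 1"
    and mean: "\<And>k. k < n \<Longrightarrow> integral {b..1} (\<lambda>s. exp (w s) * hinge (H_sum h k) s) \<le> tail_mean \<alpha> k"
  obtains \<mu> where "\<mu> \<in> BC_laws n \<alpha>"
    "integral {b..1} (\<lambda>s. exp (w s) * s) = tail_mean \<alpha> 0 \<Longrightarrow> \<mu> \<in> EC_laws n \<alpha>"
    "\<And>\<sigma>. 0 < \<sigma> \<Longrightarrow> - (1 / 2) * ln (2 * pi * exp 1) + ln (1 / \<sigma>) + - integral {b..1} (\<lambda>s. exp (w s) * w s)
      \<le> channel_information n h \<sigma> \<mu>"
proof -
  define \<rho> where "\<rho> = density lborel (\<lambda>s. ennreal (indicator {b..1} s * exp (w s)))"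
  note \<rho> = density_law[OF w b one, folded \<rho>_def]
  have [measurable]: "w \<in> borel_measurable borel" using w by (rule borel_measurable_continuous_onI)
  have AE: "AE s in \<rho>. 0 \<le> s \<and> s \<le> 1" using \<rho>(2) by eventually_elim (use b in auto)
  have mean': "(\<integral>s. hinge (H_sum h k) s \<partial>\<rho>) \<le> (\<Sum>i=k+1..n. h i * \<alpha> i)" if "k < n" for k
    using \<rho>(3)[of "hinge (H_sum h k)"] mean[OF that] by (simp add: continuous_on_hinge tail_mean_def)
  have sets: "sets \<rho> = sets borel" by (simp add: \<rho>_def)
  obtain \<mu> where \<mu>: "\<mu> \<in> BC_laws n \<alpha>" "distr \<mu> borel (\<lambda>x. \<Sum>k=1..n. h k * x k) = \<rho>"
    "(\<integral>s. s \<partial>\<rho>) = (\<Sum>i=1..n. h i * \<alpha> i) \<longrightarrow> \<mu> \<in> EC_laws n \<alpha>"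
    using laws_with_given_output[OF h_pos h_sum \<alpha> \<rho>(1) sets AE mean'] by blast
  have law: "distr \<mu> borel total = \<rho>"
    using \<mu>(2) unfolding total_def .
  show thesis
  proof (rule that[OF \<mu>(1)])
    show "\<mu> \<in> EC_laws n \<alpha>" if "integral {b..1} (\<lambda>s. exp (w s) * s) = tail_mean \<alpha> 0"
      using \<mu>(3) \<rho>(3)[of "\<lambda>s. s"] that by (simp add: tail_mean_def)
  next
    fix \<sigma> :: real assume \<sigma>: "0 < \<sigma>"
    have \<mu>b: "\<mu> \<in> bounded_input_laws n" using \<mu>(1) by (simp add: BC_laws_def)
    interpret noisy_channel \<mu> total \<sigma> using noisy_channel_input[OF \<mu>b \<sigma>] .
    have "integrable \<mu> (\<lambda>x. w (total x))"
      using \<rho>(3)[OF w] integrable_distr[of total \<mu> borel w] law by simp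
    hence "- (\<integral>x. w (total x) \<partial>\<mu>) \<le> - (\<integral>p. ln (out_density (total (fst p) + snd p)) \<partial>(\<mu> \<Otimes>\<^sub>M noise \<sigma>))"
      using law by (intro output_entropy_ge[of w b 1]) (auto simp: \<rho>_def)
    moreover have "(\<integral>x. w (total x) \<partial>\<mu>) = integral {b..1} (\<lambda>s. exp (w s) * w s)"
      using \<rho>(3)[OF w] integral_distr[of total \<mu> borel w] law by simp
    ultimately show "- (1 / 2) * ln (2 * pi * exp 1) + ln (1 / \<sigma>) + - integral {b..1} (\<lambda>s. exp (w s) * w s)
      \<le> channel_information n h \<sigma> \<mu>"
      unfolding channel_information_eq[OF \<mu>b \<sigma>] by simp
  qed
qed

lemma EC_upper:
  assumes p: "p \<in> EC_multipliers n"
  shows "\<exists>K. \<forall>\<sigma> \<mu>. 0 < \<sigma> \<longrightarrow> \<sigma> \<le> 1 \<longrightarrow> \<mu> \<in> EC_laws n \<alpha> \<longrightarrow>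
    channel_information n h \<sigma> \<mu> \<le> - (1 / 2) * ln (2 * pi * exp 1) + ln (1 / \<sigma>) + G n h \<alpha> p + K * sqrt \<sigma>"
proof -
  obtain \<nu> l where [simp]: "p = (\<nu>, l)" by fastforce
  have l: "0 \<le> l i" if "i \<in> {1..<n}" for i using p that by (auto simp: EC_multipliers_def)
  have lin: "(\<Sum>i<n. l i * (\<integral>x. hinge (H_sum h i) (total x) \<partial>\<mu>)) \<le> (\<Sum>i<n. l i * tail_mean \<alpha> i)"
    if \<mu>: "\<mu> \<in> EC_laws n \<alpha>" for \<mu>
  proof (intro sum_mono)
    fix i assume i: "i \<in> {..<n}"
    show "l i * (\<integral>x. hinge (H_sum h i) (total x) \<partial>\<mu>) \<le> l i * tail_mean \<alpha> i"
    proof (cases "i = 0")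
      case True
      thus ?thesis using hinge_mean_eq[OF \<mu>] by (simp add: tail_mean_def)
    next
      case False
      thus ?thesis using hinge_mean_le[of \<mu> \<alpha> i] \<mu> EC_subset_BC[of \<alpha>] l[of i] i
        by (auto simp: tail_mean_def intro!: mult_left_mono)
    qed
  qed
  have "\<mu> \<in> bounded_input_laws n" if "\<mu> \<in> EC_laws n \<alpha>" for \<mu>
    using that by (simp add: EC_laws_def)
  from information_upper[OF this lin] show ?thesis
    by (intro exI allI impI) (simp add: G_eq_dual)
qed

lemma BC_upper:
  assumes p: "p \<in> BC_multipliers n"
  shows "\<exists>K. \<forall>\<sigma> \<mu>. 0 < \<sigma> \<longrightarrow> \<sigma> \<le> 1 \<longrightarrow> \<mu> \<in> BC_laws n \<alpha> \<longrightarrow>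
    channel_information n h \<sigma> \<mu> \<le> - (1 / 2) * ln (2 * pi * exp 1) + ln (1 / \<sigma>) + G n h \<alpha> p + K * sqrt \<sigma>"
proof -
  obtain \<nu> l where [simp]: "p = (\<nu>, l)" by fastforce
  have lin: "(\<Sum>i<n. l i * (\<integral>x. hinge (H_sum h i) (total x) \<partial>\<mu>)) \<le> (\<Sum>i<n. l i * tail_mean \<alpha> i)"
    if \<mu>: "\<mu> \<in> BC_laws n \<alpha>" for \<mu>
    using p hinge_mean_le[OF \<mu>] by (intro sum_mono mult_left_mono) (auto simp: BC_multipliers_def tail_mean_def)
  have "\<mu> \<in> bounded_input_laws n" if "\<mu> \<in> BC_laws n \<alpha>" for \<mu>
    using that by (simp add: BC_laws_def)
  from information_upper[OF this lin] show ?thesis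
    by (intro exI allI impI) (simp add: G_eq_dual)
qed

end

section \<open>Minimizers and limits for strictly decreasing means\<close>

locale decreasing_means = channel +
  fixes \<alpha> :: "nat \<Rightarrow> real"
  assumes n_ge2: "2 \<le> n" and \<alpha>_le: "\<alpha> 1 \<le> 1" and \<alpha>_dec: "\<And>k. k \<in> {1..<n} \<Longrightarrow> \<alpha> (k + 1) < \<alpha> k"
    and \<alpha>_pos: "0 < \<alpha> n"
begin

lemma \<alpha>_antimono: "i \<in> {1..n} \<Longrightarrow> j \<in> {1..n} \<Longrightarrow> i \<le> j \<Longrightarrow> \<alpha> j \<le> \<alpha> i"
proof (induction j)
  case (Suc j)
  show ?case
  proof (cases "i = Suc j")
    case False
    hence "\<alpha> j \<le> \<alpha> i" using Suc by simp
    moreover have "\<alpha> (j + 1) < \<alpha> j" using Suc.prems False by (intro \<alpha>_dec) simp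
    ultimately show ?thesis by simp
  qed simp
qed simp

lemma tail_mean_Suc: "i < n \<Longrightarrow> tail_mean \<beta> i = h (Suc i) * \<beta> (Suc i) + tail_mean \<beta> (Suc i)"
  unfolding tail_mean_def by (simp add: sum.atLeast_Suc_atMost)

text \<open>The steps 1, \<open>\<beta> 1\<close>, ..., \<open>\<beta> n\<close>, 0 decrease
  strictly; this is where a first mean below 1 is needed. The vector \<beta> is kept general because
  \<open>BC_minimizer\<close> applies the bound to a modified \<alpha>.\<close>

lemma coercive:
  assumes \<beta>: "\<beta> 1 < 1" "\<And>k. k \<in> {1..<n} \<Longrightarrow> \<beta> (k + 1) < \<beta> k" "0 < \<beta> n"
  shows "\<exists>R. \<forall>\<nu> l. dual n (H_sum h) (tail_mean \<beta>) \<nu> l \<le> B \<longrightarrow> \<bar>\<nu>\<bar> \<le> R \<and> (\<forall>i<n. \<bar>l i\<bar> \<le> R)"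
proof (rule H.dual_coercive_steps[where b = "\<lambda>j. if j = 0 then 1 else if j \<le> n then \<beta> j else 0"])
  show "(if Suc j = 0 then 1 else if Suc j \<le> n then \<beta> (Suc j) else 0) < (if j = 0 then 1 else if j \<le> n then \<beta> j else 0)"
    if "j \<le> n" for j
    using \<beta>(1,3) \<beta>(2)[of j] n_pos that by (cases "j = 0"; cases "j = n") auto
  fix i
  show "tail_mean \<beta> i = (\<Sum>j=Suc i..n. (if j = 0 then 1 else if j \<le> n then \<beta> j else 0) * (H_sum h j - H_sum h (j - 1)))"
    unfolding tail_mean_def
  proof (intro sum.cong)
    fix j assume j: "j \<in> {Suc i..n}"
    then obtain m where "j = Suc m" by (cases j) auto
    thus "h j * \<beta> j = (if j = 0 then 1 else if j \<le> n then \<beta> j else 0) * (H_sum h j - H_sum h (j - 1))"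
      using j by (simp add: H_sum_Suc)
  qed simp
qed auto

text \<open>Serves both problems: with \<open>J\<close> = \<open>{1..<n}\<close> the condition at
  index 0 is an equality and the means are met exactly, with \<open>J\<close> =
  \<open>{..<n}\<close> they are only bounded.\<close>

lemma kkt_law:
  assumes J: "J \<subseteq> {..<n}" and l: "\<forall>i\<in>J. 0 \<le> l i"
    and min: "\<And>\<nu>' l'. (\<forall>i\<in>J. 0 \<le> l' i) \<Longrightarrow>
      dual n (H_sum h) (tail_mean \<alpha>) \<nu> l \<le> dual n (H_sum h) (tail_mean \<alpha>) \<nu>' l'"
  obtains \<mu> where "\<mu> \<in> BC_laws n \<alpha>" "0 \<notin> J \<Longrightarrow> \<mu> \<in> EC_laws n \<alpha>"
    "\<And>\<sigma>. 0 < \<sigma> \<Longrightarrow> - (1 / 2) * ln (2 * pi * exp 1) + ln (1 / \<sigma>) + dual n (H_sum h) (tail_mean \<alpha>) \<nu> l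
      \<le> channel_information n h \<sigma> \<mu>"
proof -
  have H01: "H_sum h 0 = 0" "H_sum h n = 1" using H_sum_n by (auto simp: H_sum_def)
  note kkt = H.dual_kkt[OF J l min, unfolded H01]
  have cw: "continuous_on UNIV (\<lambda>s. \<nu> - hinge_sum n (H_sum h) l s)" by (intro continuous_intros)
  obtain \<mu> where \<mu>: "\<mu> \<in> BC_laws n \<alpha>"
    "integral {0..1} (\<lambda>s. exp (\<nu> - hinge_sum n (H_sum h) l s) * s) = tail_mean \<alpha> 0 \<Longrightarrow> \<mu> \<in> EC_laws n \<alpha>"
    "\<And>\<sigma>. 0 < \<sigma> \<Longrightarrow> - (1 / 2) * ln (2 * pi * exp 1) + ln (1 / \<sigma>) + - integral {0..1} (\<lambda>s. exp (\<nu> - hinge_sum n (H_sum h) l s) * (\<nu> - hinge_sum n (H_sum h) l s))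
      \<le> channel_information n h \<sigma> \<mu>"
    using law_attaining[OF \<alpha>_antimono cw _ _ kkt(1) kkt(2)] by auto
  show thesis
  proof (rule that[OF \<mu>(1)])
    assume "0 \<notin> J"
    hence "integral {0..1} (\<lambda>s. exp (\<nu> - hinge_sum n (H_sum h) l s) * hinge (H_sum h 0) s) = tail_mean \<alpha> 0"
      using kkt(3)[of 0] n_pos by simp
    also have "integral {0..1} (\<lambda>s. exp (\<nu> - hinge_sum n (H_sum h) l s) * hinge (H_sum h 0) s) =
        integral {0..1} (\<lambda>s. exp (\<nu> - hinge_sum n (H_sum h) l s) * s)"
      by (intro integral_cong) (auto simp: H01 hinge_def)
    finally show "\<mu> \<in> EC_laws n \<alpha>" by (rule \<mu>(2))
  next
    fix \<sigma> :: real assume "0 < \<sigma>"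
    from \<mu>(3)[OF this] kkt(4) show "- (1 / 2) * ln (2 * pi * exp 1) + ln (1 / \<sigma>) + dual n (H_sum h) (tail_mean \<alpha>) \<nu> l
      \<le> channel_information n h \<sigma> \<mu>"
      by simp
  qed
qed

lemma EC_minimizer:
  assumes "\<alpha> 1 < 1"
  obtains \<nu> l where "(\<nu>, l) \<in> EC_multipliers n" "\<And>q. q \<in> EC_multipliers n \<Longrightarrow> G n h \<alpha> (\<nu>, l) \<le> G n h \<alpha> q"
proof -
  obtain R where R: "\<And>\<nu> l. dual n (H_sum h) (tail_mean \<alpha>) \<nu> l \<le> dual n (H_sum h) (tail_mean \<alpha>) 0 (\<lambda>_. 0) \<Longrightarrow>
      \<bar>\<nu>\<bar> \<le> R \<and> (\<forall>i<n. \<bar>l i\<bar> \<le> R)"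
    using coercive[OF assms \<alpha>_dec \<alpha>_pos] by blast
  have sub: "{1..<n} \<subseteq> {..<n}" by auto
  have "\<exists>\<nu> l. (\<forall>i\<in>{1..<n}. 0 \<le> l i) \<and>
    (\<forall>\<nu>' l'. (\<forall>i\<in>{1..<n}. 0 \<le> l' i) \<longrightarrow> dual n (H_sum h) (tail_mean \<alpha>) \<nu> l \<le> dual n (H_sum h) (tail_mean \<alpha>) \<nu>' l')"
    using R by (intro H.dual_has_min[where R = R] sub allI impI)
  then obtain \<nu> l where l: "\<forall>i\<in>{1..<n}. 0 \<le> l i"
    and min_all: "\<forall>\<nu>' l'. (\<forall>i\<in>{1..<n}. 0 \<le> l' i) \<longrightarrow> dual n (H_sum h) (tail_mean \<alpha>) \<nu> l \<le> dual n (H_sum h) (tail_mean \<alpha>) \<nu>' l'"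
    by (elim exE conjE)
  have min: "dual n (H_sum h) (tail_mean \<alpha>) \<nu> l \<le> dual n (H_sum h) (tail_mean \<alpha>) \<nu>' l'" if "\<forall>i\<in>{1..<n}. 0 \<le> l' i" for \<nu>' l'
    using min_all[THEN spec, THEN spec, THEN mp, OF that] .
  have sets: "{1..n-1} = {1..<n}" by auto
  show thesis
  proof (intro that[of \<nu> l])
    fix q assume q: "q \<in> EC_multipliers n"
    obtain \<nu>' l' where q_eq: "q = (\<nu>', l')" by fastforce
    have "\<forall>i\<in>{1..<n}. 0 \<le> l' i" using q unfolding q_eq EC_multipliers_def sets by simp
    thus "G n h \<alpha> (\<nu>, l) \<le> G n h \<alpha> q" unfolding q_eq G_eq_dual by (rule min)
  next
    show "(\<nu>, l) \<in> EC_multipliers n" using l unfolding EC_multipliers_def sets by simp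
  qed
qed

text \<open>
  For \<open>\<alpha> 1 = 1\<close> coercivity fails on the whole space. On the cone of nonnegative multipliers the dual
  function only decreases when \<open>\<alpha> 1\<close> is lowered, and then it is coercive.
\<close>

lemma BC_minimizer:
  obtains \<nu> l where "(\<nu>, l) \<in> BC_multipliers n" "\<And>q. q \<in> BC_multipliers n \<Longrightarrow> G n h \<alpha> (\<nu>, l) \<le> G n h \<alpha> q"
proof -
  \<comment> \<open>The midpoint lies strictly below 1 and strictly above
    \<open>\<alpha> (Suc 1)\<close>, so lowering the first mean to it keeps the decrease
    strict.\<close>
  define \<beta> where "\<beta> = \<alpha>(1 := (\<alpha> 1 + \<alpha> (Suc 1)) / 2)"
  have \<alpha>12: "\<alpha> (Suc 1) < \<alpha> 1" using \<alpha>_dec[of 1] n_ge2 by simp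
  have \<beta>: "\<beta> 1 < 1" "\<And>k. k \<in> {1..<n} \<Longrightarrow> \<beta> (k + 1) < \<beta> k" "0 < \<beta> n"
  proof -
    show "\<beta> 1 < 1" "0 < \<beta> n" using \<alpha>12 \<alpha>_le \<alpha>_pos n_ge2 by (auto simp: \<beta>_def)
    show "\<beta> (k + 1) < \<beta> k" if "k \<in> {1..<n}" for k
      using \<alpha>_dec[OF that] \<alpha>12 that by (cases "k = 1") (auto simp: \<beta>_def)
  qed
  have tail: "tail_mean \<beta> i \<le> tail_mean \<alpha> i" for i
    unfolding tail_mean_def using h_pos \<alpha>12 by (intro sum_mono mult_left_mono) (auto simp: \<beta>_def less_imp_le)
  obtain R where R: "\<And>\<nu> l. dual n (H_sum h) (tail_mean \<beta>) \<nu> l \<le> dual n (H_sum h) (tail_mean \<alpha>) 0 (\<lambda>_. 0) \<Longrightarrow>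
      \<bar>\<nu>\<bar> \<le> R \<and> (\<forall>i<n. \<bar>l i\<bar> \<le> R)"
    using coercive[OF \<beta>] by blast
  have bnd: "\<bar>\<nu>\<bar> \<le> R \<and> (\<forall>i<n. \<bar>l i\<bar> \<le> R)"
    if "\<forall>i\<in>{..<n}. 0 \<le> l i" "dual n (H_sum h) (tail_mean \<alpha>) \<nu> l \<le> dual n (H_sum h) (tail_mean \<alpha>) 0 (\<lambda>_. 0)" for \<nu> l
  proof (rule R)
    have "(\<Sum>i<n. l i * tail_mean \<beta> i) \<le> (\<Sum>i<n. l i * tail_mean \<alpha> i)"
      using that(1) tail by (intro sum_mono mult_left_mono) auto
    thus "dual n (H_sum h) (tail_mean \<beta>) \<nu> l \<le> dual n (H_sum h) (tail_mean \<alpha>) 0 (\<lambda>_. 0)"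
      using that(2) by (simp add: dual_def)
  qed
  have "\<exists>\<nu> l. (\<forall>i\<in>{..<n}. 0 \<le> l i) \<and>
    (\<forall>\<nu>' l'. (\<forall>i\<in>{..<n}. 0 \<le> l' i) \<longrightarrow> dual n (H_sum h) (tail_mean \<alpha>) \<nu> l \<le> dual n (H_sum h) (tail_mean \<alpha>) \<nu>' l')"
    using bnd by (intro H.dual_has_min[where R = R] subset_refl allI impI)
  then obtain \<nu> l where l: "\<forall>i\<in>{..<n}. 0 \<le> l i"
    and min_all: "\<forall>\<nu>' l'. (\<forall>i\<in>{..<n}. 0 \<le> l' i) \<longrightarrow> dual n (H_sum h) (tail_mean \<alpha>) \<nu> l \<le> dual n (H_sum h) (tail_mean \<alpha>) \<nu>' l'"
    by (elim exE conjE)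
  have min: "dual n (H_sum h) (tail_mean \<alpha>) \<nu> l \<le> dual n (H_sum h) (tail_mean \<alpha>) \<nu>' l'" if "\<forall>i\<in>{..<n}. 0 \<le> l' i" for \<nu>' l'
    using min_all[THEN spec, THEN spec, THEN mp, OF that] .
  have sets: "{0..n-1} = {..<n}" using n_pos by auto
  show thesis
  proof (intro that[of \<nu> l])
    fix q assume q: "q \<in> BC_multipliers n"
    obtain \<nu>' l' where q_eq: "q = (\<nu>', l')" by fastforce
    have "\<forall>i\<in>{..<n}. 0 \<le> l' i" using q unfolding q_eq BC_multipliers_def sets by simp
    thus "G n h \<alpha> (\<nu>, l) \<le> G n h \<alpha> q" unfolding q_eq G_eq_dual by (rule min)
  next
    show "(\<nu>, l) \<in> BC_multipliers n" using l unfolding BC_multipliers_def sets by simp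
  qed
qed

text \<open>
  If \<open>\<alpha> 1 = 1\<close> then \<open>S \<ge> h 1\<close> almost surely. The dual problem of the densities on
  \<open>{h 1..1}\<close>, in which \<open>\<lambda>\<^sub>0\<close> and \<open>\<lambda>\<^sub>1\<close> enter only through their sum, has a minimizer, and
  its value is the limit of \<open>G\<close> along \<open>\<lambda>\<^sub>0 \<rightarrow> -\<infinity>\<close>.
\<close>

lemma EC_saturated:
  assumes "\<alpha> 1 = 1"
  obtains \<mu> g where "\<mu> \<in> EC_laws n \<alpha>"
    "\<And>\<sigma>. 0 < \<sigma> \<Longrightarrow> - (1 / 2) * ln (2 * pi * exp 1) + ln (1 / \<sigma>) + g \<le> channel_information n h \<sigma> \<mu>"
    "\<And>\<epsilon>. 0 < \<epsilon> \<Longrightarrow> \<exists>q\<in>EC_multipliers n. G n h \<alpha> q \<le> g + \<epsilon>"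
proof -
  define N where "N = n - 1"
  have N: "n = Suc N" "0 < N" using n_ge2 by (auto simp: N_def)
  \<comment> \<open>The knot 0, whose weight \<open>1 - \<alpha> 1\<close> is zero, is dropped and
    all indices move down by one.\<close>
  define a where "a j = H_sum h (Suc j)" for j
  define c where "c i = tail_mean \<alpha> (Suc i)" for i
  interpret K: knots N a
    using N h_pos by unfold_locales (auto simp: a_def H_sum_Suc)
  have a0: "a 0 = h 1" "0 < h 1" using h_pos[of 1] n_ge2 by (auto simp: a_def H_sum_def)
  have aN: "a N = 1" using H_sum_n N by (simp add: a_def)
  have a01: "a 0 \<le> 1" using K.knot_mono[of 0 N] aN by simp
  \<comment> \<open>Now \<open>\<alpha> 1 = 1\<close> itself supplies the leading step, and the
    remaining means continue it strictly downwards.\<close>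
  have "\<exists>R. \<forall>\<nu> l. dual N a c \<nu> l \<le> B \<longrightarrow> \<bar>\<nu>\<bar> \<le> R \<and> (\<forall>i<N. \<bar>l i\<bar> \<le> R)" for B
  proof (rule K.dual_coercive_steps[where b = "\<lambda>j. if j = 0 then 1 else if j \<le> N then \<alpha> (Suc j) else 0"])
    show "(if Suc j = 0 then 1 else if Suc j \<le> N then \<alpha> (Suc (Suc j)) else 0) < (if j = 0 then 1 else if j \<le> N then \<alpha> (Suc j) else 0)"
      if "j \<le> N" for j
      using \<alpha>_dec[of "Suc j"] \<alpha>_pos assms N that by (cases "j = N") auto
    fix i
    show "c i = (\<Sum>j=Suc i..N. (if j = 0 then 1 else if j \<le> N then \<alpha> (Suc j) else 0) * (a j - a (j - 1)))"
      unfolding c_def tail_mean_def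
    proof (rule sum.reindex_bij_witness[of _ Suc "\<lambda>j. j - 1"])
      fix j assume "j \<in> {Suc i + 1..n}"
      then obtain m where "j = Suc (Suc m)" "Suc m \<le> N" using N by (cases j; cases "j - 1") auto
      thus "(if j - 1 = 0 then 1 else if j - 1 \<le> N then \<alpha> (Suc (j - 1)) else 0) * (a (j - 1) - a (j - 1 - 1)) = h j * \<alpha> j"
        by (simp add: a_def H_sum_Suc)
    qed (use N in auto)
  qed auto
  then obtain R where R: "\<And>\<nu> l. dual N a c \<nu> l \<le> dual N a c 0 (\<lambda>_. 0) \<Longrightarrow> \<bar>\<nu>\<bar> \<le> R \<and> (\<forall>i<N. \<bar>l i\<bar> \<le> R)"
    by blast
  \<comment> \<open>Index 0 of the reduced problem stands for
    \<open>\<lambda>\<^sub>0 + \<lambda>\<^sub>1\<close>, whose sign is free because that of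
    \<open>\<lambda>\<^sub>0\<close> is. The condition at this index is therefore an equality, which
    fixes the mean of \<open>S\<close>.\<close>
  have sub: "{1..<N} \<subseteq> {..<N}" by auto
  have "\<exists>\<nu> l. (\<forall>i\<in>{1..<N}. 0 \<le> l i) \<and>
    (\<forall>\<nu>' l'. (\<forall>i\<in>{1..<N}. 0 \<le> l' i) \<longrightarrow> dual N a c \<nu> l \<le> dual N a c \<nu>' l')"
    using R by (intro K.dual_has_min[where R = R] sub allI impI)
  then obtain \<nu> l where l: "\<forall>i\<in>{1..<N}. 0 \<le> l i"
    and min_all: "\<forall>\<nu>' l'. (\<forall>i\<in>{1..<N}. 0 \<le> l' i) \<longrightarrow> dual N a c \<nu> l \<le> dual N a c \<nu>' l'"
    by (elim exE conjE)
  have min: "dual N a c \<nu> l \<le> dual N a c \<nu>' l'" if "\<forall>i\<in>{1..<N}. 0 \<le> l' i" for \<nu>' l'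
    using min_all[THEN spec, THEN spec, THEN mp, OF that] .
  note kkt = K.dual_kkt[OF sub l min, unfolded aN]
  define w where "w s = \<nu> - hinge_sum N a l s" for s
  have w: "continuous_on A w" for A unfolding w_def by (intro continuous_intros)
  have one: "integral {a 0..1} (\<lambda>s. exp (w s)) = 1" using kkt(1) by (simp add: w_def)
  have int: "f integrable_on {a 0..1}" if "continuous_on {a 0..1} f" for f :: "real \<Rightarrow> real"
    using that by (rule integrable_continuous_interval)
  have tail0: "tail_mean \<alpha> 0 = h 1 + c 0"
    using tail_mean_Suc[of 0] n_ge2 assms by (simp add: c_def)
  have mean0: "integral {a 0..1} (\<lambda>s. exp (w s) * s) = tail_mean \<alpha> 0"
  proof -
    have "integral {a 0..1} (\<lambda>s. exp (w s) * s) =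
        integral {a 0..1} (\<lambda>s. exp (w s) * hinge (a 0) s + h 1 * exp (w s))"
      by (intro integral_cong) (auto simp: hinge_def a0 algebra_simps)
    also have "\<dots> = integral {a 0..1} (\<lambda>s. exp (w s) * hinge (a 0) s) + integral {a 0..1} (\<lambda>s. h 1 * exp (w s))"
      by (intro integral_add int continuous_intros w)
    also have "\<dots> = tail_mean \<alpha> 0"
      using kkt(3)[of 0] N(2) one by (simp add: tail0 w_def)
    finally show ?thesis .
  qed
  have mean: "integral {a 0..1} (\<lambda>s. exp (w s) * hinge (H_sum h k) s) \<le> tail_mean \<alpha> k" if k: "k < n" for k
  proof (cases k)
    case 0
    have "integral {a 0..1} (\<lambda>s. exp (w s) * hinge (H_sum h k) s) = integral {a 0..1} (\<lambda>s. exp (w s) * s)"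
      using a0 by (intro integral_cong) (auto simp: 0 hinge_def H_sum_def)
    thus ?thesis using mean0 0 by simp
  next
    case (Suc i)
    thus ?thesis using kkt(2)[of i] k N by (simp add: w_def a_def c_def)
  qed
  have a0': "0 \<le> a 0" using a0 by simp
  obtain \<mu> where \<mu>: "\<mu> \<in> EC_laws n \<alpha>"
    "\<And>\<sigma>. 0 < \<sigma> \<Longrightarrow> - (1 / 2) * ln (2 * pi * exp 1) + ln (1 / \<sigma>) + - integral {a 0..1} (\<lambda>s. exp (w s) * w s)
      \<le> channel_information n h \<sigma> \<mu>"
    using law_attaining[OF \<alpha>_antimono w a0' a01 one mean] mean0 by blast
  have opt: "- integral {a 0..1} (\<lambda>s. exp (w s) * w s) = dual N a c \<nu> l"
    using kkt(4) by (simp add: w_def)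
  \<comment> \<open>Splits \<open>l 0\<close> into \<open>- t\<close> and \<open>l 0 + t\<close>.
    The sum is kept, and the second part, which must be nonnegative, becomes so for large
    \<open>t\<close>.\<close>
  define lt where "lt t i = (case i of 0 \<Rightarrow> - t | Suc j \<Rightarrow> (if j = 0 then l 0 + t else l j))" for t :: real and i
  have lt_Suc: "lt t (Suc j) = l j + (if j = 0 then t else 0)" and lt_0: "lt t 0 = - t" for t j
    by (auto simp: lt_def)
  have shift: "(\<Sum>i<n. lt t i * f i) = - t * f 0 + t * f 1 + (\<Sum>j<N. l j * f (Suc j))" for t and f :: "nat \<Rightarrow> real"
  proof -
    have "(\<Sum>i<n. lt t i * f i) = - t * f 0 + (\<Sum>j<N. l j * f (Suc j) + (if j = 0 then t * f 1 else 0))"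
      unfolding N(1) sum.lessThan_Suc_shift lt_0 lt_Suc
      by (intro arg_cong2[where f = "(+)"] sum.cong) (auto simp: algebra_simps)
    thus ?thesis using N(2) by (simp add: sum.distrib)
  qed
  have G_le: "G n h \<alpha> (\<nu> - t * h 1, lt t) \<le> dual N a c \<nu> l + exp \<nu> / t" if t: "0 < t" for t
  proof -
    have H01: "H_sum h 0 = 0" "H_sum h n = 1" using H_sum_n by (auto simp: H_sum_def)
    define W where "W s = (\<nu> - t * h 1) - hinge_sum n (H_sum h) (lt t) s" for s
    \<comment> \<open>From \<open>h 1\<close> on this is \<open>w\<close>. On
      \<open>{0..h 1}\<close> it rises with slope \<open>t\<close> up to \<nu>, so the added
      interval contributes at most \<open>exp \<nu> / t\<close> to the integral.\<close>
    have W: "W s = \<nu> - t * h 1 + t * hinge 0 s - t * hinge (h 1) s - hinge_sum N a l s" for s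
      unfolding W_def hinge_sum_def shift by (simp add: H01 a_def H_sum_def)
    have cW: "continuous_on A W" for A unfolding W_def by (intro continuous_intros)
    have "integral {0..1} (\<lambda>s. exp (W s)) = integral {0..a 0} (\<lambda>s. exp (W s)) + integral {a 0..1} (\<lambda>s. exp (W s))"
      using a0' a01
      by (intro Henstock_Kurzweil_Integration.integral_combine[symmetric] integrable_continuous_interval continuous_intros cW)
    also have "integral {a 0..1} (\<lambda>s. exp (W s)) = integral {a 0..1} (\<lambda>s. exp (w s))"
      using a0 by (intro integral_cong) (auto simp: W w_def hinge_def algebra_simps)
    also have "integral {0..a 0} (\<lambda>s. exp (W s)) = integral {0..0 + a 0} (\<lambda>s. exp ((\<nu> - t * h 1) - (- t) * (s - 0)))"
    proof -
      have "hinge_sum N a l s = 0" if "s \<le> a 0" for s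
        unfolding hinge_sum_def
      proof (intro sum.neutral ballI)
        fix i assume "i \<in> {..<N}"
        hence "s \<le> a i" using K.knot_mono[of 0 i] that by simp
        thus "l i * hinge (a i) s = 0" by (simp add: hinge_def)
      qed
      thus ?thesis using a0 by (simp, intro integral_cong) (simp add: W hinge_def)
    qed
    also have "\<dots> = exp (\<nu> - t * h 1) * a 0 * zeta (- (- t) * a 0)"
      using a0' by (rule zeta_integral)
    also have "\<dots> = exp (\<nu> - t * h 1) * (exp (t * h 1) - 1) / t"
      using t a0 by (simp add: zeta_def)
    also have "\<dots> \<le> exp \<nu> / t"
    proof -
      have "exp (\<nu> - t * h 1) * (exp (t * h 1) - 1) \<le> exp (\<nu> - t * h 1) * exp (t * h 1)"
        by (intro mult_left_mono) auto
      also have "\<dots> = exp \<nu>" by (simp flip: exp_add)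
      finally show ?thesis using t by (intro divide_right_mono) auto
    qed
    finally have I: "integral {0..1} (\<lambda>s. exp (W s)) \<le> exp \<nu> / t + integral {a 0..1} (\<lambda>s. exp (w s))" by simp
    have lin: "(\<Sum>i<n. lt t i * tail_mean \<alpha> i) = - t * h 1 + (\<Sum>j<N. l j * c j)"
      unfolding shift using tail0 by (simp add: c_def algebra_simps)
    have "G n h \<alpha> (\<nu> - t * h 1, lt t) = (\<Sum>i<n. lt t i * tail_mean \<alpha> i) - 1 - (\<nu> - t * h 1) + integral {0..1} (\<lambda>s. exp (W s))"
      unfolding G_eq_dual dual_def H01 W_def ..
    also have "\<dots> \<le> (\<Sum>j<N. l j * c j) - 1 - \<nu> + (exp \<nu> / t + integral {a 0..1} (\<lambda>s. exp (w s)))"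
      using I unfolding lin by simp
    finally show ?thesis unfolding dual_def aN w_def by simp
  qed
  have approx: "\<exists>q\<in>EC_multipliers n. G n h \<alpha> q \<le> dual N a c \<nu> l + \<epsilon>" if \<epsilon>: "0 < \<epsilon>" for \<epsilon>
  proof -
    define t where "t = max (exp \<nu> / \<epsilon>) (\<bar>l 0\<bar> + 1)"
    have t: "0 < t" "0 \<le> l 0 + t" by (auto simp: t_def)
    have "exp \<nu> / t \<le> \<epsilon>"
    proof -
      have "exp \<nu> / \<epsilon> \<le> t" by (simp add: t_def)
      thus ?thesis using t \<epsilon> by (simp add: pos_divide_le_eq mult.commute)
    qed
    moreover have "(\<nu> - t * h 1, lt t) \<in> EC_multipliers n"
      unfolding EC_multipliers_def
    proof (clarify, goal_cases)
      case (1 i)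
      then obtain j where "i = Suc j" "j < N" using N by (cases i) auto
      thus ?case using l t by (cases "j = 0") (auto simp: lt_Suc)
    qed
    ultimately show ?thesis using G_le[OF t(1)] by (intro bexI[of _ "(\<nu> - t * h 1, lt t)"]) auto
  qed
  show thesis
    using that[OF \<mu>(1), of "dual N a c \<nu> l"] \<mu>(2) approx unfolding opt by blast
qed

lemma EC_limit:
  "((\<lambda>\<sigma>. capacity_EC n h \<alpha> \<sigma> - ereal (ln (1 / \<sigma>)))
      \<longlongrightarrow> ereal (- (1 / 2) * ln (2 * pi * exp 1) + gamma_EC n h \<alpha>)) (at_right 0)"
  "bdd_below (G n h \<alpha> ` EC_multipliers n)"
proof -
  obtain \<mu> g where *: "\<mu> \<in> EC_laws n \<alpha>"
    "\<And>\<sigma>. 0 < \<sigma> \<Longrightarrow> - (1 / 2) * ln (2 * pi * exp 1) + ln (1 / \<sigma>) + g \<le> channel_information n h \<sigma> \<mu>"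
    "\<And>\<epsilon>. 0 < \<epsilon> \<Longrightarrow> \<exists>q\<in>EC_multipliers n. G n h \<alpha> q \<le> g + \<epsilon>"
  proof (cases "\<alpha> 1 = 1")
    case True
    thus thesis using EC_saturated that by blast
  next
    case False
    hence "\<alpha> 1 < 1" using \<alpha>_le by simp
    then obtain \<nu> l where m: "(\<nu>, l) \<in> EC_multipliers n"
      "\<And>q. q \<in> EC_multipliers n \<Longrightarrow> G n h \<alpha> (\<nu>, l) \<le> G n h \<alpha> q"
      using EC_minimizer by blast
    have sets: "{1..n-1} = {1..<n}" by auto
    have l: "\<forall>i\<in>{1..<n}. 0 \<le> l i" using m(1) unfolding EC_multipliers_def sets by simp
    have min: "dual n (H_sum h) (tail_mean \<alpha>) \<nu> l \<le> dual n (H_sum h) (tail_mean \<alpha>) \<nu>' l'"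
      if "\<forall>i\<in>{1..<n}. 0 \<le> l' i" for \<nu>' l'
      using m(2)[of "(\<nu>', l')"] that unfolding EC_multipliers_def sets G_eq_dual by simp
    have sub: "{1..<n} \<subseteq> {..<n}" by auto
    obtain \<mu> where "\<mu> \<in> EC_laws n \<alpha>"
      "\<And>\<sigma>. 0 < \<sigma> \<Longrightarrow> - (1 / 2) * ln (2 * pi * exp 1) + ln (1 / \<sigma>) + dual n (H_sum h) (tail_mean \<alpha>) \<nu> l
        \<le> channel_information n h \<sigma> \<mu>"
      using kkt_law[OF sub l min] by auto
    moreover have "\<exists>q\<in>EC_multipliers n. G n h \<alpha> q \<le> dual n (H_sum h) (tail_mean \<alpha>) \<nu> l + \<epsilon>" if "0 < \<epsilon>" for \<epsilon>
      using m(1) that by (intro bexI[of _ "(\<nu>, l)"]) (simp_all add: G_eq_dual)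
    ultimately show thesis using that by blast
  qed
  note lim = capacity_limit[OF EC_upper *]
  show "((\<lambda>\<sigma>. capacity_EC n h \<alpha> \<sigma> - ereal (ln (1 / \<sigma>)))
      \<longlongrightarrow> ereal (- (1 / 2) * ln (2 * pi * exp 1) + gamma_EC n h \<alpha>)) (at_right 0)"
    unfolding capacity_EC_def gamma_EC_def by (rule lim(2))
  show "bdd_below (G n h \<alpha> ` EC_multipliers n)" by (rule lim(1))
qed

lemma BC_limit:
  "((\<lambda>\<sigma>. capacity_BC n h \<alpha> \<sigma> - ereal (ln (1 / \<sigma>)))
      \<longlongrightarrow> ereal (- (1 / 2) * ln (2 * pi * exp 1) + gamma_BC n h \<alpha>)) (at_right 0)"
proof -
  obtain \<nu> l where m: "(\<nu>, l) \<in> BC_multipliers n"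
    "\<And>q. q \<in> BC_multipliers n \<Longrightarrow> G n h \<alpha> (\<nu>, l) \<le> G n h \<alpha> q"
    using BC_minimizer by blast
  have sets: "{0..n-1} = {..<n}" using n_pos by auto
  have l: "\<forall>i\<in>{..<n}. 0 \<le> l i" using m(1) unfolding BC_multipliers_def sets by simp
  have min: "dual n (H_sum h) (tail_mean \<alpha>) \<nu> l \<le> dual n (H_sum h) (tail_mean \<alpha>) \<nu>' l'"
    if "\<forall>i\<in>{..<n}. 0 \<le> l' i" for \<nu>' l'
    using m(2)[of "(\<nu>', l')"] that unfolding BC_multipliers_def sets G_eq_dual by simp
  obtain \<mu> where \<mu>: "\<mu> \<in> BC_laws n \<alpha>"
    "\<And>\<sigma>. 0 < \<sigma> \<Longrightarrow> - (1 / 2) * ln (2 * pi * exp 1) + ln (1 / \<sigma>) + dual n (H_sum h) (tail_mean \<alpha>) \<nu> l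
      \<le> channel_information n h \<sigma> \<mu>"
    using kkt_law[OF subset_refl l min] by blast
  have approx: "\<exists>q\<in>BC_multipliers n. G n h \<alpha> q \<le> dual n (H_sum h) (tail_mean \<alpha>) \<nu> l + \<epsilon>" if "0 < \<epsilon>" for \<epsilon>
    using m(1) that by (intro bexI[of _ "(\<nu>, l)"]) (simp_all add: G_eq_dual)
  show ?thesis
    unfolding capacity_BC_def gamma_BC_def by (rule capacity_limit(2)[OF BC_upper \<mu> approx])
qed

end

theorem theorem10:
  fixes n :: nat and h \<alpha> :: "nat \<Rightarrow> real"
  assumes "n \<ge> 2"
    and "\<And>k. k \<in> {1..n} \<Longrightarrow> h k > 0"
    and "(\<Sum>k=1..n. h k) = 1"
    and "\<alpha> 1 \<le> 1"
    and "\<And>k. k \<in> {1..<n} \<Longrightarrow> \<alpha> (k + 1) < \<alpha> k"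
    and "\<alpha> n > 0"
    and "\<alpha> n \<le> 1 / 2"
  shows "((\<lambda>\<sigma>. capacity_EC n h \<alpha> \<sigma> - ereal (ln (1 / \<sigma>)))
            \<longlongrightarrow> ereal (- (1 / 2) * ln (2 * pi * exp 1) + gamma_EC n h \<alpha>)) (at_right 0)
    \<and> ((\<lambda>\<sigma>. capacity_BC n h \<alpha> \<sigma> - ereal (ln (1 / \<sigma>)))
            \<longlongrightarrow> ereal (- (1 / 2) * ln (2 * pi * exp 1) + gamma_BC n h \<alpha>)) (at_right 0)
    \<and> bdd_below (G n h \<alpha> ` EC_multipliers n)
    \<and> (\<alpha> 1 < 1 \<longrightarrow> (\<exists>p. is_arg_min (G n h \<alpha>) (\<lambda>q. q \<in> EC_multipliers n) p))
    \<and> (\<exists>p. is_arg_min (G n h \<alpha>) (\<lambda>q. q \<in> BC_multipliers n) p)"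
proof -
  interpret decreasing_means n h \<alpha>
    using assms by unfold_locales auto
  have "\<exists>p. is_arg_min (G n h \<alpha>) (\<lambda>q. q \<in> EC_multipliers n) p" if "\<alpha> 1 < 1"
    using EC_minimizer[OF that] unfolding is_arg_min_def by (metis not_le)
  moreover have "\<exists>p. is_arg_min (G n h \<alpha>) (\<lambda>q. q \<in> BC_multipliers n) p"
    using BC_minimizer unfolding is_arg_min_def by (metis not_le)
  ultimately show ?thesis
    using EC_limit BC_limit by blast
qed

end
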